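(* Let $n\geq 2$, and let $M$ be any of the partition monoid $\mathcal P_n$, the partial Brauer monoid $\mathcal{PB}_n$, the planar partition monoid $\mathcal{PP}_n$ or the Motzkin monoid $\mathcal M_n$. Then $$\deg'(M)=|Q|\qquad\text{and}\qquad \deg(M)=\deg_{\mathrm{rc}}(M)=1+|Q|,$$ where $Q=\{\varepsilon\in P(M):\operatorname{rank}(\varepsilon)\leq 2\}$ is the set of projections of $M$ of rank at most $2$.
   Context: Diagram monoids. For an integer $n\ge 0$ let $\mathbf n=\{1,\dots,n\}$ and $\mathbf n'=\{1',\dots,n'\}$. $\mathcal P_n$ is the set of all set partitions of $\mathbf n\cup\mathbf n'$. Product of $\alpha,\beta\in\mathcal P_n$: with $\mathbf n''=\{1'',\dots,n''\}$, rename each $x'$ in $\alpha$ as $x''$ and each (unprimed) $x$ in $\beta$ as $x''$; consider the equivalence on $\mathbf n\cup\mathbf n''\cup\mathbf n'$ generated by the blocks of these two renamed partitions; $x,y\in\mathbf n\cup\mathbf n'$ are in the same block of $\alpha\beta$ iff they are related by this equivalence. This is a monoid with identity the partition with blocks $\{x,x'\}$. $\alpha^*$ is obtained from $\alpha$ by interchanging $x$ and $x'$ for all $x$. A transversal of $\alpha$ is a block meeting both $\mathbf n$ and $\mathbf n'$; $\operatorname{rank}(\alpha)$ is the number of transversals. $\alpha$ is planar if it can be drawn by a graph, whose connected components are the blocks, with vertices $1,\dots,n$ in order on an upper row and $1',\dots,n'$ in order on a lower row, with all edges inside the rectangle spanned by the vertices and with no crossings (equivalently, $\alpha$ is a non-crossing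 partition for the cyclic order $1,\dots,n,n',\dots,1'$). Submonoids: $\mathcal{PB}_n$ = all blocks of size $\leq 2$; $\mathcal{PP}_n$ = planar partitions; $\mathcal M_n=\mathcal{PP}_n\cap\mathcal{PB}_n$. For such a monoid $M$, $P(M)=\{\varepsilon\in M:\varepsilon^2=\varepsilon=\varepsilon^*\}$ is the set of projections. Degrees. $\mathcal T_m$ (resp. $\mathcal{PT}_m$) is the monoid of all maps (resp. partial maps) from $\{1,\dots,m\}$ to itself, composed left to right. For a finite semigroup $S$: $\deg(S)=\min\{m\ge1: S\text{ embeds in }\mathcal T_m\}$ and $\deg'(S)=\min\{m\geq1:S\text{ embeds in }\mathcal{PT}_m\}$, embeddings being injective semigroup homomorphisms. A right congruence $\sigma$ on $S$ is an equivalence with $(a,b)\in\sigma\Rightarrow(as,bs)\in\sigma$ for all $s \in S$; it gives a right action of $S$ on $S/\sigma$ by $([x]_\sigma,a)\mapsto[xa]_\sigma$, of degree $|S/\sigma|$. An action of $S$ on $X$ is faithful if distinct elements of $S$ induce distinct maps $X\to X$. $\deg_{\mathrm{rc}}(S)$ is the minimum of $|S/\sigma|$ over right congruences $\sigma$ whose associated action is faithful. *)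

theory Defs
  imports "HOL-Algebra.Group" "HOL-Library.Disjoint_Sets"
begin

text \<open>
  The vertices \<open>x\<close> and \<open>x'\<close> of a diagram are \<open>Upper x\<close> and \<open>Lower x\<close>; the vertices
  \<open>Middle x\<close> (that is, \<open>x''\<close>) occur only in the product of two diagrams.
\<close>

datatype vertex = Upper nat | Middle nat | Lower nat

type_synonym diagram = "vertex set set"

definition upper_row :: "nat \<Rightarrow> vertex set" where
  "upper_row n = Upper ` {1..n}"

definition lower_row :: "nat \<Rightarrow> vertex set" where
  "lower_row n = Lower ` {1..n}"

definition diagrams :: "nat \<Rightarrow> diagram set" where
  "diagrams n = {\<alpha>. partition_on (upper_row n \<union> lower_row n) \<alpha>}"

fun lower_to_middle :: "vertex \<Rightarrow> vertex" where
  "lower_to_middle (Lower x) = Middle x"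
| "lower_to_middle v = v"

fun upper_to_middle :: "vertex \<Rightarrow> vertex" where
  "upper_to_middle (Upper x) = Middle x"
| "upper_to_middle v = v"

fun flip_vertex :: "vertex \<Rightarrow> vertex" where
  "flip_vertex (Upper x) = Lower x"
| "flip_vertex (Lower x) = Upper x"
| "flip_vertex (Middle x) = Middle x"

definition in_common_block :: "diagram \<Rightarrow> (vertex \<times> vertex) set" where
  "in_common_block \<gamma> = {(x, y). \<exists>B\<in>\<gamma>. x \<in> B \<and> y \<in> B}"

text \<open>
  The relation \<open>in_common_block\<close> is symmetric, so its reflexive transitive closure is the
  equivalence generated by the blocks.
\<close>

definition product_equiv :: "diagram \<Rightarrow> diagram \<Rightarrow> (vertex \<times> vertex) set" where
  "product_equiv \<alpha> \<beta> =
     (in_common_block (image lower_to_middle ` \<alpha> \<union> image upper_to_middle ` \<beta>))\<^sup>*"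

definition diagram_mult :: "nat \<Rightarrow> diagram \<Rightarrow> diagram \<Rightarrow> diagram" where
  "diagram_mult n \<alpha> \<beta> =
     (let V = upper_row n \<union> lower_row n in V // (product_equiv \<alpha> \<beta> \<inter> V \<times> V))"

definition diagram_one :: "nat \<Rightarrow> diagram" where
  "diagram_one n = (\<lambda>x. {Upper x, Lower x}) ` {1..n}"

definition diagram_star :: "diagram \<Rightarrow> diagram" where
  "diagram_star \<alpha> = image flip_vertex ` \<alpha>"

definition transversals :: "diagram \<Rightarrow> diagram" where
  "transversals \<alpha> = {B \<in> \<alpha>. B \<inter> range Upper \<noteq> {} \<and> B \<inter> range Lower \<noteq> {}}"

definition diagram_rank :: "diagram \<Rightarrow> nat" where
  "diagram_rank \<alpha> = card (transversals \<alpha>)"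

text \<open>
  Planarity is non-crossing for the cyclic order \<open>1, \<dots>, n, n', \<dots>, 1'\<close>, which
  \<open>boundary_pos\<close> cuts open before \<open>1\<close>. Middle vertices do not occur in diagrams, so their
  position is immaterial.
\<close>

fun boundary_pos :: "nat \<Rightarrow> vertex \<Rightarrow> nat" where
  "boundary_pos n (Upper x) = x"
| "boundary_pos n (Lower x) = 2 * n + 1 - x"
| "boundary_pos n (Middle x) = 0"

definition planar :: "nat \<Rightarrow> diagram \<Rightarrow> bool" where
  "planar n \<alpha> \<longleftrightarrow>
     \<not> (\<exists>B\<in>\<alpha>. \<exists>C\<in>\<alpha>. B \<noteq> C \<and>
          (\<exists>a\<in>B. \<exists>b\<in>C. \<exists>c\<in>B. \<exists>d\<in>C.
             boundary_pos n a < boundary_pos n b \<and>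
             boundary_pos n b < boundary_pos n c \<and>
             boundary_pos n c < boundary_pos n d))"

definition partition_monoid :: "nat \<Rightarrow> diagram monoid" where
  "partition_monoid n =
     \<lparr>carrier = diagrams n, mult = diagram_mult n, one = diagram_one n\<rparr>"

definition partial_brauer_monoid :: "nat \<Rightarrow> diagram monoid" where
  "partial_brauer_monoid n =
     (partition_monoid n)\<lparr>carrier := {\<alpha> \<in> diagrams n. \<forall>B\<in>\<alpha>. card B \<le> 2}\<rparr>"

definition planar_partition_monoid :: "nat \<Rightarrow> diagram monoid" where
  "planar_partition_monoid n =
     (partition_monoid n)\<lparr>carrier := {\<alpha> \<in> diagrams n. planar n \<alpha>}\<rparr>"

definition motzkin_monoid :: "nat \<Rightarrow> diagram monoid" where
  "motzkin_monoid n =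
     (partition_monoid n)\<lparr>carrier :=
        carrier (planar_partition_monoid n) \<inter> carrier (partial_brauer_monoid n)\<rparr>"

definition projections :: "diagram monoid \<Rightarrow> diagram set" where
  "projections M =
     {\<epsilon> \<in> carrier M. \<epsilon> \<otimes>\<^bsub>M\<^esub> \<epsilon> = \<epsilon> \<and> diagram_star \<epsilon> = \<epsilon>}"

text \<open>
  Maps are composed left to right. Total maps of \<open>{1..m}\<close> are \<open>undefined\<close> outside \<open>{1..m}\<close>, so
  that they are determined by their values on that set.
\<close>

definition full_transformation_monoid :: "nat \<Rightarrow> (nat \<Rightarrow> nat) monoid" where
  "full_transformation_monoid m =
     \<lparr>carrier = {1..m} \<rightarrow>\<^sub>E {1..m},
      mult = (\<lambda>f g. compose {1..m} g f),
      one = (\<lambda>x\<in>{1..m}. x)\<rparr>"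

definition partial_transformation_monoid :: "nat \<Rightarrow> (nat \<rightharpoonup> nat) monoid" where
  "partial_transformation_monoid m =
     \<lparr>carrier = {f. dom f \<subseteq> {1..m} \<and> ran f \<subseteq> {1..m}},
      mult = (\<lambda>f g. g \<circ>\<^sub>m f),
      one = (\<lambda>x. if x \<in> {1..m} then Some x else None)\<rparr>"

text \<open>
  The set \<open>mon S T\<close> consists of the injective maps in \<open>hom S T\<close>; these are only required to
  preserve products, so they are the semigroup embeddings.
\<close>

definition transformation_degree :: "('a, 'b) monoid_scheme \<Rightarrow> nat" where
  "transformation_degree S =
     (LEAST m. m \<ge> 1 \<and> mon S (full_transformation_monoid m) \<noteq> {})"

definition partial_transformation_degree :: "('a, 'b) monoid_scheme \<Rightarrow> nat" where
  "partial_transformation_degree S =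
     (LEAST m. m \<ge> 1 \<and> mon S (partial_transformation_monoid m) \<noteq> {})"

definition right_congruence :: "('a, 'b) monoid_scheme \<Rightarrow> ('a \<times> 'a) set \<Rightarrow> bool" where
  "right_congruence S \<sigma> \<longleftrightarrow>
     equiv (carrier S) \<sigma> \<and>
     (\<forall>(a, b) \<in> \<sigma>. \<forall>s\<in>carrier S. (a \<otimes>\<^bsub>S\<^esub> s, b \<otimes>\<^bsub>S\<^esub> s) \<in> \<sigma>)"

text \<open>
  If \<open>\<sigma>\<close> is a right congruence and \<open>X\<close> is the class of \<open>x\<close>, then the products \<open>y \<otimes> a\<close> with
  \<open>y \<in> X\<close> lie in a single class, so \<open>class_action S \<sigma> X a\<close> is the class of \<open>x \<otimes> a\<close>.
\<close>

definition class_action ::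
    "('a, 'b) monoid_scheme \<Rightarrow> ('a \<times> 'a) set \<Rightarrow> 'a set \<Rightarrow> 'a \<Rightarrow> 'a set" where
  "class_action S \<sigma> X a = \<sigma> `` ((\<lambda>y. y \<otimes>\<^bsub>S\<^esub> a) ` X)"

definition faithful_action ::
    "('a, 'b) monoid_scheme \<Rightarrow> 'x set \<Rightarrow> ('x \<Rightarrow> 'a \<Rightarrow> 'x) \<Rightarrow> bool" where
  "faithful_action S X act \<longleftrightarrow> inj_on (\<lambda>a. \<lambda>x\<in>X. act x a) (carrier S)"

definition right_congruence_degree :: "('a, 'b) monoid_scheme \<Rightarrow> nat" where
  "right_congruence_degree S =
     (LEAST k. \<exists>\<sigma>. right_congruence S \<sigma> \<and>
        faithful_action S (carrier S // \<sigma>) (class_action S \<sigma>) \<and>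
        k = card (carrier S // \<sigma>))"

end

theory Submission
  imports Defs
begin

text \<open>
  Let \<open>M\<close> act faithfully on a finite set \<open>X\<close>, and let \<open>\<omega>\<close> be the diagram all of whose blocks are
  singletons. For \<open>r = 0, 1, 2\<close> let \<open>\<kappa>\<^sub>r\<close> be the diagram whose only non-singleton block is \<open>{1', 2'}\<close>,
  \<open>{1, 1'}\<close>, \<open>{1, 2}\<close> respectively, and pick \<open>x\<^sub>r \<in> X\<close> with \<open>x\<^sub>r \<kappa>\<^sub>r \<noteq> x\<^sub>r \<omega>\<close>. A projection \<open>\<epsilon>\<close> of rank
  \<open>r \<le> 2\<close> has a left multiple \<open>\<gamma>\<close> whose transversals start at the first \<open>r\<close> upper vertices and whose
  other upper vertices are isolated. The points \<open>x\<^sub>r \<gamma>\<close> are pairwise distinct: for two projections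
  of rank \<open>r\<close> some \<open>t \<in> M\<close> with at most two non-singleton blocks sends one of the two diagrams \<open>\<gamma>\<close> to
  \<open>\<kappa>\<^sub>r\<close> and the other one to \<open>\<omega>\<close>, while projections of different rank are told apart by a \<open>t\<close> that
  acts like \<open>\<omega>\<close> on all diagrams of smaller rank. One of \<open>x\<^sub>2 \<kappa>\<^sub>2\<close>, \<open>x\<^sub>2 \<omega>\<close> is a further point, so
  \<open>card X \<ge> 1 + card Q\<close>.

  Conversely, \<open>M\<close> acts on itself from the right, and it preserves the following data of a diagram:
  whether \<open>1\<close> and \<open>2\<close> lie in a common block and, if they do not, which lower vertices are
  joined to each other and which are joined to \<open>1\<close> or \<open>2\<close>. In the second case the data are those
  of a projection in \<open>Q\<close>. The resulting action has at most \<open>1 + card Q\<close> points, one of which is a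
  sink, and it is faithful.
\<close>

subsection \<open>Diagrams as equivalence relations\<close>

text \<open>All four monoids are treated at once, so every explicit factor must lie in the smallest
  of them, the Motzkin monoid: blocks of at most two vertices and no crossing. This shapes the
  tests. They consist of at most two strings, and where the obvious strings would cross, two of the
  vertices exchange roles. Rank 2 is the right bound because an element is determined by its
  products with left factors that have at most two strings: two strings show which upper vertices it
  joins, one string shows what an upper vertex is joined to below. The gap of one between the two
  degrees is the sink. Partial maps can leave it out; conversely, partial maps on m points become
  total on m + 1 points once a sink is added. A single lower bound, for total actions, therefore
  serves both degrees and the degree of right congruences.\<close>

definition vertices :: "nat \<Rightarrow> vertex set" where
  "vertices n = upper_row n \<union> lower_row n"

abbreviation rel :: "diagram \<Rightarrow> vertex \<Rightarrow> vertex \<Rightarrow> bool" where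
  "rel \<alpha> x y \<equiv> (x, y) \<in> in_common_block \<alpha>"

lemma vertices_simps [simp]:
  "Upper i \<in> vertices n \<longleftrightarrow> 1 \<le> i \<and> i \<le> n"
  "Lower i \<in> vertices n \<longleftrightarrow> 1 \<le> i \<and> i \<le> n"
  "Middle i \<notin> vertices n"
  by (auto simp: vertices_def upper_row_def lower_row_def)

lemma finite_vertices [simp]: "finite (vertices n)"
  by (simp add: vertices_def upper_row_def lower_row_def)

lemma diagrams_altdef: "diagrams n = {\<alpha>. partition_on (vertices n) \<alpha>}"
  by (simp add: diagrams_def vertices_def)

lemma equiv_in_common_block:
  assumes "\<alpha> \<in> diagrams n"
  shows "equiv (vertices n) (in_common_block \<alpha>)"
proof -
  have "in_common_block \<alpha> = {(x, y). \<exists>p\<in>\<alpha>. x \<in> p \<and> y \<in> p}"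
    by (simp add: in_common_block_def)
  then show ?thesis
    using equiv_partition_on assms by (auto simp: diagrams_altdef)
qed

lemma diagram_eq_quotient:
  assumes "\<alpha> \<in> diagrams n"
  shows "\<alpha> = vertices n // in_common_block \<alpha>"
  using partition_on_eq_quotient assms
  by (auto simp: diagrams_altdef in_common_block_def)

lemma quotient_in_diagrams:
  "equiv (vertices n) R \<Longrightarrow> vertices n // R \<in> diagrams n"
  by (simp add: diagrams_altdef partition_on_quotient)

lemma in_common_block_quotient:
  assumes R: "equiv A R"
  shows "in_common_block (A // R) = R"
proof -
  have "(x, y) \<in> R" if xy: "rel (A // R) x y" for x y
  proof -
    obtain B where B: "B \<in> A // R" "x \<in> B" "y \<in> B"
      using xy by (auto simp: in_common_block_def)
    then show "(x, y) \<in> R" using quotient_eq_iff[OF R B(1) B(1) B(2,3)] by simp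
  qed
  moreover have "rel (A // R) x y" if xy: "(x, y) \<in> R" for x y
  proof -
    have "x \<in> A" using xy equiv_type[OF R] by blast
    then have "R `` {x} \<in> A // R" "x \<in> R `` {x}"
      using equiv_class_self[OF R] by (auto intro: quotientI)
    with xy show "rel (A // R) x y" unfolding in_common_block_def by blast
  qed
  ultimately show ?thesis by auto
qed

lemma diagram_eqI:
  assumes "\<alpha> \<in> diagrams n" "\<beta> \<in> diagrams n" "\<And>x y. rel \<alpha> x y \<longleftrightarrow> rel \<beta> x y"
  shows "\<alpha> = \<beta>"
proof -
  have "in_common_block \<alpha> = in_common_block \<beta>" using assms(3) by auto
  then show ?thesis using assms(1,2) diagram_eq_quotient by metis
qed

lemma rel_vertices:
  assumes "\<alpha> \<in> diagrams n" "rel \<alpha> x y"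
  shows "x \<in> vertices n" "y \<in> vertices n"
  using equiv_in_common_block[OF assms(1)] assms(2) by (auto dest: equiv_type)

lemma rel_refl:
  assumes "\<alpha> \<in> diagrams n"
  shows "rel \<alpha> x x \<longleftrightarrow> x \<in> vertices n"
  using equiv_in_common_block[OF assms] rel_vertices[OF assms]
  by (meson equivE refl_onD)

lemma rel_sym: "rel \<alpha> x y \<Longrightarrow> rel \<alpha> y x"
  by (auto simp: in_common_block_def)

lemma rel_trans:
  "\<alpha> \<in> diagrams n \<Longrightarrow> rel \<alpha> x y \<Longrightarrow> rel \<alpha> y z \<Longrightarrow> rel \<alpha> x z"
  using equiv_in_common_block by (metis equivE transD)

lemma rel_Middle [simp]:
  assumes "\<alpha> \<in> diagrams n"
  shows "\<not> rel \<alpha> (Middle i) y" "\<not> rel \<alpha> y (Middle i)"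
  using rel_vertices[OF assms] vertices_simps(3) by blast+

lemma rel_bounds:
  assumes "\<alpha> \<in> diagrams n"
  shows "rel \<alpha> (Upper i) y \<Longrightarrow> 1 \<le> i \<and> i \<le> n" "rel \<alpha> (Lower i) y \<Longrightarrow> 1 \<le> i \<and> i \<le> n"
    "rel \<alpha> y (Upper i) \<Longrightarrow> 1 \<le> i \<and> i \<le> n" "rel \<alpha> y (Lower i) \<Longrightarrow> 1 \<le> i \<and> i \<le> n"
  using rel_vertices[OF assms] vertices_simps by blast+

lemma finite_diagrams: "finite (diagrams n)"
  unfolding diagrams_altdef by (rule finitely_many_partition_on) simp

subsection \<open>Products\<close>

abbreviation step :: "diagram \<Rightarrow> diagram \<Rightarrow> (vertex \<times> vertex) set" where
  "step \<alpha> \<beta> \<equiv> in_common_block (image lower_to_middle ` \<alpha> \<union> image upper_to_middle ` \<beta>)"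

lemma step_iff:
  "(u, v) \<in> step \<alpha> \<beta> \<longleftrightarrow>
     (\<exists>x y. rel \<alpha> x y \<and> u = lower_to_middle x \<and> v = lower_to_middle y) \<or>
     (\<exists>x y. rel \<beta> x y \<and> u = upper_to_middle x \<and> v = upper_to_middle y)"
proof -
  have "rel (image f ` \<gamma>) u v \<longleftrightarrow> (\<exists>x y. rel \<gamma> x y \<and> u = f x \<and> v = f y)"
    for f :: "vertex \<Rightarrow> vertex" and \<gamma>
    by (auto simp: in_common_block_def)
  moreover have "rel (\<gamma> \<union> \<delta>) u v \<longleftrightarrow> rel \<gamma> u v \<or> rel \<delta> u v" for \<gamma> \<delta>
    by (auto simp: in_common_block_def)
  ultimately show ?thesis by simp
qed

lemma equiv_product_equiv:
  "equiv (vertices n) (product_equiv \<alpha> \<beta> \<inter> vertices n \<times> vertices n)"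
proof (rule equivI)
  have "sym (product_equiv \<alpha> \<beta>)"
    unfolding product_equiv_def
    by (rule sym_rtrancl) (auto simp: sym_def in_common_block_def)
  then show "sym (product_equiv \<alpha> \<beta> \<inter> vertices n \<times> vertices n)"
    by (auto simp: sym_def)
  have "trans (product_equiv \<alpha> \<beta>)"
    unfolding product_equiv_def by (rule trans_rtrancl)
  then show "trans (product_equiv \<alpha> \<beta> \<inter> vertices n \<times> vertices n)"
    by (auto simp: trans_def)
qed (auto simp: refl_on_def product_equiv_def)

lemma diagram_mult_altdef:
  "diagram_mult n \<alpha> \<beta> = vertices n // (product_equiv \<alpha> \<beta> \<inter> vertices n \<times> vertices n)"
  by (simp add: diagram_mult_def vertices_def Let_def)

lemma diagram_mult_in_diagrams [simp]: "diagram_mult n \<alpha> \<beta> \<in> diagrams n"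
  unfolding diagram_mult_altdef by (rule quotient_in_diagrams[OF equiv_product_equiv])

lemma rel_mult:
  "rel (diagram_mult n \<alpha> \<beta>) x y \<longleftrightarrow>
     (x, y) \<in> (step \<alpha> \<beta>)\<^sup>* \<and> x \<in> vertices n \<and> y \<in> vertices n"
  unfolding diagram_mult_altdef in_common_block_quotient[OF equiv_product_equiv]
  by (auto simp: product_equiv_def)

text \<open>A walk between middle vertices may visit an outer row, but each visit stays in one block
  of \<alpha> or \<beta>. Connectivity of the middle row is therefore generated by the two inner
  kernels alone.\<close>

definition mid :: "diagram \<Rightarrow> diagram \<Rightarrow> (nat \<times> nat) set" where
  "mid \<alpha> \<beta> = {(p, q). rel \<alpha> (Lower p) (Lower q) \<or> rel \<beta> (Upper p) (Upper q)}\<^sup>*"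

lemma mid_sym: "(p, q) \<in> mid \<alpha> \<beta> \<Longrightarrow> (q, p) \<in> mid \<alpha> \<beta>"
proof -
  have "sym (mid \<alpha> \<beta>)"
    unfolding mid_def by (rule sym_rtrancl) (auto simp: sym_def dest: rel_sym)
  then show "(p, q) \<in> mid \<alpha> \<beta> \<Longrightarrow> (q, p) \<in> mid \<alpha> \<beta>" by (auto simp: sym_def)
qed

lemma mid_refl [simp]: "(p, p) \<in> mid \<alpha> \<beta>"
  by (simp add: mid_def)

lemma mid_trans: "(p, q) \<in> mid \<alpha> \<beta> \<Longrightarrow> (q, r) \<in> mid \<alpha> \<beta> \<Longrightarrow> (p, r) \<in> mid \<alpha> \<beta>"
  by (simp add: mid_def)

lemma mid_lower: "rel \<alpha> (Lower p) (Lower q) \<Longrightarrow> (p, q) \<in> mid \<alpha> \<beta>"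
  and mid_upper: "rel \<beta> (Upper p) (Upper q) \<Longrightarrow> (p, q) \<in> mid \<alpha> \<beta>"
  by (auto simp: mid_def)

lemma mid_step:
  "(p, q) \<in> mid \<alpha> \<beta> \<Longrightarrow> rel \<alpha> (Lower q) (Lower r) \<Longrightarrow> (p, r) \<in> mid \<alpha> \<beta>"
  "(p, q) \<in> mid \<alpha> \<beta> \<Longrightarrow> rel \<beta> (Upper q) (Upper r) \<Longrightarrow> (p, r) \<in> mid \<alpha> \<beta>"
  using mid_trans mid_lower mid_upper by blast+

lemma mid_step2:
  assumes "\<alpha> \<in> diagrams n" "\<beta> \<in> diagrams n"
  shows "(p, q) \<in> mid \<alpha> \<beta> \<Longrightarrow> rel \<alpha> (Lower q) x \<Longrightarrow> rel \<alpha> x (Lower r) \<Longrightarrow> (p, r) \<in> mid \<alpha> \<beta>"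
    "(p, q) \<in> mid \<alpha> \<beta> \<Longrightarrow> rel \<beta> (Upper q) x \<Longrightarrow> rel \<beta> x (Upper r) \<Longrightarrow> (p, r) \<in> mid \<alpha> \<beta>"
  using mid_step assms rel_trans by metis+

lemma mid_imp_steps: "(p, q) \<in> mid \<alpha> \<beta> \<Longrightarrow> (Middle p, Middle q) \<in> (step \<alpha> \<beta>)\<^sup>*"
  unfolding mid_def
proof (induction rule: rtrancl_induct)
  case (step q r)
  then have "(Middle q, Middle r) \<in> step \<alpha> \<beta>"
    by (force simp: step_iff)
  with step.IH show ?case by (rule rtrancl_into_rtrancl)
qed simp

lemma step_cases:
  assumes ab: "\<alpha> \<in> diagrams n" "\<beta> \<in> diagrams n"
  shows "(Upper i, Upper j) \<in> step \<alpha> \<beta> \<longleftrightarrow> rel \<alpha> (Upper i) (Upper j)"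
    "(Upper i, Middle q) \<in> step \<alpha> \<beta> \<longleftrightarrow> rel \<alpha> (Upper i) (Lower q)"
    "(Upper i, Lower j) \<notin> step \<alpha> \<beta>"
    "(Middle p, Upper j) \<in> step \<alpha> \<beta> \<longleftrightarrow> rel \<alpha> (Lower p) (Upper j)"
    "(Middle p, Middle q) \<in> step \<alpha> \<beta> \<longleftrightarrow> rel \<alpha> (Lower p) (Lower q) \<or> rel \<beta> (Upper p) (Upper q)"
    "(Middle p, Lower j) \<in> step \<alpha> \<beta> \<longleftrightarrow> rel \<beta> (Upper p) (Lower j)"
    "(Lower i, Upper j) \<notin> step \<alpha> \<beta>"
    "(Lower i, Middle q) \<in> step \<alpha> \<beta> \<longleftrightarrow> rel \<beta> (Lower i) (Upper q)"
    "(Lower i, Lower j) \<in> step \<alpha> \<beta> \<longleftrightarrow> rel \<beta> (Lower i) (Lower j)"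
proof -
  have l: "lower_to_middle x = Upper k \<longleftrightarrow> x = Upper k" "lower_to_middle x \<noteq> Lower k"
    "lower_to_middle x = Middle k \<longleftrightarrow> x = Lower k \<or> x = Middle k"
    "upper_to_middle x = Lower k \<longleftrightarrow> x = Lower k" "upper_to_middle x \<noteq> Upper k"
    "upper_to_middle x = Middle k \<longleftrightarrow> x = Upper k \<or> x = Middle k" for x k
    by (cases x; auto)+
  have l2: "Upper k = lower_to_middle x \<longleftrightarrow> x = Upper k" "Lower k \<noteq> lower_to_middle x"
    "Middle k = lower_to_middle x \<longleftrightarrow> x = Lower k \<or> x = Middle k"
    "Lower k = upper_to_middle x \<longleftrightarrow> x = Lower k" "Upper k \<noteq> upper_to_middle x"
    "Middle k = upper_to_middle x \<longleftrightarrow> x = Upper k \<or> x = Middle k" for x k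
    using l by metis+
  show "(Upper i, Upper j) \<in> step \<alpha> \<beta> \<longleftrightarrow> rel \<alpha> (Upper i) (Upper j)"
    "(Upper i, Middle q) \<in> step \<alpha> \<beta> \<longleftrightarrow> rel \<alpha> (Upper i) (Lower q)"
    "(Upper i, Lower j) \<notin> step \<alpha> \<beta>"
    "(Middle p, Upper j) \<in> step \<alpha> \<beta> \<longleftrightarrow> rel \<alpha> (Lower p) (Upper j)"
    "(Middle p, Middle q) \<in> step \<alpha> \<beta> \<longleftrightarrow> rel \<alpha> (Lower p) (Lower q) \<or> rel \<beta> (Upper p) (Upper q)"
    "(Middle p, Lower j) \<in> step \<alpha> \<beta> \<longleftrightarrow> rel \<beta> (Upper p) (Lower j)"
    "(Lower i, Upper j) \<notin> step \<alpha> \<beta>"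
    "(Lower i, Middle q) \<in> step \<alpha> \<beta> \<longleftrightarrow> rel \<beta> (Lower i) (Upper q)"
    "(Lower i, Lower j) \<in> step \<alpha> \<beta> \<longleftrightarrow> rel \<beta> (Lower i) (Lower j)"
    using rel_Middle[OF ab(1)] rel_Middle[OF ab(2)] by (auto simp: step_iff l2)
qed

text \<open>Walks from the upper row are brought into a form in which at most the first and the last
  step leave the middle row. When a walk enters an outer row and returns, \<open>mid_step2\<close>
  absorbs the detour into \<open>mid\<close>.\<close>

lemma steps_from_Upper:
  assumes ab: "\<alpha> \<in> diagrams n" "\<beta> \<in> diagrams n" and i: "1 \<le> i" "i \<le> n"
    and "(Upper i, v) \<in> (step \<alpha> \<beta>)\<^sup>*"
  shows "case v of
      Upper j \<Rightarrow> rel \<alpha> (Upper i) (Upper j) \<or>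
        (\<exists>p q. rel \<alpha> (Upper i) (Lower p) \<and> (p, q) \<in> mid \<alpha> \<beta> \<and> rel \<alpha> (Lower q) (Upper j))
    | Middle q \<Rightarrow> \<exists>p. rel \<alpha> (Upper i) (Lower p) \<and> (p, q) \<in> mid \<alpha> \<beta>
    | Lower j \<Rightarrow> \<exists>p q. rel \<alpha> (Upper i) (Lower p) \<and> (p, q) \<in> mid \<alpha> \<beta> \<and> rel \<beta> (Upper q) (Lower j)"
  using assms(5)
proof (induction rule: rtrancl_induct)
  case base
  then show ?case using rel_refl[OF ab(1)] i by simp
next
  case (step v w)
  then show ?case
    by (cases v; cases w; simp add: step_cases[OF ab];
        blast intro: rel_trans[OF ab(1)] rel_trans[OF ab(2)] mid_refl mid_step mid_step2[OF ab])
qed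

lemma steps_from_Lower:
  assumes ab: "\<alpha> \<in> diagrams n" "\<beta> \<in> diagrams n" and i: "1 \<le> i" "i \<le> n"
    and "(Lower i, v) \<in> (step \<alpha> \<beta>)\<^sup>*"
  shows "case v of
      Lower j \<Rightarrow> rel \<beta> (Lower i) (Lower j) \<or>
        (\<exists>p q. rel \<beta> (Lower i) (Upper p) \<and> (p, q) \<in> mid \<alpha> \<beta> \<and> rel \<beta> (Upper q) (Lower j))
    | Middle q \<Rightarrow> \<exists>p. rel \<beta> (Lower i) (Upper p) \<and> (p, q) \<in> mid \<alpha> \<beta>
    | Upper j \<Rightarrow> \<exists>p q. rel \<beta> (Lower i) (Upper p) \<and> (p, q) \<in> mid \<alpha> \<beta> \<and> rel \<alpha> (Lower q) (Upper j)"
  using assms(5)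
proof (induction rule: rtrancl_induct)
  case base
  then show ?case using rel_refl[OF ab(2)] i by simp
next
  case (step v w)
  then show ?case
    by (cases v; cases w; simp add: step_cases[OF ab];
        blast intro: rel_trans[OF ab(1)] rel_trans[OF ab(2)] mid_refl mid_step mid_step2[OF ab])
qed

lemma Upper_Lower_stepsI:
  assumes ab: "\<alpha> \<in> diagrams n" "\<beta> \<in> diagrams n"
  shows "rel \<alpha> x (Lower p) \<Longrightarrow> x = Upper i \<Longrightarrow> (p, q) \<in> mid \<alpha> \<beta> \<Longrightarrow> (x, Middle q) \<in> (step \<alpha> \<beta>)\<^sup>*"
    "rel \<beta> (Upper p) y \<Longrightarrow> y = Lower j \<Longrightarrow> (q, p) \<in> mid \<alpha> \<beta> \<Longrightarrow> (Middle q, y) \<in> (step \<alpha> \<beta>)\<^sup>*"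
    "rel \<alpha> (Lower p) x \<Longrightarrow> x = Upper i \<Longrightarrow> (q, p) \<in> mid \<alpha> \<beta> \<Longrightarrow> (Middle q, x) \<in> (step \<alpha> \<beta>)\<^sup>*"
    "rel \<beta> y (Upper p) \<Longrightarrow> y = Lower j \<Longrightarrow> (p, q) \<in> mid \<alpha> \<beta> \<Longrightarrow> (y, Middle q) \<in> (step \<alpha> \<beta>)\<^sup>*"
  using mid_imp_steps step_cases[OF ab]
  by (meson converse_rtrancl_into_rtrancl rtrancl_into_rtrancl)+

lemma rel_mult_Upper_Upper:
  assumes ab: "\<alpha> \<in> diagrams n" "\<beta> \<in> diagrams n"
  shows "rel (diagram_mult n \<alpha> \<beta>) (Upper i) (Upper j) \<longleftrightarrow> rel \<alpha> (Upper i) (Upper j) \<or>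
    (\<exists>p q. rel \<alpha> (Upper i) (Lower p) \<and> (p, q) \<in> mid \<alpha> \<beta> \<and> rel \<alpha> (Lower q) (Upper j))"
    (is "?L \<longleftrightarrow> ?R")
proof
  assume ?L
  then show ?R using steps_from_Upper[OF ab] by (fastforce simp: rel_mult)
next
  assume R: ?R
  then have v: "Upper i \<in> vertices n" "Upper j \<in> vertices n"
    using rel_vertices[OF ab(1)] by blast+
  from R have "(Upper i, Upper j) \<in> (step \<alpha> \<beta>)\<^sup>*"
  proof (elim disjE exE conjE)
    fix p q assume "rel \<alpha> (Upper i) (Lower p)" "(p, q) \<in> mid \<alpha> \<beta>" "rel \<alpha> (Lower q) (Upper j)"
    then show ?thesis
      using Upper_Lower_stepsI(1)[OF ab _ refl] Upper_Lower_stepsI(3)[OF ab _ refl mid_refl]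
      by (meson rtrancl_trans)
  qed (use step_cases[OF ab] in blast)
  with v show ?L by (simp add: rel_mult)
qed

lemma rel_mult_Upper_Lower:
  assumes ab: "\<alpha> \<in> diagrams n" "\<beta> \<in> diagrams n"
  shows "rel (diagram_mult n \<alpha> \<beta>) (Upper i) (Lower j) \<longleftrightarrow>
    (\<exists>p q. rel \<alpha> (Upper i) (Lower p) \<and> (p, q) \<in> mid \<alpha> \<beta> \<and> rel \<beta> (Upper q) (Lower j))"
    (is "?L \<longleftrightarrow> ?R")
proof
  assume ?L
  then show ?R using steps_from_Upper[OF ab] by (fastforce simp: rel_mult)
next
  assume R: ?R
  then have v: "Upper i \<in> vertices n" "Lower j \<in> vertices n"
    using rel_vertices[OF ab(1)] rel_vertices[OF ab(2)] by blast+
  from R obtain p q where "rel \<alpha> (Upper i) (Lower p)" "(p, q) \<in> mid \<alpha> \<beta>" "rel \<beta> (Upper q) (Lower j)"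
    by blast
  then have "(Upper i, Lower j) \<in> (step \<alpha> \<beta>)\<^sup>*"
    using Upper_Lower_stepsI(1)[OF ab _ refl] Upper_Lower_stepsI(2)[OF ab _ refl mid_refl]
    by (meson rtrancl_trans)
  with v show ?L by (simp add: rel_mult)
qed

lemma rel_mult_Lower_Upper:
  assumes ab: "\<alpha> \<in> diagrams n" "\<beta> \<in> diagrams n"
  shows "rel (diagram_mult n \<alpha> \<beta>) (Lower j) (Upper i) \<longleftrightarrow>
    (\<exists>p q. rel \<alpha> (Upper i) (Lower p) \<and> (p, q) \<in> mid \<alpha> \<beta> \<and> rel \<beta> (Upper q) (Lower j))"
  using rel_mult_Upper_Lower[OF ab] rel_sym by blast

lemma rel_mult_Lower_Lower:
  assumes ab: "\<alpha> \<in> diagrams n" "\<beta> \<in> diagrams n"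
  shows "rel (diagram_mult n \<alpha> \<beta>) (Lower i) (Lower j) \<longleftrightarrow> rel \<beta> (Lower i) (Lower j) \<or>
    (\<exists>p q. rel \<beta> (Lower i) (Upper p) \<and> (p, q) \<in> mid \<alpha> \<beta> \<and> rel \<beta> (Upper q) (Lower j))"
    (is "?L \<longleftrightarrow> ?R")
proof
  assume ?L
  then show ?R using steps_from_Lower[OF ab] by (fastforce simp: rel_mult)
next
  assume R: ?R
  then have v: "Lower i \<in> vertices n" "Lower j \<in> vertices n"
    using rel_vertices[OF ab(2)] by blast+
  from R have "(Lower i, Lower j) \<in> (step \<alpha> \<beta>)\<^sup>*"
  proof (elim disjE exE conjE)
    fix p q assume "rel \<beta> (Lower i) (Upper p)" "(p, q) \<in> mid \<alpha> \<beta>" "rel \<beta> (Upper q) (Lower j)"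
    then show ?thesis
      using Upper_Lower_stepsI(4)[OF ab _ refl] Upper_Lower_stepsI(2)[OF ab _ refl mid_refl]
      by (meson rtrancl_trans)
  qed (use step_cases[OF ab] in blast)
  with v show ?L by (simp add: rel_mult)
qed

lemmas rel_mult_cases =
  rel_mult_Upper_Upper rel_mult_Upper_Lower rel_mult_Lower_Upper rel_mult_Lower_Lower

subsection \<open>Associativity\<close>

text \<open>
  The diagram \<open>\<alpha>\<close> drawn with its upper row on row \<open>r\<close> and its lower row on row \<open>s\<close>.
\<close>

fun place :: "nat \<Rightarrow> nat \<Rightarrow> nat \<Rightarrow> vertex \<Rightarrow> nat \<times> nat" where
  "place r m s (Upper x) = (r, x)"
| "place r m s (Middle x) = (m, x)"
| "place r m s (Lower x) = (s, x)"

definition placed :: "nat \<Rightarrow> nat \<Rightarrow> diagram \<Rightarrow> ((nat \<times> nat) \<times> (nat \<times> nat)) set" where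
  "placed r s \<alpha> = {(place r 0 s x, place r 0 s y) |x y. rel \<alpha> x y}"

lemma inj_place: "r \<noteq> s \<Longrightarrow> r \<noteq> m \<Longrightarrow> m \<noteq> s \<Longrightarrow> inj (place r m s)"
  unfolding inj_def
  by (intro allI, case_tac x; case_tac y; simp)

lemma rtrancl_map_inj:
  assumes "inj h"
  shows "(h x, h y) \<in> (map_prod h h ` R)\<^sup>* \<longleftrightarrow> (x, y) \<in> R\<^sup>*"
proof
  assume "(x, y) \<in> R\<^sup>*"
  then show "(h x, h y) \<in> (map_prod h h ` R)\<^sup>*"
  proof induction
    case (step y z)
    then have "(h y, h z) \<in> map_prod h h ` R" by force
    with step.IH show ?case by (rule rtrancl_into_rtrancl)
  qed simp
next
  have "\<exists>z. v = h z \<and> (x, z) \<in> R\<^sup>*" if "(h x, v) \<in> (map_prod h h ` R)\<^sup>*" for v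
    using that
  proof induction
    case (step v w)
    then show ?case using assms by (force dest: injD intro: rtrancl_into_rtrancl)
  qed auto
  then show "(x, y) \<in> R\<^sup>*" if "(h x, h y) \<in> (map_prod h h ` R)\<^sup>*"
    using that assms by (auto dest: injD)
qed

text \<open>\<open>place r m s\<close> is injective and carries \<open>step\<close> onto the union
  of the two drawings, hence walks onto walks; the intersection forgets the middle row. Numbered
  rows allow three diagrams to be drawn at once, for which \<open>vertex\<close> has too few
  rows.\<close>

lemma placed_mult:
  assumes ab: "\<alpha> \<in> diagrams n" "\<beta> \<in> diagrams n" and d: "r \<noteq> s" "r \<noteq> m" "m \<noteq> s"
  shows "placed r s (diagram_mult n \<alpha> \<beta>) =
    (placed r m \<alpha> \<union> placed m s \<beta>)\<^sup>* \<inter> ({r, s} \<times> {1..n}) \<times> ({r, s} \<times> {1..n})"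
proof -
  let ?h = "place r m s"
  note inj = inj_place[OF d]
  have h1: "?h (lower_to_middle x) = place r 0 m x" if "x \<in> vertices n" for x
    using that by (cases x) auto
  have h2: "?h (upper_to_middle x) = place m 0 s x" if "x \<in> vertices n" for x
    using that by (cases x) auto
  have "map_prod ?h ?h ` step \<alpha> \<beta> = placed r m \<alpha> \<union> placed m s \<beta>" (is "?A = ?B")
  proof (intro equalityI subsetI)
    fix z assume "z \<in> ?A"
    then obtain u v where z: "z = (?h u, ?h v)" and "(u, v) \<in> step \<alpha> \<beta>" by auto
    then consider x y where "rel \<alpha> x y" "u = lower_to_middle x" "v = lower_to_middle y"
      | x y where "rel \<beta> x y" "u = upper_to_middle x" "v = upper_to_middle y"
      unfolding step_iff by blast
    then show "z \<in> ?B"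
    proof cases
      case 1
      then show ?thesis using h1 rel_vertices[OF ab(1)] z unfolding placed_def by blast
    next
      case 2
      then show ?thesis using h2 rel_vertices[OF ab(2)] z unfolding placed_def by blast
    qed
  next
    fix z assume "z \<in> ?B"
    then consider x y where "rel \<alpha> x y" "z = (place r 0 m x, place r 0 m y)"
      | x y where "rel \<beta> x y" "z = (place m 0 s x, place m 0 s y)"
      by (auto simp: placed_def)
    then show "z \<in> ?A"
    proof cases
      case 1
      then have "z = map_prod ?h ?h (lower_to_middle x, lower_to_middle y)"
        using h1 rel_vertices[OF ab(1)] by auto
      then show ?thesis using 1 step_iff by blast
    next
      case 2
      then have "z = map_prod ?h ?h (upper_to_middle x, upper_to_middle y)"
        using h2 rel_vertices[OF ab(2)] by auto
      then show ?thesis using 2 step_iff by blast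
    qed
  qed
  then have *: "(?h x, ?h y) \<in> (placed r m \<alpha> \<union> placed m s \<beta>)\<^sup>* \<longleftrightarrow> (x, y) \<in> (step \<alpha> \<beta>)\<^sup>*" for x y
    using rtrancl_map_inj[OF inj] by metis
  have V: "v \<in> {r, s} \<times> {1..n} \<longleftrightarrow> (\<exists>x\<in>vertices n. v = ?h x)" for v
    by (auto simp: vertices_def upper_row_def lower_row_def bex_Un)
  have h0: "place r 0 s x = ?h x" if "x \<in> vertices n" for x
    using that by (cases x) auto
  have "(u, v) \<in> placed r s (diagram_mult n \<alpha> \<beta>) \<longleftrightarrow>
      (\<exists>x\<in>vertices n. \<exists>y\<in>vertices n. u = ?h x \<and> v = ?h y \<and> (x, y) \<in> (step \<alpha> \<beta>)\<^sup>*)" for u v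
    unfolding placed_def rel_mult using h0 by (auto; metis)
  also have "\<dots> u v \<longleftrightarrow> (u, v) \<in> (placed r m \<alpha> \<union> placed m s \<beta>)\<^sup>* \<and>
      u \<in> {r, s} \<times> {1..n} \<and> v \<in> {r, s} \<times> {1..n}" for u v
    unfolding V using * by metis
  finally show ?thesis by auto
qed

text \<open>Inner vertices may be eliminated early: \<open>S\<close> touches only \<open>T\<close>,
  so a walk splits into stretches of \<open>R\<close> between points of \<open>T\<close>, and by
  \<open>RQ\<close> each stretch can be replaced by a walk in \<open>Q\<close>.\<close>

lemma rtrancl_Un_restrict:
  assumes S: "S \<subseteq> T \<times> T" and QR: "Q \<subseteq> R\<^sup>*"
    and RQ: "\<And>x y. (x, y) \<in> R\<^sup>* \<Longrightarrow> x \<in> T \<Longrightarrow> y \<in> T \<Longrightarrow> (x, y) \<in> Q\<^sup>*"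
    and xy: "x \<in> T" "y \<in> T"
  shows "(x, y) \<in> (Q \<union> S)\<^sup>* \<longleftrightarrow> (x, y) \<in> (R \<union> S)\<^sup>*"
proof
  have "Q \<union> S \<subseteq> (R \<union> S)\<^sup>*"
    using QR rtrancl_mono[of R "R \<union> S"] by auto
  then have "(Q \<union> S)\<^sup>* \<subseteq> (R \<union> S)\<^sup>*"
    using rtrancl_subset_rtrancl by blast
  then show "(x, y) \<in> (Q \<union> S)\<^sup>* \<Longrightarrow> (x, y) \<in> (R \<union> S)\<^sup>*" by blast
next
  have Q: "(u, v) \<in> (Q \<union> S)\<^sup>*" if "(u, v) \<in> Q\<^sup>*" for u v
    using that rtrancl_mono[of Q "Q \<union> S"] by auto
  \<comment> \<open>Invariant: z is a point of \<open>T\<close> from which only steps of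
    \<open>R\<close> have been made since.\<close>
  have "\<exists>z\<in>T. (x, z) \<in> (Q \<union> S)\<^sup>* \<and> (z, v) \<in> R\<^sup>*" if "(x, v) \<in> (R \<union> S)\<^sup>*" for v
    using that
  proof induction
    case base
    then show ?case using xy by auto
  next
    case (step v w)
    then obtain z where z: "z \<in> T" "(x, z) \<in> (Q \<union> S)\<^sup>*" "(z, v) \<in> R\<^sup>*" by blast
    show ?case
    proof (cases "(v, w) \<in> R")
      case True
      then show ?thesis using z by (meson rtrancl_into_rtrancl)
    next
      case False
      then have vw: "(v, w) \<in> S" using step by auto
      then have "(z, v) \<in> Q\<^sup>*" using RQ z S by auto
      then have "(x, w) \<in> (Q \<union> S)\<^sup>*"
        using z Q vw by (meson UnI2 rtrancl.rtrancl_into_rtrancl rtrancl_trans)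
      then show ?thesis using vw S by auto
    qed
  qed
  then show "(x, y) \<in> (Q \<union> S)\<^sup>*" if "(x, y) \<in> (R \<union> S)\<^sup>*"
    using that RQ xy Q by (meson rtrancl_trans)
qed

lemma placed_subset:
  assumes "\<alpha> \<in> diagrams n"
  shows "placed r s \<alpha> \<subseteq> ({r, s} \<times> {1..n}) \<times> ({r, s} \<times> {1..n})"
proof -
  have "place r 0 s x \<in> {r, s} \<times> {1..n}" if "x \<in> vertices n" for x
    using that by (cases x) auto
  then show ?thesis using rel_vertices[OF assms] unfolding placed_def by blast
qed

lemma placed_eq_imp_eq:
  assumes ab: "\<alpha> \<in> diagrams n" "\<beta> \<in> diagrams n" and "placed 1 2 \<alpha> = placed 1 2 \<beta>"
  shows "\<alpha> = \<beta>"
proof (rule diagram_eqI[OF ab])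
  fix x y
  have "rel \<gamma> x y \<longleftrightarrow> (place 1 0 2 x, place 1 0 2 y) \<in> placed 1 2 \<gamma>" for \<gamma>
    using inj_place[of 1 2 0] by (auto simp: placed_def dest: injD)
  then show "rel \<alpha> x y \<longleftrightarrow> rel \<beta> x y" using assms(3) by simp
qed

lemma rtrancl_Field: "(x, y) \<in> R\<^sup>* \<Longrightarrow> x = y \<or> x \<in> Field R \<and> y \<in> Field R"
  by (metis FieldI1 FieldI2 converse_rtranclE rtranclE)

lemma diagram_mult_assoc:
  assumes "\<alpha> \<in> diagrams n" "\<beta> \<in> diagrams n" "\<gamma> \<in> diagrams n"
  shows "diagram_mult n (diagram_mult n \<alpha> \<beta>) \<gamma> = diagram_mult n \<alpha> (diagram_mult n \<beta> \<gamma>)"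
proof -
  \<comment> \<open>Rows 1 and 2 are the outer rows, 3 and 4 the two inner ones. Both bracketings
    turn out to be the closure of all three drawings, cut down to the outer rows.\<close>
  define A where "A = placed 1 3 \<alpha>"
  define B where "B = placed 3 4 \<beta>"
  define C where "C = placed 4 2 \<gamma>"
  let ?V = "({1, 2} \<times> {1..n}) \<times> ({1, 2} \<times> {1..n})"
  note sub = placed_subset[OF assms(1), of 1 3, folded A_def]
    placed_subset[OF assms(2), of 3 4, folded B_def] placed_subset[OF assms(3), of 4 2, folded C_def]
  define Q1 where "Q1 = placed 1 4 (diagram_mult n \<alpha> \<beta>)"
  define Q2 where "Q2 = placed 3 2 (diagram_mult n \<beta> \<gamma>)"
  have Q1: "Q1 = (A \<union> B)\<^sup>* \<inter> ({1, 4} \<times> {1..n}) \<times> ({1, 4} \<times> {1..n})"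
    unfolding Q1_def A_def B_def by (rule placed_mult) (use assms in auto)
  have Q2: "Q2 = (B \<union> C)\<^sup>* \<inter> ({3, 2} \<times> {1..n}) \<times> ({3, 2} \<times> {1..n})"
    unfolding Q2_def B_def C_def by (rule placed_mult) (use assms in auto)
  have "placed 1 2 (diagram_mult n (diagram_mult n \<alpha> \<beta>) \<gamma>) = (Q1 \<union> C)\<^sup>* \<inter> ?V"
    unfolding Q1_def C_def by (rule placed_mult) (use assms in auto)
  also have "\<dots> = (A \<union> B \<union> C)\<^sup>* \<inter> ?V"
  proof -
    have "(x, y) \<in> (Q1 \<union> C)\<^sup>* \<longleftrightarrow> (x, y) \<in> ((A \<union> B) \<union> C)\<^sup>*"
      if "x \<in> ({1, 2} \<times> {1..n})" "y \<in> ({1, 2} \<times> {1..n})" for x y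
    \<comment> \<open>Row 3 is the one swallowed by the first product, and \<open>C\<close> does not
      meet it.\<close>
    proof (rule rtrancl_Un_restrict[where T = "{v. fst v \<noteq> 3}"])
      fix x y :: "nat \<times> nat"
      assume xy: "(x, y) \<in> (A \<union> B)\<^sup>*" "x \<in> {v. fst v \<noteq> 3}" "y \<in> {v. fst v \<noteq> 3}"
      have "Field (A \<union> B) \<subseteq> {1, 3, 4} \<times> {1..n}" using sub by (auto simp: Field_def)
      then have "x = y \<or> x \<in> {1, 4} \<times> {1..n} \<and> y \<in> {1, 4} \<times> {1..n}"
        using rtrancl_Field[OF xy(1)] xy(2,3) by auto
      then show "(x, y) \<in> Q1\<^sup>*" using xy(1) unfolding Q1 by blast
    qed (use that sub Q1 in auto)
    then show ?thesis by (auto 0 3)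
  qed
  also have "\<dots> = (Q2 \<union> A)\<^sup>* \<inter> ?V"
  proof -
    have "(x, y) \<in> (Q2 \<union> A)\<^sup>* \<longleftrightarrow> (x, y) \<in> ((B \<union> C) \<union> A)\<^sup>*"
      if "x \<in> ({1, 2} \<times> {1..n})" "y \<in> ({1, 2} \<times> {1..n})" for x y
    proof (rule rtrancl_Un_restrict[where T = "{v. fst v \<noteq> 4}"])
      fix x y :: "nat \<times> nat"
      assume xy: "(x, y) \<in> (B \<union> C)\<^sup>*" "x \<in> {v. fst v \<noteq> 4}" "y \<in> {v. fst v \<noteq> 4}"
      have "Field (B \<union> C) \<subseteq> {2, 3, 4} \<times> {1..n}" using sub by (auto simp: Field_def)
      then have "x = y \<or> x \<in> {3, 2} \<times> {1..n} \<and> y \<in> {3, 2} \<times> {1..n}"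
        using rtrancl_Field[OF xy(1)] xy(2,3) by auto
      then show "(x, y) \<in> Q2\<^sup>*" using xy(1) unfolding Q2 by blast
    qed (use that sub Q2 in auto)
    moreover have "(B \<union> C) \<union> A = A \<union> B \<union> C" by auto
    ultimately show ?thesis by (auto 0 3)
  qed
  also have "\<dots> = placed 1 2 (diagram_mult n \<alpha> (diagram_mult n \<beta> \<gamma>))"
    unfolding Q2_def A_def Un_commute[of _ "placed 1 3 \<alpha>"]
    by (rule placed_mult[symmetric]) (use assms in auto)
  finally show ?thesis
    by (intro placed_eq_imp_eq[of _ n]) auto
qed

subsection \<open>Planarity and block sizes\<close>

text \<open>Blocks are disjoint, so \<open>rel \<alpha> a b\<close> expresses that the two blocks
  which seem to cross coincide.\<close>

lemma planar_iff:
  assumes "\<alpha> \<in> diagrams n"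
  shows "planar n \<alpha> \<longleftrightarrow> (\<forall>a b c d. boundary_pos n a < boundary_pos n b \<longrightarrow>
    boundary_pos n b < boundary_pos n c \<longrightarrow> boundary_pos n c < boundary_pos n d \<longrightarrow>
    rel \<alpha> a c \<longrightarrow> rel \<alpha> b d \<longrightarrow> rel \<alpha> a b)" (is "_ \<longleftrightarrow> ?R")
proof
  assume p: "planar n \<alpha>"
  show ?R
  proof (intro allI impI)
    fix a b c d
    assume pos: "boundary_pos n a < boundary_pos n b" "boundary_pos n b < boundary_pos n c"
      "boundary_pos n c < boundary_pos n d" and "rel \<alpha> a c" "rel \<alpha> b d"
    then obtain B C where BC: "B \<in> \<alpha>" "C \<in> \<alpha>" "a \<in> B" "c \<in> B" "b \<in> C" "d \<in> C"
      by (auto simp: in_common_block_def)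
    have "B = C"
    proof (rule ccontr)
      assume "B \<noteq> C"
      then have "\<not> planar n \<alpha>"
        unfolding planar_def not_not
        by (intro bexI[of _ B] bexI[of _ C] conjI bexI[of _ a] bexI[of _ b] bexI[of _ c]
            bexI[of _ d] pos BC)
      then show False using p by simp
    qed
    then show "rel \<alpha> a b" using BC by (auto simp: in_common_block_def)
  qed
next
  assume R: ?R
  show "planar n \<alpha>"
    unfolding planar_def
  proof (rule notI, elim bexE conjE)
    fix B C a b c d
    assume *: "B \<in> \<alpha>" "C \<in> \<alpha>" "B \<noteq> C" "a \<in> B" "b \<in> C" "c \<in> B" "d \<in> C"
      and pos: "boundary_pos n a < boundary_pos n b" "boundary_pos n b < boundary_pos n c"
      "boundary_pos n c < boundary_pos n d"
    then have "rel \<alpha> a c" "rel \<alpha> b d" by (auto simp: in_common_block_def)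
    with R pos have "rel \<alpha> a b" by blast
    then obtain D where D: "D \<in> \<alpha>" "a \<in> D" "b \<in> D" by (auto simp: in_common_block_def)
    have "disjoint \<alpha>" using assms by (auto simp: diagrams_altdef dest: partition_onD2)
    then have "B = D" "C = D" using * D by (auto simp: disjoint_def)
    with * show False by simp
  qed
qed

lemma blocks_card_le_2_iff:
  assumes "\<alpha> \<in> diagrams n"
  shows "(\<forall>B\<in>\<alpha>. card B \<le> 2) \<longleftrightarrow>
    (\<forall>x y z. rel \<alpha> x y \<longrightarrow> rel \<alpha> x z \<longrightarrow> x = y \<or> x = z \<or> y = z)" (is "_ \<longleftrightarrow> ?R")
proof
  assume c: "\<forall>B\<in>\<alpha>. card B \<le> 2"
  show ?R
  proof (intro allI impI)
    fix x y z assume xyz: "rel \<alpha> x y" "rel \<alpha> x z"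
    then have "rel \<alpha> y z" using rel_trans[OF assms] rel_sym by blast
    have "disjoint \<alpha>" using assms by (auto simp: diagrams_altdef dest: partition_onD2)
    then obtain B where B: "B \<in> \<alpha>" "x \<in> B" "y \<in> B" "z \<in> B"
      using xyz by (auto simp: in_common_block_def disjoint_def)
    have "B \<subseteq> vertices n"
      using assms B by (auto simp: diagrams_altdef dest: partition_onD1)
    \<comment> \<open>An infinite block would have \<open>card\<close> equal to 0, so finiteness
      comes before counting.\<close>
    then have "finite B" using finite_subset finite_vertices by blast
    then have "card {x, y, z} \<le> card B" using B by (intro card_mono) auto
    then have "card {x, y, z} \<le> 2" using c B by force
    then show "x = y \<or> x = z \<or> y = z" by (auto simp: card_insert_if split: if_splits)
  qed
next
  assume R: ?R
  show "\<forall>B\<in>\<alpha>. card B \<le> 2"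
  proof
    fix B assume B: "B \<in> \<alpha>"
    show "card B \<le> 2"
    proof (rule ccontr)
      assume "\<not> card B \<le> 2"
      then have "3 \<le> card B" by simp
      then obtain T where "T \<subseteq> B" "card T = 3" by (meson obtain_subset_with_card_n)
      then obtain x y z where "x \<in> B" "y \<in> B" "z \<in> B" "x \<noteq> y" "x \<noteq> z" "y \<noteq> z"
        by (auto simp: card_3_iff)
      then show False using R B by (auto simp: in_common_block_def)
    qed
  qed
qed

text \<open>The flags switch planarity and the bound on block sizes on and off; their four
  combinations give the four monoids, so that one argument covers them all.\<close>

definition diagram_family :: "nat \<Rightarrow> bool \<Rightarrow> bool \<Rightarrow> diagram set" where
  "diagram_family n pl br =
    {\<alpha> \<in> diagrams n. (pl \<longrightarrow> planar n \<alpha>) \<and> (br \<longrightarrow> (\<forall>B\<in>\<alpha>. card B \<le> 2))}"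

subsection \<open>Closure under products\<close>

text \<open>
  The product arises by placing the two boundaries next to each other in a line and joining \<open>k'\<close> of
  the first diagram to \<open>k\<close> of the second one, for \<open>k = 1, \<dots>, n\<close> in turn. Once joined, the two
  vertices are deleted, so that each time the two vertices to be joined are adjacent.
\<close>

definition glue :: "'a \<Rightarrow> 'a \<Rightarrow> ('a \<Rightarrow> 'a \<Rightarrow> bool) \<Rightarrow> 'a \<Rightarrow> 'a \<Rightarrow> bool" where
  "glue p q R x y \<longleftrightarrow> R x y \<or> R x p \<and> R q y \<or> R x q \<and> R p y"

text \<open>Deleting vertices shrinks only \<open>S\<close>. The relation keeps speaking about them,
  so that it can be compared with the walks of the product afterwards.\<close>

definition noncrossing :: "('a \<Rightarrow> nat) \<Rightarrow> 'a set \<Rightarrow> ('a \<Rightarrow> 'a \<Rightarrow> bool) \<Rightarrow> bool" where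
  "noncrossing f S R \<longleftrightarrow> (\<forall>a\<in>S. \<forall>b\<in>S. \<forall>c\<in>S. \<forall>d\<in>S.
     f a < f b \<longrightarrow> f b < f c \<longrightarrow> f c < f d \<longrightarrow> R a c \<longrightarrow> R b d \<longrightarrow> R a b)"

definition at_most_pairs :: "'a set \<Rightarrow> ('a \<Rightarrow> 'a \<Rightarrow> bool) \<Rightarrow> bool" where
  "at_most_pairs S R \<longleftrightarrow>
    (\<forall>x\<in>S. \<forall>y\<in>S. \<forall>z\<in>S. R x y \<longrightarrow> R x z \<longrightarrow> x = y \<or> x = z \<or> y = z)"

lemma symp_glue: "symp R \<Longrightarrow> symp (glue p q R)"
  unfolding symp_def glue_def by blast

text \<open>If a path uses the new link twice, then either both uses meet at the same end or p and q
  were related before; in both cases the ends of the path are related without the link.\<close>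

lemma transp_glue:
  assumes "symp R" "transp R"
  shows "transp (glue p q R)"
proof -
  have s: "R x y \<Longrightarrow> R y x" for x y using assms(1) by (simp add: symp_def)
  have t: "R x y \<Longrightarrow> R y z \<Longrightarrow> R x z" for x y z using assms(2) by (meson transpE)
  show ?thesis
  proof (rule transpI)
    fix x y z assume "glue p q R x y" "glue p q R y z"
    then show "glue p q R x z" unfolding glue_def using s t by metis
  qed
qed

text \<open>Each of p and q has at most one other partner in \<open>S\<close>, and the gluing makes
  a pair of these two partners.\<close>

lemma at_most_pairs_glue:
  assumes S: "at_most_pairs S R" "p \<in> S" "q \<in> S"
  shows "at_most_pairs (S - {p, q}) (glue p q R)"
proof -
  have m: "x = y \<or> x = z \<or> y = z" if "R x y" "R x z" "x \<in> S" "y \<in> S" "z \<in> S" for x y z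
    using S(1) that unfolding at_most_pairs_def by blast
  show ?thesis unfolding at_most_pairs_def
  proof (intro ballI impI)
    fix x y z
    assume v: "x \<in> S - {p, q}" "y \<in> S - {p, q}" "z \<in> S - {p, q}"
    assume "glue p q R x y" "glue p q R x z"
    then show "x = y \<or> x = z \<or> y = z"
      using v S(2,3) m[of x y z] m[of q y z] m[of p y z] m[of x y p] m[of x y q] m[of x z p] m[of x z q]
        m[of x p q] unfolding glue_def by blast
  qed
qed

lemma noncrossing_glue:
  assumes R: "symp R" "transp R" and S: "noncrossing f S R" "p \<in> S" "q \<in> S" "f p < f q"
    and adj: "\<And>v. v \<in> S - {p, q} \<Longrightarrow> f v < f p \<or> f q < f v"
  shows "noncrossing f (S - {p, q}) (glue p q R)"
proof -
  have s: "R x y \<Longrightarrow> R y x" for x y using R(1) by (simp add: symp_def)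
  have t: "R x y \<Longrightarrow> R y z \<Longrightarrow> R x z" for x y z using R(2) by (meson transpE)
  have n: "R a b" if "R a c" "R b d" "f a < f b" "f b < f c" "f c < f d"
      "a \<in> S" "b \<in> S" "c \<in> S" "d \<in> S" for a b c d
    using S(1) that unfolding noncrossing_def by blast
  show ?thesis unfolding noncrossing_def
  proof (intro ballI impI)
    fix a b c d
    assume v: "a \<in> S - {p, q}" "b \<in> S - {p, q}" "c \<in> S - {p, q}" "d \<in> S - {p, q}"
      and f: "f a < f b" "f b < f c" "f c < f d"
      and g: "glue p q R a c" "glue p q R b d"
    have S': "a \<in> S" "b \<in> S" "c \<in> S" "d \<in> S" using v by auto
    \<comment> \<open>The chord from a to c separates b from d. The neighbours p' and q' lie on the
      same side of it, so it is crossed either by the chord from b to p' or by the chord from q' to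
      d.\<close>
    have b_d: "glue p q R a b" if R: "R a c" "R b p'" "R q' d" and pq: "{p', q'} = {p, q}" for p' q'
    proof -
      have pq_S: "p' \<in> S" "q' \<in> S" using pq S(2,3) by (auto simp: doubleton_eq_iff)
      have side: "f v < f p' \<and> f v < f q' \<or> f p' < f v \<and> f q' < f v" if "v \<in> S - {p, q}" for v
        using adj[OF that] S(4) pq by (auto simp: doubleton_eq_iff)
      consider "f p' < f a" | "f a < f q'" "f q' < f c" | "f c < f p'"
        using side[OF v(1)] side[OF v(3)] by linarith
      then have "R a b \<or> R a q'"
      proof cases
        case 1
        then have "R p' a" using n[of p' b a c] R s f S' pq_S by blast
        then show ?thesis using R s t by blast
      next
        case 2
        then show ?thesis using n[of a c q' d] R f S' pq_S by blast
      next
        case 3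
        then show ?thesis using n[of a c b p'] R f S' pq_S by blast
      qed
      then show ?thesis using R s pq unfolding glue_def by (auto simp: doubleton_eq_iff)
    qed
    \<comment> \<open>The same with the chords exchanged: b and d are related directly and the link
      joins a to c.\<close>
    have a_c: "glue p q R a b" if R: "R b d" "R a p'" "R q' c" and pq: "{p', q'} = {p, q}" for p' q'
    proof -
      have pq_S: "p' \<in> S" "q' \<in> S" using pq S(2,3) by (auto simp: doubleton_eq_iff)
      have side: "f v < f p' \<and> f v < f q' \<or> f p' < f v \<and> f q' < f v" if "v \<in> S - {p, q}" for v
        using adj[OF that] S(4) pq by (auto simp: doubleton_eq_iff)
      consider "f q' < f b" | "f b < f p'" "f p' < f d" | "f d < f q'"
        using side[OF v(2)] side[OF v(4)] by linarith
      then have "R a b \<or> R q' b"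
      proof cases
        case 1
        then show ?thesis using n[of q' c b d] R f S' pq_S by blast
      next
        case 2
        then show ?thesis using n[of a p' b d] R f S' pq_S by blast
      next
        case 3
        then have "R b c" using n[of b d c q'] R s f S' pq_S by blast
        then show ?thesis using R s t by blast
      qed
      then show ?thesis using R s pq unfolding glue_def by (auto simp: doubleton_eq_iff)
    qed
    \<comment> \<open>If both pairs use the link, then each of a and b is related to p or q, and
      this already relates them after gluing.\<close>
    from g show "glue p q R a b"
      using b_d[of p q] b_d[of q p] a_c[of p q] a_c[of q p] n[of a c b d] f S' s t
      unfolding glue_def by (elim disjE conjE) (blast | simp)+
  qed
qed

fun glue_base :: "diagram \<Rightarrow> diagram \<Rightarrow> vertex + vertex \<Rightarrow> vertex + vertex \<Rightarrow> bool" where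
  "glue_base \<alpha> \<beta> (Inl x) (Inl y) = rel \<alpha> x y"
| "glue_base \<alpha> \<beta> (Inr x) (Inr y) = rel \<beta> x y"
| "glue_base \<alpha> \<beta> _ _ = False"

fun glued :: "diagram \<Rightarrow> diagram \<Rightarrow> nat \<Rightarrow> vertex + vertex \<Rightarrow> vertex + vertex \<Rightarrow> bool" where
  "glued \<alpha> \<beta> 0 = glue_base \<alpha> \<beta>"
| "glued \<alpha> \<beta> (Suc k) = glue (Inl (Lower (Suc k))) (Inr (Upper (Suc k))) (glued \<alpha> \<beta> k)"

lemma glue_base_symp: "symp (glue_base \<alpha> \<beta>)"
proof (rule sympI)
  fix x y assume "glue_base \<alpha> \<beta> x y"
  then show "glue_base \<alpha> \<beta> y x" by (cases x; cases y) (auto dest: rel_sym)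
qed

lemma glue_base_transp:
  assumes "\<alpha> \<in> diagrams n" "\<beta> \<in> diagrams n"
  shows "transp (glue_base \<alpha> \<beta>)"
proof (rule transpI)
  fix x y z assume "glue_base \<alpha> \<beta> x y" "glue_base \<alpha> \<beta> y z"
  then show "glue_base \<alpha> \<beta> x z"
    by (cases x; cases y; cases z) (auto intro: rel_trans[OF assms(1)] rel_trans[OF assms(2)])
qed

lemma glued_symp: "symp (glued \<alpha> \<beta> k)"
  by (induction k) (auto intro: glue_base_symp symp_glue)

lemma glued_transp:
  assumes "\<alpha> \<in> diagrams n" "\<beta> \<in> diagrams n"
  shows "transp (glued \<alpha> \<beta> k)"
  by (induction k) (auto intro: glue_base_transp[OF assms] transp_glue glued_symp)

section \<open>Comparison of the glued relation with the product\<close>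

fun vertex_outer :: "vertex \<Rightarrow> vertex + vertex" where
  "vertex_outer (Lower i) = Inr (Lower i)"
| "vertex_outer v = Inl v"

fun vertex_merge :: "vertex + vertex \<Rightarrow> vertex" where
  "vertex_merge (Inl x) = lower_to_middle x"
| "vertex_merge (Inr x) = upper_to_middle x"

lemma glued_imp_steps:
  assumes ab: "\<alpha> \<in> diagrams n" "\<beta> \<in> diagrams n" 
  shows "glued \<alpha> \<beta> k x y \<Longrightarrow> (vertex_merge x, vertex_merge y) \<in> (step \<alpha> \<beta>)\<^sup>*"
proof (induction k arbitrary: x y)
  case 0
  then have "(vertex_merge x, vertex_merge y) \<in> step \<alpha> \<beta>"
    by (cases x; cases y) (auto simp: step_iff)
  then show ?case by blast
next
  case (Suc k)
  \<comment> \<open>Both ends of a link represent the same middle vertex, so passing along a link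
    takes no step.\<close>
  have "vertex_merge (Inl (Lower (Suc k))) = vertex_merge (Inr (Upper (Suc k)))" by simp
  with Suc show ?case unfolding glued.simps glue_def by (metis rtrancl_trans)
qed

lemma glued_mono: "k \<le> m \<Longrightarrow> glued \<alpha> \<beta> k x y \<Longrightarrow> glued \<alpha> \<beta> m x y"
  by (induction m rule: dec_induct) (auto simp: glue_def)

lemma glued_pair:
  assumes ab: "\<alpha> \<in> diagrams n" "\<beta> \<in> diagrams n" and "1 \<le> k" "k \<le> n"
  shows "glued \<alpha> \<beta> n (Inl (Lower k)) (Inr (Upper k))"
proof -
  obtain j where j: "k = Suc j" using assms(3) by (cases k) auto
  \<comment> \<open>\<open>glue\<close> relates its two ends only if they are related to themselves;
    this is where k must lie in range.\<close>
  have "glued \<alpha> \<beta> j (Inl (Lower k)) (Inl (Lower k))" "glued \<alpha> \<beta> j (Inr (Upper k)) (Inr (Upper k))"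
    using assms rel_refl[OF ab(1)] rel_refl[OF ab(2)] by (auto intro!: glued_mono[of 0 j])
  then have "glued \<alpha> \<beta> k (Inl (Lower k)) (Inr (Upper k))" by (simp add: j glue_def)
  then show ?thesis using glued_mono assms(4) by blast
qed

text \<open>\<open>mid\<close> is reflexive on all numbers but \<open>glued\<close> only on
  vertices, hence the bounds on p. A step in the upper kernel of \<beta> is transported to the first
  copy along the links at its two ends.\<close>

lemma mid_imp_glued:
  assumes ab: "\<alpha> \<in> diagrams n" "\<beta> \<in> diagrams n" and pq: "(p, q) \<in> mid \<alpha> \<beta>" and p: "1 \<le> p" "p \<le> n"
  shows "glued \<alpha> \<beta> n (Inl (Lower p)) (Inl (Lower q))"
  using pq unfolding mid_def
proof (induction rule: rtrancl_induct)
  case base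
  have "rel \<alpha> (Lower p) (Lower p)" using rel_refl[OF ab(1)] p by simp
  then show ?case by (auto intro!: glued_mono[of 0 n])
next
  case (step q r)
  have t: "glued \<alpha> \<beta> n x y \<Longrightarrow> glued \<alpha> \<beta> n y z \<Longrightarrow> glued \<alpha> \<beta> n x z" for x y z
    using glued_transp[OF ab] by (meson transpE)
  have s: "glued \<alpha> \<beta> n x y \<Longrightarrow> glued \<alpha> \<beta> n y x" for x y
    using glued_symp by (meson sympE)
  from step(2) have "glued \<alpha> \<beta> n (Inl (Lower q)) (Inl (Lower r))"
  proof (elim CollectE case_prodE Pair_inject disjE, goal_cases)
    case 1
    then show ?case by (auto intro!: glued_mono[of 0 n])
  next
    case 2
    then have "glued \<alpha> \<beta> n (Inr (Upper q)) (Inr (Upper r))"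
      by (auto intro!: glued_mono[of 0 n])
    moreover have "1 \<le> q" "q \<le> n" "1 \<le> r" "r \<le> n"
      using 2 rel_bounds[OF ab(2)] by blast+
    ultimately show ?case using glued_pair[OF ab] s t by meson
  qed
  then show ?case using step.IH t by blast
qed

lemma glued_imp_rel_mult:
  assumes ab: "\<alpha> \<in> diagrams n" "\<beta> \<in> diagrams n" and v: "x \<in> vertices n" "y \<in> vertices n"
    and "glued \<alpha> \<beta> n (vertex_outer x) (vertex_outer y)"
  shows "rel (diagram_mult n \<alpha> \<beta>) x y"
proof -
  have "vertex_merge (vertex_outer x) = x" if "x \<in> vertices n" for x
    using that by (cases x) auto
  then show ?thesis using glued_imp_steps[OF ab assms(5)] v by (simp add: rel_mult)
qed

lemma rel_mult_imp_glued:
  assumes ab: "\<alpha> \<in> diagrams n" "\<beta> \<in> diagrams n" and r: "rel (diagram_mult n \<alpha> \<beta>) x y"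
  shows "glued \<alpha> \<beta> n (vertex_outer x) (vertex_outer y)"
proof -
  have t: "glued \<alpha> \<beta> n x y \<Longrightarrow> glued \<alpha> \<beta> n y z \<Longrightarrow> glued \<alpha> \<beta> n x z" for x y z
    using glued_transp[OF ab] by (meson transpE)
  have s: "glued \<alpha> \<beta> n x y \<Longrightarrow> glued \<alpha> \<beta> n y x" for x y
    using glued_symp by (meson sympE)
  have l: "glued \<alpha> \<beta> n (Inl x) (Inl y)" if "rel \<alpha> x y" for x y
    using that by (auto intro!: glued_mono[of 0 n])
  have r: "glued \<alpha> \<beta> n (Inr x) (Inr y)" if "rel \<beta> x y" for x y
    using that by (auto intro!: glued_mono[of 0 n])
  have UL: "glued \<alpha> \<beta> n (Inl (Upper i)) (Inr (Lower j))"
    if "rel \<alpha> (Upper i) (Lower p)" "(p, q) \<in> mid \<alpha> \<beta>" "rel \<beta> (Upper q) (Lower j)" for i j p q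
  proof -
    have "1 \<le> p" "p \<le> n" "1 \<le> q" "q \<le> n"
      using that rel_bounds[OF ab(1)] rel_bounds[OF ab(2)] by blast+
    then show ?thesis
      using l[OF that(1)] r[OF that(3)] mid_imp_glued[OF ab that(2)] glued_pair[OF ab, of q] t
      by meson
  qed
  have UU: "glued \<alpha> \<beta> n (Inl (Upper i)) (Inl (Upper j))"
    if "rel \<alpha> (Upper i) (Lower p)" "(p, q) \<in> mid \<alpha> \<beta>" "rel \<alpha> (Lower q) (Upper j)" for i j p q
  proof -
    have "1 \<le> p" "p \<le> n"
      using that rel_bounds[OF ab(1)] by blast+
    then show ?thesis
      using l[OF that(1)] l[OF that(3)] mid_imp_glued[OF ab that(2)] t by meson
  qed
  have LL: "glued \<alpha> \<beta> n (Inr (Lower i)) (Inr (Lower j))"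
    if "rel \<beta> (Lower i) (Upper p)" "(p, q) \<in> mid \<alpha> \<beta>" "rel \<beta> (Upper q) (Lower j)" for i j p q
  proof -
    have "1 \<le> p" "p \<le> n" "1 \<le> q" "q \<le> n"
      using that rel_bounds[OF ab(2)] by blast+
    then show ?thesis
      using r[OF that(1)] r[OF that(3)] mid_imp_glued[OF ab that(2)] s
        glued_pair[OF ab, of p] glued_pair[OF ab, of q] t by meson
  qed
  show ?thesis
  proof (cases x; cases y)
    fix i j assume "x = Upper i" "y = Upper j"
    then show ?thesis using assms(3) l UU by (auto simp: rel_mult_cases[OF ab])
  next
    fix i j assume "x = Upper i" "y = Lower j"
    then show ?thesis using assms(3) UL by (auto simp: rel_mult_cases[OF ab])
  next
    fix i j assume "x = Lower i" "y = Upper j"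
    then show ?thesis using assms(3) UL s by (auto simp: rel_mult_cases[OF ab])
  next
    fix i j assume "x = Lower i" "y = Lower j"
    then show ?thesis using assms(3) r LL by (auto simp: rel_mult_cases[OF ab])
  qed (use assms(3) rel_Middle[OF diagram_mult_in_diagrams] in auto)
qed

section \<open>Gluing preserves non-crossing and small blocks\<close>

definition unglued :: "nat \<Rightarrow> nat \<Rightarrow> (vertex + vertex) set" where
  "unglued n k = (Inl ` vertices n \<union> Inr ` vertices n)
     - {Inl (Lower j) |j. j \<le> k} - {Inr (Upper j) |j. j \<le> k}"

lemma unglued_Suc:
  "unglued n (Suc k) = unglued n k - {Inl (Lower (Suc k)), Inr (Upper (Suc k))}"
  by (auto simp: unglued_def le_Suc_eq)

lemma unglued_0: "unglued n 0 = Inl ` vertices n \<union> Inr ` vertices n"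
  by (auto simp: unglued_def)

lemma vertex_outer_unglued: "x \<in> vertices n \<Longrightarrow> vertex_outer x \<in> unglued n k"
  by (cases x) (auto simp: unglued_def)

text \<open>The vertex k' of the first copy stands at 2n + 1 - k and the vertex k of the second at
  2n + k. All positions in between belong to smaller indices, which have been deleted before; this
  is why the gluing proceeds upwards from 1.\<close>

fun juxtaposed_pos :: "nat \<Rightarrow> vertex + vertex \<Rightarrow> nat" where
  "juxtaposed_pos n (Inl x) = boundary_pos n x"
| "juxtaposed_pos n (Inr x) = 2 * n + boundary_pos n x"

lemma boundary_pos_bounds: "x \<in> vertices n \<Longrightarrow> 1 \<le> boundary_pos n x \<and> boundary_pos n x \<le> 2 * n"
  by (cases x) auto

lemma noncrossing_glued:
  assumes ab: "\<alpha> \<in> diagrams n" "\<beta> \<in> diagrams n" and pl: "planar n \<alpha>" "planar n \<beta>"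
  shows "k \<le> n \<Longrightarrow> noncrossing (juxtaposed_pos n) (unglued n k) (glued \<alpha> \<beta> k)"
proof (induction k)
  case 0
  show ?case unfolding noncrossing_def
  proof (intro ballI impI)
    fix a b c d
    assume v: "a \<in> unglued n 0" "b \<in> unglued n 0" "c \<in> unglued n 0" "d \<in> unglued n 0"
      and f: "juxtaposed_pos n a < juxtaposed_pos n b" "juxtaposed_pos n b < juxtaposed_pos n c"
      "juxtaposed_pos n c < juxtaposed_pos n d"
      and g: "glued \<alpha> \<beta> 0 a c" "glued \<alpha> \<beta> 0 b d"
    \<comment> \<open>Related vertices lie in one copy, and the first copy lies entirely before the
      second, so a crossing would happen inside one of the two diagrams.\<close>
    have lr: "\<not> 2 * n + boundary_pos n u < boundary_pos n w" if "w \<in> vertices n" for u w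
      using boundary_pos_bounds[OF that] by auto
    show "glued \<alpha> \<beta> 0 a b"
      using v f g pl[unfolded planar_iff[OF ab(1)] planar_iff[OF ab(2)]]
      by (cases a; cases b; cases c; cases d) (auto simp: unglued_0 lr)
  qed
next
  case (Suc k)
  have "Inl (Lower (Suc k)) \<in> unglued n k" "Inr (Upper (Suc k)) \<in> unglued n k"
    using Suc.prems by (auto simp: unglued_def)
  moreover have "juxtaposed_pos n v < juxtaposed_pos n (Inl (Lower (Suc k))) \<or>
      juxtaposed_pos n (Inr (Upper (Suc k))) < juxtaposed_pos n v"
    if "v \<in> unglued n k - {Inl (Lower (Suc k)), Inr (Upper (Suc k))}" for v
  proof (cases v)
    case (Inl x)
    then show ?thesis using that Suc.prems by (cases x) (auto simp: unglued_def)
  next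
    case (Inr x)
    then show ?thesis using that Suc.prems by (cases x) (auto simp: unglued_def)
  qed
  ultimately show ?case
    unfolding unglued_Suc glued.simps using Suc
    by (intro noncrossing_glue glued_symp glued_transp[OF ab]) auto
qed

lemma planar_mult:
  assumes ab: "\<alpha> \<in> diagrams n" "\<beta> \<in> diagrams n" and pl: "planar n \<alpha>" "planar n \<beta>"
  shows "planar n (diagram_mult n \<alpha> \<beta>)"
  unfolding planar_iff[OF diagram_mult_in_diagrams]
proof (intro allI impI)
  fix a b c d
  assume f: "boundary_pos n a < boundary_pos n b" "boundary_pos n b < boundary_pos n c"
    "boundary_pos n c < boundary_pos n d"
    and g: "rel (diagram_mult n \<alpha> \<beta>) a c" "rel (diagram_mult n \<alpha> \<beta>) b d"
  have v: "a \<in> vertices n" "b \<in> vertices n" "c \<in> vertices n" "d \<in> vertices n"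
    using rel_vertices[OF diagram_mult_in_diagrams g(1)] rel_vertices[OF diagram_mult_in_diagrams g(2)]
    by auto
  \<comment> \<open>Once the inner rows are deleted, the remaining vertices stand in the boundary
    order of the product.\<close>
  have mono: "juxtaposed_pos n (vertex_outer x) < juxtaposed_pos n (vertex_outer y)"
    if "boundary_pos n x < boundary_pos n y" "x \<in> vertices n" "y \<in> vertices n" for x y
    using that by (cases x; cases y) auto
  have "glued \<alpha> \<beta> n (vertex_outer a) (vertex_outer b)"
    using noncrossing_glued[OF ab pl order.refl] v mono f
      rel_mult_imp_glued[OF ab g(1)] rel_mult_imp_glued[OF ab g(2)] vertex_outer_unglued
    unfolding noncrossing_def by meson
  then show "rel (diagram_mult n \<alpha> \<beta>) a b" using glued_imp_rel_mult[OF ab] v by blast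
qed

lemma at_most_pairs_glued:
  assumes ab: "\<alpha> \<in> diagrams n" "\<beta> \<in> diagrams n"
    and br: "\<forall>B\<in>\<alpha>. card B \<le> 2" "\<forall>B\<in>\<beta>. card B \<le> 2"
  shows "k \<le> n \<Longrightarrow> at_most_pairs (unglued n k) (glued \<alpha> \<beta> k)"
proof (induction k)
  case 0
  show ?case unfolding at_most_pairs_def
  proof (intro ballI impI)
    fix x y z assume "glued \<alpha> \<beta> 0 x y" "glued \<alpha> \<beta> 0 x z"
    then show "x = y \<or> x = z \<or> y = z"
      using br[unfolded blocks_card_le_2_iff[OF ab(1)] blocks_card_le_2_iff[OF ab(2)]]
      by (cases x; cases y; cases z) auto
  qed
next
  case (Suc k)
  have "Inl (Lower (Suc k)) \<in> unglued n k" "Inr (Upper (Suc k)) \<in> unglued n k"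
    using Suc.prems by (auto simp: unglued_def)
  then show ?case
    unfolding unglued_Suc glued.simps using Suc
    by (intro at_most_pairs_glue) auto
qed

lemma blocks_card_le_2_mult:
  assumes ab: "\<alpha> \<in> diagrams n" "\<beta> \<in> diagrams n"
    and br: "\<forall>B\<in>\<alpha>. card B \<le> 2" "\<forall>B\<in>\<beta>. card B \<le> 2"
  shows "\<forall>B\<in>diagram_mult n \<alpha> \<beta>. card B \<le> 2"
  unfolding blocks_card_le_2_iff[OF diagram_mult_in_diagrams]
proof (intro allI impI)
  fix x y z assume g: "rel (diagram_mult n \<alpha> \<beta>) x y" "rel (diagram_mult n \<alpha> \<beta>) x z"
  have v: "x \<in> vertices n" "y \<in> vertices n" "z \<in> vertices n"
    using rel_vertices[OF diagram_mult_in_diagrams g(1)] rel_vertices[OF diagram_mult_in_diagrams g(2)]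
    by auto
  have inj: "vertex_outer x = vertex_outer y \<Longrightarrow> x = y" for x y
    by (cases x; cases y) auto
  have "vertex_outer x = vertex_outer y \<or> vertex_outer x = vertex_outer z \<or> vertex_outer y = vertex_outer z"
    using at_most_pairs_glued[OF ab br order.refl] v
      rel_mult_imp_glued[OF ab g(1)] rel_mult_imp_glued[OF ab g(2)] vertex_outer_unglued
    unfolding at_most_pairs_def by meson
  then show "x = y \<or> x = z \<or> y = z" using inj by blast
qed

lemma diagram_family_mult:
  "\<alpha> \<in> diagram_family n pl br \<Longrightarrow> \<beta> \<in> diagram_family n pl br \<Longrightarrow>
    diagram_mult n \<alpha> \<beta> \<in> diagram_family n pl br"
  unfolding diagram_family_def mem_Collect_eq
  by (intro conjI impI diagram_mult_in_diagrams planar_mult blocks_card_le_2_mult) auto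

subsection \<open>The involution\<close>

lemma rel_star: "rel (diagram_star \<alpha>) x y \<longleftrightarrow> rel \<alpha> (flip_vertex x) (flip_vertex y)"
proof -
  have ff: "flip_vertex (flip_vertex x) = x" for x by (cases x) auto
  then have "x \<in> flip_vertex ` B \<longleftrightarrow> flip_vertex x \<in> B" for x B by (metis imageE imageI)
  then show ?thesis by (auto simp: in_common_block_def diagram_star_def)
qed

lemma diagram_family_star:
  assumes "\<alpha> \<in> diagram_family n pl br"
  shows "diagram_star \<alpha> \<in> diagram_family n pl br"
proof -
  have a: "\<alpha> \<in> diagrams n" using assms by (simp add: diagram_family_def)
  have inj: "inj flip_vertex" by (rule injI, case_tac x; case_tac y) auto
  have V: "flip_vertex ` vertices n = vertices n"
    by (auto simp: vertices_def upper_row_def lower_row_def image_Un image_image)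
  have "partition_on (vertices n) (image flip_vertex ` \<alpha>)"
    using partition_on_inj_image[of "vertices n" \<alpha> flip_vertex] a inj V
    by (auto simp: diagrams_altdef inj_on_def image_iff dest: partition_onD3)
  then have s: "diagram_star \<alpha> \<in> diagrams n" by (simp add: diagrams_altdef diagram_star_def)
  have "planar n (diagram_star \<alpha>)" if "planar n \<alpha>"
    unfolding planar_iff[OF s] rel_star
  proof (intro allI impI)
    fix x y z w
    assume f: "boundary_pos n x < boundary_pos n y" "boundary_pos n y < boundary_pos n z"
      "boundary_pos n z < boundary_pos n w"
      and g: "rel \<alpha> (flip_vertex x) (flip_vertex z)" "rel \<alpha> (flip_vertex y) (flip_vertex w)"
    have v: "x \<in> vertices n" "y \<in> vertices n" "z \<in> vertices n" "w \<in> vertices n"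
      using rel_vertices[OF a g(1)] rel_vertices[OF a g(2)] V inj by (metis imageE injD)+
    \<comment> \<open>The flip reverses the boundary order, so that planarity of \<alpha> is applied
      to the four vertices read backwards.\<close>
    have mono: "boundary_pos n (flip_vertex y) < boundary_pos n (flip_vertex x)"
      if "boundary_pos n x < boundary_pos n y" "x \<in> vertices n" "y \<in> vertices n" for x y
      using that by (cases x; cases y) auto
    have "rel \<alpha> (flip_vertex w) (flip_vertex z)"
      using that[unfolded planar_iff[OF a]] mono v f g rel_sym by meson
    then show "rel \<alpha> (flip_vertex x) (flip_vertex y)"
      using g rel_sym rel_trans[OF a] by meson
  qed
  moreover have "\<forall>B\<in>diagram_star \<alpha>. card B \<le> 2" if "\<forall>B\<in>\<alpha>. card B \<le> 2"
    using that by (auto simp: diagram_star_def card_image inj_on_subset[OF inj])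
  ultimately show ?thesis using assms s by (simp add: diagram_family_def)
qed

declare One_nat_def [simp del]

subsection \<open>Diagrams with few non-singleton blocks\<close>

definition edge :: "'a \<Rightarrow> 'a \<Rightarrow> 'a \<Rightarrow> 'a \<Rightarrow> bool" where
  "edge a b x y \<longleftrightarrow> x = a \<and> y = b \<or> x = b \<and> y = a"

text \<open>The pairs may coincide, and a pair may shrink to one vertex; \<open>one_pair\<close> and
  \<open>dots\<close> thus become instances and share the lemmas.\<close>

definition two_pairs :: "nat \<Rightarrow> vertex \<Rightarrow> vertex \<Rightarrow> vertex \<Rightarrow> vertex \<Rightarrow> diagram" where
  "two_pairs n a b c d =
    vertices n // {(x, y) \<in> vertices n \<times> vertices n. x = y \<or> edge a b x y \<or> edge c d x y}"

abbreviation one_pair :: "nat \<Rightarrow> vertex \<Rightarrow> vertex \<Rightarrow> diagram" where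
  "one_pair n a b \<equiv> two_pairs n a b a b"

definition dots :: "nat \<Rightarrow> diagram" where
  "dots n = one_pair n (Upper 1) (Upper 1)"

text \<open>Two chords with four distinct ends cross iff exactly one end of the second lies between
  the ends of the first.\<close>

definition between :: "nat \<Rightarrow> nat \<Rightarrow> nat \<Rightarrow> bool" where
  "between a b c \<longleftrightarrow> a < c \<and> c < b \<or> b < c \<and> c < a"

lemma equiv_two_pairs:
  assumes "{a, b} = {c, d} \<or> {a, b} \<inter> {c, d} = {}"
  shows "equiv (vertices n)
    {(x, y) \<in> vertices n \<times> vertices n. x = y \<or> edge a b x y \<or> edge c d x y}"
  using assms
  by (intro equivI) (auto simp: refl_on_def sym_def trans_def edge_def doubleton_eq_iff)

lemma rel_two_pairs:
  assumes "{a, b} = {c, d} \<or> {a, b} \<inter> {c, d} = {}"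
    and "a \<in> vertices n" "b \<in> vertices n" "c \<in> vertices n" "d \<in> vertices n"
  shows "rel (two_pairs n a b c d) x y \<longleftrightarrow> x = y \<and> x \<in> vertices n \<or> edge a b x y \<or> edge c d x y"
  unfolding two_pairs_def in_common_block_quotient[OF equiv_two_pairs[OF assms(1)]]
  using assms(2-) by (auto simp: edge_def)

lemma rel_one_pair:
  assumes "a \<in> vertices n" "b \<in> vertices n"
  shows "rel (one_pair n a b) x y \<longleftrightarrow> x = y \<and> x \<in> vertices n \<or> edge a b x y"
  using rel_two_pairs[of a b a b n x y] assms by auto

lemma rel_dots:
  "1 \<le> n \<Longrightarrow> rel (dots n) x y \<longleftrightarrow> x = y \<and> x \<in> vertices n"
  by (auto simp: dots_def rel_one_pair edge_def)

text \<open>Only the two chords could cross, and \<open>nc\<close> excludes this. The diagram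
  therefore lies in the Motzkin monoid and so in each of the four. All explicit factors used later
  are of this kind.\<close>

lemma two_pairs_in_family:
  assumes "{a, b} = {c, d} \<or> {a, b} \<inter> {c, d} = {}"
    and "a \<in> vertices n" "b \<in> vertices n" "c \<in> vertices n" "d \<in> vertices n"
    and nc: "between (boundary_pos n a) (boundary_pos n b) (boundary_pos n c) \<longleftrightarrow>
      between (boundary_pos n a) (boundary_pos n b) (boundary_pos n d)"
  shows "two_pairs n a b c d \<in> diagram_family n pl br"
proof -
  note r = rel_two_pairs[OF assms(1-5)]
  have D: "two_pairs n a b c d \<in> diagrams n"
    unfolding two_pairs_def by (rule quotient_in_diagrams[OF equiv_two_pairs[OF assms(1)]])
  have "planar n (two_pairs n a b c d)"
    unfolding planar_iff[OF D] r edge_def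
    using nc unfolding between_def by (intro allI impI; elim disjE conjE; simp)
  moreover have "\<forall>B\<in>two_pairs n a b c d. card B \<le> 2"
    unfolding blocks_card_le_2_iff[OF D] r edge_def
    using assms(1) by (auto simp: doubleton_eq_iff)
  ultimately show ?thesis using D by (simp add: diagram_family_def)
qed

lemma one_pair_in_family:
  assumes "a \<in> vertices n" "b \<in> vertices n"
  shows "one_pair n a b \<in> diagram_family n pl br"
  by (rule two_pairs_in_family) (use assms in \<open>auto simp: between_def\<close>)

lemma dots_in_family: "1 \<le> n \<Longrightarrow> dots n \<in> diagram_family n pl br"
  unfolding dots_def by (rule one_pair_in_family) auto

section \<open>Isolated vertices and products with small diagrams\<close>

definition isolated :: "diagram \<Rightarrow> vertex \<Rightarrow> bool" where
  "isolated \<alpha> v \<longleftrightarrow> (\<forall>y. rel \<alpha> v y \<longrightarrow> y = v)"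

lemma isolated_mult:
  assumes ab: "\<alpha> \<in> diagrams n" "\<beta> \<in> diagrams n"
  shows "isolated \<alpha> (Upper i) \<Longrightarrow> isolated (diagram_mult n \<alpha> \<beta>) (Upper i)"
    "isolated \<beta> (Lower i) \<Longrightarrow> isolated (diagram_mult n \<alpha> \<beta>) (Lower i)"
proof -
  note r = rel_mult_cases[OF ab] rel_Middle[OF diagram_mult_in_diagrams]
  show "isolated (diagram_mult n \<alpha> \<beta>) (Upper i)" if "isolated \<alpha> (Upper i)"
    unfolding isolated_def
  proof (intro allI impI)
    fix y assume "rel (diagram_mult n \<alpha> \<beta>) (Upper i) y"
    then show "y = Upper i" using that by (cases y) (auto simp: r isolated_def)
  qed
  show "isolated (diagram_mult n \<alpha> \<beta>) (Lower i)" if "isolated \<beta> (Lower i)"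
    unfolding isolated_def
  proof (intro allI impI)
    fix y assume "rel (diagram_mult n \<alpha> \<beta>) (Lower i) y"
    then show "y = Lower i"
      using that rel_sym[of _ _ \<beta>] by (cases y) (fastforce simp: r isolated_def)+
  qed
qed

lemma isolated_outside: "\<alpha> \<in> diagrams n \<Longrightarrow> v \<notin> vertices n \<Longrightarrow> isolated \<alpha> v"
  using rel_vertices by (auto simp: isolated_def)

lemma eq_one_pairI:
  assumes g: "\<gamma> \<in> diagrams n" and v: "a \<in> vertices n" "b \<in> vertices n"
    and iso: "\<And>v. v \<in> vertices n \<Longrightarrow> v \<noteq> a \<Longrightarrow> v \<noteq> b \<Longrightarrow> isolated \<gamma> v"
  shows "\<gamma> = (if rel \<gamma> a b then one_pair n a b else dots n)"
proof (rule diagram_eqI[OF g])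
  have n: "1 \<le> n" using v by (cases a) auto
  show "(if rel \<gamma> a b then one_pair n a b else dots n) \<in> diagrams n"
    using one_pair_in_family[OF v] dots_in_family[OF n] by (auto simp: diagram_family_def)
  fix x y
  have V: "rel \<gamma> x y \<Longrightarrow> x \<in> vertices n \<and> y \<in> vertices n" using rel_vertices[OF g] by blast
  have "rel \<gamma> x y \<longleftrightarrow> x = y \<and> x \<in> vertices n \<or> edge a b x y \<and> rel \<gamma> a b"
  proof
    assume r: "rel \<gamma> x y"
    show "x = y \<and> x \<in> vertices n \<or> edge a b x y \<and> rel \<gamma> a b"
    proof (cases "x = y")
      case False
      then have "\<not> isolated \<gamma> x" "\<not> isolated \<gamma> y"
        using r rel_sym[OF r] unfolding isolated_def by metis+
      then have "x = a \<or> x = b" "y = a \<or> y = b" using V[OF r] iso by metis+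
      then show ?thesis using False r rel_sym[OF r] by (auto simp: edge_def)
    qed (use V r in blast)
  next
    assume "x = y \<and> x \<in> vertices n \<or> edge a b x y \<and> rel \<gamma> a b"
    then show "rel \<gamma> x y" using rel_refl[OF g] rel_sym unfolding edge_def by blast
  qed
  then show "rel \<gamma> x y \<longleftrightarrow> rel (if rel \<gamma> a b then one_pair n a b else dots n) x y"
    using rel_one_pair[OF v] rel_dots[OF n] by auto
qed

text \<open>This bounds what is connected to p: it suffices to name a set \<open>Z\<close>
  containing p that neither inner kernel leaves.\<close>

lemma mid_closed:
  assumes "(p, q) \<in> mid \<alpha> \<beta>" "p \<in> Z"
    and "\<And>i j. i \<in> Z \<Longrightarrow> rel \<alpha> (Lower i) (Lower j) \<Longrightarrow> j \<in> Z"
    and "\<And>i j. i \<in> Z \<Longrightarrow> rel \<beta> (Upper i) (Upper j) \<Longrightarrow> j \<in> Z"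
  shows "q \<in> Z"
  using assms(1) unfolding mid_def
  by (induction rule: rtrancl_induct) (use assms(2-) in blast)+

lemma mid_left:
  assumes b: "\<beta> \<in> diagrams n" and "\<And>p q. rel \<alpha> (Lower p) (Lower q) \<Longrightarrow> p = q"
  shows "(p, q) \<in> mid \<alpha> \<beta> \<longleftrightarrow> p = q \<or> rel \<beta> (Upper p) (Upper q)"
proof
  assume "(p, q) \<in> mid \<alpha> \<beta>"
  then have "q \<in> {q. p = q \<or> rel \<beta> (Upper p) (Upper q)}"
    by (rule mid_closed) (use assms(2) rel_trans[OF b] in blast)+
  then show "p = q \<or> rel \<beta> (Upper p) (Upper q)" by simp
qed (auto intro: mid_upper)

lemma mid_right:
  assumes a: "\<alpha> \<in> diagrams n" and "\<And>p q. rel \<beta> (Upper p) (Upper q) \<Longrightarrow> p = q"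
  shows "(p, q) \<in> mid \<alpha> \<beta> \<longleftrightarrow> p = q \<or> rel \<alpha> (Lower p) (Lower q)"
proof
  assume "(p, q) \<in> mid \<alpha> \<beta>"
  then have "q \<in> {q. p = q \<or> rel \<alpha> (Lower p) (Lower q)}"
    by (rule mid_closed) (use assms(2) rel_trans[OF a] in blast)+
  then show "p = q \<or> rel \<alpha> (Lower p) (Lower q)" by simp
qed (auto intro: mid_lower)

lemma rel_mult_discrete_left:
  assumes ab: "\<alpha> \<in> diagrams n" "\<beta> \<in> diagrams n" and "\<And>p q. rel \<alpha> (Lower p) (Lower q) \<Longrightarrow> p = q"
  shows "rel (diagram_mult n \<alpha> \<beta>) (Upper i) (Lower j) \<longleftrightarrow>
      (\<exists>p. rel \<alpha> (Upper i) (Lower p) \<and> rel \<beta> (Upper p) (Lower j))"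
    "rel (diagram_mult n \<alpha> \<beta>) (Lower i) (Lower j) \<longleftrightarrow> rel \<beta> (Lower i) (Lower j)"
proof -
  have m: "(p, q) \<in> mid \<alpha> \<beta> \<longleftrightarrow> p = q \<or> rel \<beta> (Upper p) (Upper q)" for p q
    using mid_left[OF ab(2) assms(3)] .
  show "rel (diagram_mult n \<alpha> \<beta>) (Upper i) (Lower j) \<longleftrightarrow>
      (\<exists>p. rel \<alpha> (Upper i) (Lower p) \<and> rel \<beta> (Upper p) (Lower j))"
    unfolding rel_mult_cases[OF ab] m using rel_trans[OF ab(2)] by metis
  show "rel (diagram_mult n \<alpha> \<beta>) (Lower i) (Lower j) \<longleftrightarrow> rel \<beta> (Lower i) (Lower j)"
    unfolding rel_mult_cases[OF ab] m using rel_trans[OF ab(2)] by metis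
qed

text \<open>As a left factor it moves the upper vertices u and v to 1 and 2, isolates the remaining
  upper vertices and keeps the lower kernel. The strings do not cross if u < v.\<close>

definition select_two :: "nat \<Rightarrow> nat \<Rightarrow> nat \<Rightarrow> diagram" where
  "select_two n u v = two_pairs n (Upper 1) (Lower u) (Upper 2) (Lower v)"

abbreviation select_one :: "nat \<Rightarrow> nat \<Rightarrow> diagram" where
  "select_one n u \<equiv> one_pair n (Upper 1) (Lower u)"

lemma select_two_in_family:
  assumes "2 \<le> n" "1 \<le> u" "u < v" "v \<le> n"
  shows "select_two n u v \<in> diagram_family n pl br"
  unfolding select_two_def
  by (rule two_pairs_in_family) (use assms in \<open>auto simp: between_def\<close>)

lemma family_imp_diagram: "\<alpha> \<in> diagram_family n pl br \<Longrightarrow> \<alpha> \<in> diagrams n"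
  by (simp add: diagram_family_def)

lemma select_two_mult:
  assumes a: "\<alpha> \<in> diagrams n" and u: "2 \<le> n" "1 \<le> u" "u < v" "v \<le> n"
  defines "\<gamma> \<equiv> diagram_mult n (select_two n u v) \<alpha>"
  shows "rel \<gamma> (Upper 1) (Upper 2) \<longleftrightarrow> rel \<alpha> (Upper u) (Upper v)"
    "rel \<gamma> (Upper 1) (Lower j) \<longleftrightarrow> rel \<alpha> (Upper u) (Lower j)"
    "rel \<gamma> (Upper 2) (Lower j) \<longleftrightarrow> rel \<alpha> (Upper v) (Lower j)"
    "rel \<gamma> (Lower i) (Lower j) \<longleftrightarrow> rel \<alpha> (Lower i) (Lower j)"
    "3 \<le> k \<Longrightarrow> isolated \<gamma> (Upper k)"
proof -
  let ?s = "select_two n u v"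
  have s: "?s \<in> diagrams n" using select_two_in_family u family_imp_diagram by blast
  have r: "rel ?s x y \<longleftrightarrow> x = y \<and> x \<in> vertices n \<or> edge (Upper 1) (Lower u) x y \<or>
      edge (Upper 2) (Lower v) x y" for x y
    unfolding select_two_def by (rule rel_two_pairs) (use u in auto)
  have m: "(p, q) \<in> mid ?s \<alpha> \<longleftrightarrow> p = q \<or> rel \<alpha> (Upper p) (Upper q)" for p q
    by (rule mid_left[OF a]) (auto simp: r edge_def)
  note d = rel_mult_discrete_left[OF s a]
  show "rel \<gamma> (Upper 1) (Upper 2) \<longleftrightarrow> rel \<alpha> (Upper u) (Upper v)"
    using u by (auto simp: \<gamma>_def rel_mult_cases[OF s a] r m edge_def)
  show "rel \<gamma> (Upper 1) (Lower j) \<longleftrightarrow> rel \<alpha> (Upper u) (Lower j)"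
    "rel \<gamma> (Upper 2) (Lower j) \<longleftrightarrow> rel \<alpha> (Upper v) (Lower j)"
    unfolding \<gamma>_def using u by (subst d(1); auto simp: r edge_def)+
  show "rel \<gamma> (Lower i) (Lower j) \<longleftrightarrow> rel \<alpha> (Lower i) (Lower j)"
    unfolding \<gamma>_def by (rule d(2)) (auto simp: r edge_def)
  show "isolated \<gamma> (Upper k)" if "3 \<le> k" unfolding \<gamma>_def
    by (rule isolated_mult[OF s a]) (use that in \<open>auto simp: isolated_def r edge_def\<close>)
qed

lemma select_one_mult:
  assumes a: "\<alpha> \<in> diagrams n" and u: "1 \<le> n" "1 \<le> u" "u \<le> n"
  defines "\<gamma> \<equiv> diagram_mult n (select_one n u) \<alpha>"
  shows "rel \<gamma> (Upper 1) (Lower j) \<longleftrightarrow> rel \<alpha> (Upper u) (Lower j)"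
    "rel \<gamma> (Lower i) (Lower j) \<longleftrightarrow> rel \<alpha> (Lower i) (Lower j)"
    "2 \<le> k \<Longrightarrow> isolated \<gamma> (Upper k)"
proof -
  let ?s = "select_one n u"
  have v: "Upper 1 \<in> vertices n" "Lower u \<in> vertices n" using u by auto
  have s: "?s \<in> diagrams n" using one_pair_in_family[OF v] family_imp_diagram by blast
  note r = rel_one_pair[OF v]
  note d = rel_mult_discrete_left[OF s a]
  show "rel \<gamma> (Upper 1) (Lower j) \<longleftrightarrow> rel \<alpha> (Upper u) (Lower j)"
    unfolding \<gamma>_def using u by (subst d(1); auto simp: r edge_def)+
  show "rel \<gamma> (Lower i) (Lower j) \<longleftrightarrow> rel \<alpha> (Lower i) (Lower j)"
    unfolding \<gamma>_def by (rule d(2)) (auto simp: r edge_def)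
  show "isolated \<gamma> (Upper k)" if "2 \<le> k" unfolding \<gamma>_def
    by (rule isolated_mult[OF s a]) (use that in \<open>auto simp: isolated_def r edge_def\<close>)
qed

lemma dots_mult:
  assumes a: "\<alpha> \<in> diagrams n" and n: "1 \<le> n"
  defines "\<gamma> \<equiv> diagram_mult n (dots n) \<alpha>"
  shows "rel \<gamma> (Lower i) (Lower j) \<longleftrightarrow> rel \<alpha> (Lower i) (Lower j)"
    "isolated \<gamma> (Upper k)"
proof -
  have s: "dots n \<in> diagrams n" using dots_in_family[OF n] family_imp_diagram by blast
  note r = rel_dots[OF n]
  note d = rel_mult_discrete_left[OF s a]
  show "rel \<gamma> (Lower i) (Lower j) \<longleftrightarrow> rel \<alpha> (Lower i) (Lower j)"
    unfolding \<gamma>_def by (rule d(2)) (auto simp: r edge_def)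
  show "isolated \<gamma> (Upper k)" unfolding \<gamma>_def
    by (rule isolated_mult[OF s a]) (auto simp: isolated_def r)
qed

subsection \<open>Projections of rank at most 2\<close>

definition family_projections :: "nat \<Rightarrow> bool \<Rightarrow> bool \<Rightarrow> diagram set" where
  "family_projections n pl br =
    {\<epsilon> \<in> diagram_family n pl br. diagram_mult n \<epsilon> \<epsilon> = \<epsilon> \<and> diagram_star \<epsilon> = \<epsilon> \<and> diagram_rank \<epsilon> \<le> 2}"

text \<open>If i is joined to j', then the symmetry joins j to i', and in the square of \<epsilon>
  the middle vertex j'' links i to i'. A transversal thus contains i' together with i, and
  \<epsilon> is determined by its lower kernel and the indices i joined to i'.\<close>

lemma projection_rel:
  assumes e: "\<epsilon> \<in> diagrams n" and p: "diagram_mult n \<epsilon> \<epsilon> = \<epsilon>" "diagram_star \<epsilon> = \<epsilon>"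
  shows "rel \<epsilon> (Upper i) (Upper j) \<longleftrightarrow> rel \<epsilon> (Lower i) (Lower j)"
    "rel \<epsilon> (Upper i) (Lower j) \<longleftrightarrow> rel \<epsilon> (Lower i) (Lower j) \<and> rel \<epsilon> (Upper i) (Lower i)"
proof -
  have star: "rel \<epsilon> x y \<longleftrightarrow> rel \<epsilon> (flip_vertex x) (flip_vertex y)" for x y
    using rel_star[of x y \<epsilon>] p(2) by simp
  show "rel \<epsilon> (Upper i) (Upper j) \<longleftrightarrow> rel \<epsilon> (Lower i) (Lower j)"
    using star[of "Upper i" "Upper j"] by simp
  note t = rel_trans[OF e]
  have "rel \<epsilon> (Upper i) (Lower i)" if r: "rel \<epsilon> (Upper i) (Lower j)"
  proof -
    have "rel \<epsilon> (Upper j) (Lower i)"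
      using star[of "Lower i" "Upper j"] r rel_sym by auto
    then have "rel (diagram_mult n \<epsilon> \<epsilon>) (Upper i) (Lower i)"
      unfolding rel_mult_cases[OF e e] using r mid_refl by blast
    then show ?thesis using p by simp
  qed
  then show "rel \<epsilon> (Upper i) (Lower j) \<longleftrightarrow> rel \<epsilon> (Lower i) (Lower j) \<and> rel \<epsilon> (Upper i) (Lower i)"
    using t rel_sym by metis
qed

definition marked :: "diagram \<Rightarrow> nat \<Rightarrow> bool" where
  "marked \<epsilon> i \<longleftrightarrow> rel \<epsilon> (Upper i) (Lower i)"

abbreviation ker :: "diagram \<Rightarrow> nat \<Rightarrow> nat \<Rightarrow> bool" where
  "ker \<alpha> i j \<equiv> rel \<alpha> (Lower i) (Lower j)"

lemma projection_eqI:
  assumes "\<epsilon> \<in> diagrams n" "diagram_mult n \<epsilon> \<epsilon> = \<epsilon>" "diagram_star \<epsilon> = \<epsilon>"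
    and "\<delta> \<in> diagrams n" "diagram_mult n \<delta> \<delta> = \<delta>" "diagram_star \<delta> = \<delta>"
    and "\<And>i j. ker \<epsilon> i j \<longleftrightarrow> ker \<delta> i j" "\<And>i. marked \<epsilon> i \<longleftrightarrow> marked \<delta> i"
  shows "\<epsilon> = \<delta>"
proof (rule diagram_eqI[OF assms(1,4)])
  note e = projection_rel[OF assms(1-3)] and d = projection_rel[OF assms(4-6)]
  have UL: "rel \<epsilon> (Upper i) (Lower j) \<longleftrightarrow> rel \<delta> (Upper i) (Lower j)" for i j
    unfolding e(2)[of i j] d(2)[of i j] using assms(7,8) marked_def by simp
  then have LU: "rel \<epsilon> (Lower j) (Upper i) \<longleftrightarrow> rel \<delta> (Lower j) (Upper i)" for i j
    using rel_sym by blast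
  show "rel \<epsilon> x y \<longleftrightarrow> rel \<delta> x y" for x y
    using UL LU assms(7)
    by (cases x; cases y) (auto simp: e(1) d(1) rel_Middle[OF assms(1)] rel_Middle[OF assms(4)])
qed

lemma marked_cong:
  assumes e: "\<epsilon> \<in> diagrams n" "diagram_mult n \<epsilon> \<epsilon> = \<epsilon>" "diagram_star \<epsilon> = \<epsilon>"
    and "ker \<epsilon> i j" "marked \<epsilon> i"
  shows "marked \<epsilon> j"
  using assms(4,5) projection_rel[OF e] rel_trans[OF e(1)] rel_sym unfolding marked_def by metis

lemma transversals_eq:
  assumes e: "\<epsilon> \<in> diagrams n" "diagram_mult n \<epsilon> \<epsilon> = \<epsilon>" "diagram_star \<epsilon> = \<epsilon>"
  shows "transversals \<epsilon> = (\<lambda>i. in_common_block \<epsilon> `` {Upper i}) ` {i. marked \<epsilon> i}"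
proof (intro equalityI subsetI)
  have quot: "in_common_block \<epsilon> `` {v} \<in> \<epsilon>" if "v \<in> vertices n" for v
    using quotientI[OF that, of "in_common_block \<epsilon>"] diagram_eq_quotient[OF e(1), symmetric] by simp
  fix B
  {
    assume "B \<in> transversals \<epsilon>"
    then obtain i j where B: "B \<in> \<epsilon>" "Upper i \<in> B" "Lower j \<in> B"
      by (auto simp: transversals_def)
    then have r: "rel \<epsilon> (Upper i) (Lower j)" by (auto simp: in_common_block_def)
    then have "marked \<epsilon> i" using projection_rel(2)[OF e, of i j] by (simp add: marked_def)
    moreover have "B = in_common_block \<epsilon> `` {Upper i}"
    proof -
      have "in_common_block \<epsilon> `` {Upper i} \<in> \<epsilon>"
        using rel_vertices(1)[OF e(1) r] by (rule quot)
      moreover have "Upper i \<in> in_common_block \<epsilon> `` {Upper i}"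
        using rel_vertices(1)[OF e(1) r] rel_refl[OF e(1), of "Upper i"] by simp
      moreover have "disjoint \<epsilon>" using e(1) by (auto simp: diagrams_altdef dest: partition_onD2)
      ultimately show ?thesis using B(1,2) by (metis disjointD disjoint_iff)
    qed
    ultimately show "B \<in> (\<lambda>i. in_common_block \<epsilon> `` {Upper i}) ` {i. marked \<epsilon> i}" by blast
  next
    assume "B \<in> (\<lambda>i. in_common_block \<epsilon> `` {Upper i}) ` {i. marked \<epsilon> i}"
    then obtain i where i: "B = in_common_block \<epsilon> `` {Upper i}" "rel \<epsilon> (Upper i) (Lower i)"
      by (auto simp: marked_def)
    have v: "Upper i \<in> vertices n" using rel_vertices(1)[OF e(1) i(2)] .
    then have "B \<in> \<epsilon>" using quot i(1) by simp
    moreover have "Upper i \<in> B" "Lower i \<in> B" using i v rel_refl[OF e(1)] by auto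
    ultimately show "B \<in> transversals \<epsilon>" by (auto simp: transversals_def)
  }
qed

lemma block_eq_iff:
  assumes e: "\<epsilon> \<in> diagrams n" "diagram_mult n \<epsilon> \<epsilon> = \<epsilon>" "diagram_star \<epsilon> = \<epsilon>"
    and "marked \<epsilon> i" "marked \<epsilon> j"
  shows "in_common_block \<epsilon> `` {Upper i} = in_common_block \<epsilon> `` {Upper j} \<longleftrightarrow> ker \<epsilon> i j"
  using eq_equiv_class_iff[OF equiv_in_common_block[OF e(1)], of "Upper i" "Upper j"]
    projection_rel(1)[OF e] assms(4,5) rel_vertices[OF e(1)] unfolding marked_def by metis

text \<open>Transversals correspond to the kernel classes of marked indices, by
  \<open>transversals_eq\<close> and \<open>block_eq_iff\<close>. The representatives are ordered by
  u < v to fit \<open>select_two\<close>.\<close>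

lemma rank_cases:
  assumes e: "\<epsilon> \<in> diagrams n" "diagram_mult n \<epsilon> \<epsilon> = \<epsilon>" "diagram_star \<epsilon> = \<epsilon>" "diagram_rank \<epsilon> \<le> 2"
  obtains (rank0) "diagram_rank \<epsilon> = 0" "\<And>i. \<not> marked \<epsilon> i"
    | (rank1) u where "diagram_rank \<epsilon> = 1" "marked \<epsilon> u" "\<And>i. marked \<epsilon> i \<Longrightarrow> ker \<epsilon> u i"
    | (rank2) u v where "diagram_rank \<epsilon> = 2" "u < v" "marked \<epsilon> u" "marked \<epsilon> v" "\<not> ker \<epsilon> u v"
      "\<And>i. marked \<epsilon> i \<Longrightarrow> ker \<epsilon> u i \<or> ker \<epsilon> v i"
proof -
  let ?b = "\<lambda>i. in_common_block \<epsilon> `` {Upper i}"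
  note T = transversals_eq[OF e(1-3)] and b = block_eq_iff[OF e(1-3)]
  have "marked \<epsilon> i \<Longrightarrow> i \<in> {1..n}" for i
    using rel_bounds[OF e(1)] by (auto simp: marked_def)
  then have "{i. marked \<epsilon> i} \<subseteq> {1..n}" by blast
  then have "finite {i. marked \<epsilon> i}" by (rule finite_subset) simp
  then have fin: "finite (transversals \<epsilon>)" unfolding T by (rule finite_imageI)
  consider "card (transversals \<epsilon>) = 0" | "card (transversals \<epsilon>) = 1" | "card (transversals \<epsilon>) = 2"
    using e(4) unfolding diagram_rank_def by linarith
  then show thesis
  proof cases
    case 1
    then have "transversals \<epsilon> = {}" using fin by simp
    then show thesis using rank0 1 T unfolding diagram_rank_def by auto
  next
    case 2
    then obtain B where B: "transversals \<epsilon> = {B}" by (auto simp: card_1_singleton_iff One_nat_def)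
    then have "B \<in> transversals \<epsilon>" by simp
    then obtain u where u: "marked \<epsilon> u" "B = ?b u" using T by auto
    have "ker \<epsilon> u i" if "marked \<epsilon> i" for i
    proof -
      have "?b i \<in> transversals \<epsilon>" using that T by auto
      then have "?b u = ?b i" using B u by auto
      then show ?thesis using b[OF u(1) that] by blast
    qed
    then show thesis using rank1 2 u(1) unfolding diagram_rank_def by blast
  next
    case 3
    then obtain B C where B: "transversals \<epsilon> = {B, C}" "B \<noteq> C" by (auto simp: card_2_iff)
    have "B \<in> transversals \<epsilon>" "C \<in> transversals \<epsilon>" using B by auto
    then obtain u v where u: "marked \<epsilon> u" "B = ?b u" and v: "marked \<epsilon> v" "C = ?b v"
      using T by auto
    have k: "\<not> ker \<epsilon> u v" using b[OF u(1) v(1)] B u v by auto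
    have all: "ker \<epsilon> u i \<or> ker \<epsilon> v i" if "marked \<epsilon> i" for i
    proof -
      have "?b i \<in> transversals \<epsilon>" using that T by auto
      then have "?b u = ?b i \<or> ?b v = ?b i" using B u v by auto
      then show ?thesis using b[OF u(1) that] b[OF v(1) that] by blast
    qed
    have "u \<noteq> v" using B u v by auto
    then consider "u < v" | "v < u" by linarith
    then show thesis
    proof cases
      case 1
      then show thesis using rank2[of u v] 3 u v k all unfolding diagram_rank_def by blast
    next
      case 2
      then show thesis using rank2[of v u] 3 u v k all rel_sym unfolding diagram_rank_def by blast
    qed
  qed
qed

section \<open>Left multiples of projections in normal form\<close>

definition normal_form0 :: "diagram \<Rightarrow> diagram \<Rightarrow> bool" where
  "normal_form0 \<epsilon> \<gamma> \<longleftrightarrow> (\<forall>i j. ker \<gamma> i j \<longleftrightarrow> ker \<epsilon> i j) \<and> (\<forall>i. isolated \<gamma> (Upper i))"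

definition normal_form1 :: "diagram \<Rightarrow> diagram \<Rightarrow> bool" where
  "normal_form1 \<epsilon> \<gamma> \<longleftrightarrow> (\<forall>i j. ker \<gamma> i j \<longleftrightarrow> ker \<epsilon> i j) \<and> (\<forall>i\<ge>2. isolated \<gamma> (Upper i)) \<and>
    (\<forall>j. rel \<gamma> (Upper 1) (Lower j) \<longleftrightarrow> marked \<epsilon> j)"

text \<open>Which transversal starts at 1 and which at 2 is left open, since the tests treat the two
  alike.\<close>

definition normal_form2 :: "diagram \<Rightarrow> diagram \<Rightarrow> bool" where
  "normal_form2 \<epsilon> \<gamma> \<longleftrightarrow> (\<forall>i j. ker \<gamma> i j \<longleftrightarrow> ker \<epsilon> i j) \<and> (\<forall>i\<ge>3. isolated \<gamma> (Upper i)) \<and>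
    \<not> rel \<gamma> (Upper 1) (Upper 2) \<and>
    (\<exists>u v. marked \<epsilon> u \<and> marked \<epsilon> v \<and> \<not> ker \<epsilon> u v \<and>
      (\<forall>i. marked \<epsilon> i \<longrightarrow> ker \<epsilon> u i \<or> ker \<epsilon> v i) \<and>
      (\<forall>j. rel \<gamma> (Upper 1) (Lower j) \<longleftrightarrow> ker \<epsilon> u j) \<and>
      (\<forall>j. rel \<gamma> (Upper 2) (Lower j) \<longleftrightarrow> ker \<epsilon> v j))"

definition normal_form :: "diagram \<Rightarrow> diagram \<Rightarrow> bool" where
  "normal_form \<epsilon> \<gamma> \<longleftrightarrow>
    (diagram_rank \<epsilon> = 0 \<and> normal_form0 \<epsilon> \<gamma> \<or> diagram_rank \<epsilon> = 1 \<and> normal_form1 \<epsilon> \<gamma> \<or>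
     diagram_rank \<epsilon> = 2 \<and> normal_form2 \<epsilon> \<gamma>)"

lemma normal_form_exists:
  assumes n: "2 \<le> n" and e: "\<epsilon> \<in> family_projections n pl br"
  obtains \<gamma> where "\<gamma> \<in> diagram_family n pl br" "normal_form \<epsilon> \<gamma>"
proof -
  have f: "\<epsilon> \<in> diagram_family n pl br" and p: "diagram_mult n \<epsilon> \<epsilon> = \<epsilon>" "diagram_star \<epsilon> = \<epsilon>"
    and rk: "diagram_rank \<epsilon> \<le> 2"
    using e by (auto simp: family_projections_def)
  note d = family_imp_diagram[OF f]
  note pr = projection_rel[OF d p]
  have U: "rel \<epsilon> (Upper i) (Lower j) \<longleftrightarrow> ker \<epsilon> i j" if "marked \<epsilon> i" for i j
    using pr(2)[of i j] that by (simp add: marked_def)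
  have bd: "1 \<le> i" "i \<le> n" if "marked \<epsilon> i" for i
    using that rel_bounds[OF d] by (auto simp: marked_def)
  show thesis
  proof (rule rank_cases[OF d p rk])
    assume "diagram_rank \<epsilon> = 0" "\<And>i. \<not> marked \<epsilon> i"
    then show thesis
      using that[of "diagram_mult n (dots n) \<epsilon>"] diagram_family_mult[OF dots_in_family f]
        dots_mult[OF d] n unfolding normal_form_def normal_form0_def by simp
  next
    fix u assume r: "diagram_rank \<epsilon> = 1" and u: "marked \<epsilon> u" "\<And>i. marked \<epsilon> i \<Longrightarrow> ker \<epsilon> u i"
    have n1: "1 \<le> n" using n by simp
    have "select_one n u \<in> diagram_family n pl br"
      using one_pair_in_family[of "Upper 1" n "Lower u"] bd[OF u(1)] n by simp
    then have c: "diagram_mult n (select_one n u) \<epsilon> \<in> diagram_family n pl br"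
      using diagram_family_mult f by blast
    have "ker \<epsilon> u j \<longleftrightarrow> marked \<epsilon> j" for j using u marked_cong[OF d p] by blast
    then have "normal_form1 \<epsilon> (diagram_mult n (select_one n u) \<epsilon>)"
      unfolding normal_form1_def using select_one_mult[OF d n1 bd[OF u(1)]] U[OF u(1)] by simp
    then show thesis using that c r unfolding normal_form_def by blast
  next
    fix u v assume r: "diagram_rank \<epsilon> = 2" and uv: "u < v" "marked \<epsilon> u" "marked \<epsilon> v" "\<not> ker \<epsilon> u v"
      "\<And>i. marked \<epsilon> i \<Longrightarrow> ker \<epsilon> u i \<or> ker \<epsilon> v i"
    note s = select_two_mult[OF d n bd(1)[OF uv(2)] uv(1) bd(2)[OF uv(3)]]
    have c: "diagram_mult n (select_two n u v) \<epsilon> \<in> diagram_family n pl br"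
      using select_two_in_family[OF n bd(1)[OF uv(2)] uv(1) bd(2)[OF uv(3)]] diagram_family_mult f
      by blast
    have "normal_form2 \<epsilon> (diagram_mult n (select_two n u v) \<epsilon>)"
      unfolding normal_form2_def s U[OF uv(2)] U[OF uv(3)] pr(1)
      using s(5) uv by blast
    then show thesis using that c r unfolding normal_form_def by blast
  qed
qed

section \<open>The diagrams \<open>kappa n r\<close> and the effect of the tests on normal
  forms\<close>

definition kappa :: "nat \<Rightarrow> nat \<Rightarrow> diagram" where
  "kappa n r = (if r = 0 then one_pair n (Lower 1) (Lower 2)
    else if r = 1 then one_pair n (Upper 1) (Lower 1) else one_pair n (Upper 1) (Upper 2))"

lemma kappa_in_family: "2 \<le> n \<Longrightarrow> kappa n r \<in> diagram_family n pl br"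
  by (auto simp: kappa_def intro!: one_pair_in_family)

lemma kappa_neq_dots:
  assumes "2 \<le> n"
  shows "kappa n r \<noteq> dots n"
proof -
  have "one_pair n a b \<noteq> dots n" if "a \<in> vertices n" "b \<in> vertices n" "a \<noteq> b" for a b
  proof -
    have "rel (one_pair n a b) a b" using that by (simp add: rel_one_pair edge_def)
    moreover have "\<not> rel (dots n) a b" using that assms by (simp add: rel_dots)
    ultimately show ?thesis by metis
  qed
  then show ?thesis using assms by (auto simp: kappa_def)
qed

text \<open>
  Right multiples of the diagrams in normal form by the diagrams used as tests are either
  \<open>dots n\<close> or \<open>kappa n r\<close>, since all but two of their vertices are isolated.
\<close>

lemma mult_eq_one_pairI:
  assumes ab: "\<alpha> \<in> diagrams n" "\<beta> \<in> diagrams n" and v: "a \<in> vertices n" "b \<in> vertices n"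
    and U: "\<And>i. Upper i \<noteq> a \<Longrightarrow> Upper i \<noteq> b \<Longrightarrow> isolated \<alpha> (Upper i)"
    and L: "\<And>i. Lower i \<noteq> a \<Longrightarrow> Lower i \<noteq> b \<Longrightarrow> isolated \<beta> (Lower i)"
  shows "diagram_mult n \<alpha> \<beta> = (if rel (diagram_mult n \<alpha> \<beta>) a b then one_pair n a b else dots n)"
proof (rule eq_one_pairI[OF diagram_mult_in_diagrams v])
  fix w assume "w \<in> vertices n" "w \<noteq> a" "w \<noteq> b"
  then show "isolated (diagram_mult n \<alpha> \<beta>) w"
    using isolated_mult[OF ab] U L by (cases w) auto
qed

text \<open>A block with two vertices would need two vertices that are not isolated, and here only
  the upper vertex 1 could be one. The proof takes the degenerate pair at this vertex.\<close>

lemma mult_dotsI: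
  assumes "1 \<le> n" "\<alpha> \<in> diagrams n" "\<beta> \<in> diagrams n"
    and "\<And>i. 2 \<le> i \<Longrightarrow> isolated \<alpha> (Upper i)" "\<And>i. isolated \<beta> (Lower i)"
  shows "diagram_mult n \<alpha> \<beta> = dots n"
proof -
  \<comment> \<open>Index 0 is no vertex and counts as isolated.\<close>
  have "isolated \<alpha> (Upper i)" if "i \<noteq> 1" for i
    using assms(4)[of i] isolated_outside[OF assms(2), of "Upper i"] that by (cases "i = 0") auto
  then show ?thesis
    using mult_eq_one_pairI[of \<alpha> n \<beta> "Upper 1" "Upper 1"] assms unfolding dots_def
    by (simp split: if_splits)
qed

lemma mult_dotsI':
  assumes "1 \<le> n" "\<alpha> \<in> diagrams n" "\<beta> \<in> diagrams n"
    and "\<And>i. isolated \<alpha> (Upper i)" "\<And>i. 2 \<le> i \<Longrightarrow> isolated \<beta> (Lower i)"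
  shows "diagram_mult n \<alpha> \<beta> = dots n"
proof -
  have "isolated \<beta> (Lower i)" if "i \<noteq> 1" for i
    using assms(5)[of i] isolated_outside[OF assms(3), of "Lower i"] that by (cases "i = 0") auto
  then have "diagram_mult n \<alpha> \<beta> = (if rel (diagram_mult n \<alpha> \<beta>) (Lower 1) (Lower 1)
      then one_pair n (Lower 1) (Lower 1) else dots n)"
    by (intro mult_eq_one_pairI) (use assms in auto)
  moreover have "one_pair n (Lower 1) (Lower 1) = dots n"
  proof (rule diagram_eqI)
    have "Lower 1 \<in> vertices n" using assms by simp
    then show "one_pair n (Lower 1) (Lower 1) \<in> diagrams n" "dots n \<in> diagrams n"
      "rel (one_pair n (Lower 1) (Lower 1)) x y \<longleftrightarrow> rel (dots n) x y" for x y
      using one_pair_in_family[of "Lower 1" n "Lower 1" False False] dots_in_family[of n False False] assms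
      by (auto simp: rel_one_pair rel_dots edge_def diagram_family_def)
  qed
  ultimately show ?thesis by (simp split: if_splits)
qed

lemma isolated_dots: "1 \<le> n \<Longrightarrow> isolated (dots n) v"
  by (simp add: isolated_def rel_dots)

lemma isolated_one_pair:
  "a \<in> vertices n \<Longrightarrow> b \<in> vertices n \<Longrightarrow> v \<noteq> a \<Longrightarrow> v \<noteq> b \<Longrightarrow> isolated (one_pair n a b) v"
  by (simp add: isolated_def rel_one_pair edge_def)

lemma isolated_two_pairs:
  assumes "{a, b} \<inter> {c, d} = {}"
    and "a \<in> vertices n" "b \<in> vertices n" "c \<in> vertices n" "d \<in> vertices n"
    and "v \<notin> {a, b, c, d}"
  shows "isolated (two_pairs n a b c d) v"
  using rel_two_pairs[of a b c d n v] assms unfolding isolated_def by (auto simp: edge_def)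

lemma family_projectionsD:
  assumes "\<epsilon> \<in> family_projections n pl br"
  shows "\<epsilon> \<in> diagram_family n pl br" "\<epsilon> \<in> diagrams n" "diagram_mult n \<epsilon> \<epsilon> = \<epsilon>"
    "diagram_star \<epsilon> = \<epsilon>" "diagram_rank \<epsilon> \<le> 2"
  using assms by (auto simp: family_projections_def diagram_family_def)

lemma kappa_simps:
  "kappa n 0 = one_pair n (Lower 1) (Lower 2)" "kappa n 1 = one_pair n (Upper 1) (Lower 1)"
  "kappa n 2 = one_pair n (Upper 1) (Upper 2)"
  by (simp_all add: kappa_def)

text \<open>The lower row of t is isolated, so the only thing the product can still do is join 1 to
  2. It does so iff the two transversals, represented by u and v, become connected in the middle
  row.\<close>

lemma nf2_mult:
  assumes n: "2 \<le> n" and g: "\<gamma> \<in> diagrams n" and nf: "normal_form2 \<epsilon> \<gamma>"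
  obtains u v where "marked \<epsilon> u" "marked \<epsilon> v" "\<not> ker \<epsilon> u v"
    "\<And>i. marked \<epsilon> i \<Longrightarrow> ker \<epsilon> u i \<or> ker \<epsilon> v i"
    "\<And>t. t \<in> diagrams n \<Longrightarrow> (\<And>i. isolated t (Lower i)) \<Longrightarrow>
      diagram_mult n \<gamma> t = (if (u, v) \<in> mid \<gamma> t then kappa n 2 else dots n)"
proof -
  obtain u v where uv: "marked \<epsilon> u" "marked \<epsilon> v" "\<not> ker \<epsilon> u v"
    "\<And>i. marked \<epsilon> i \<Longrightarrow> ker \<epsilon> u i \<or> ker \<epsilon> v i"
    and r: "\<And>j. rel \<gamma> (Upper 1) (Lower j) \<longleftrightarrow> ker \<epsilon> u j"
      "\<And>j. rel \<gamma> (Upper 2) (Lower j) \<longleftrightarrow> ker \<epsilon> v j"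
    using nf unfolding normal_form2_def by metis
  have k: "ker \<gamma> i j \<longleftrightarrow> ker \<epsilon> i j" for i j using nf unfolding normal_form2_def by blast
  have r': "rel \<gamma> (Lower j) (Upper 2) \<longleftrightarrow> ker \<epsilon> v j" for j using r(2) rel_sym by blast
  have "diagram_mult n \<gamma> t = (if (u, v) \<in> mid \<gamma> t then kappa n 2 else dots n)"
    if t: "t \<in> diagrams n" and iso: "\<And>i. isolated t (Lower i)" for t
  proof -
    have "isolated \<gamma> (Upper i)" if "i \<noteq> 1" "i \<noteq> 2" for i
      using nf isolated_outside[OF g, of "Upper i"] that unfolding normal_form2_def
      by (cases "i = 0") auto
    then have *: "diagram_mult n \<gamma> t =
        (if rel (diagram_mult n \<gamma> t) (Upper 1) (Upper 2) then kappa n 2 else dots n)"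
      unfolding kappa_simps by (intro mult_eq_one_pairI[OF g t]) (use n iso in auto)
    have eq: "rel (diagram_mult n \<gamma> t) (Upper 1) (Upper 2) \<longleftrightarrow> (u, v) \<in> mid \<gamma> t"
    proof -
      have "rel (diagram_mult n \<gamma> t) (Upper 1) (Upper 2) \<longleftrightarrow>
          (\<exists>p q. ker \<epsilon> u p \<and> (p, q) \<in> mid \<gamma> t \<and> ker \<epsilon> v q)"
        using nf unfolding rel_mult_cases[OF g t] r r' normal_form2_def by blast
      also have "\<dots> \<longleftrightarrow> (u, v) \<in> mid \<gamma> t"
      proof
        assume "\<exists>p q. ker \<epsilon> u p \<and> (p, q) \<in> mid \<gamma> t \<and> ker \<epsilon> v q"
        then obtain p q where pq: "ker \<gamma> u p" "(p, q) \<in> mid \<gamma> t" "ker \<gamma> v q" using k by blast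
        from mid_lower[OF pq(1)] pq(2) mid_lower[OF rel_sym[OF pq(3)]]
        show "(u, v) \<in> mid \<gamma> t" by (meson mid_trans)
      next
        assume m: "(u, v) \<in> mid \<gamma> t"
        \<comment> \<open>The covering property is applied to u and v themselves; the other
          alternative would relate u to v.\<close>
        have "ker \<epsilon> u u" "ker \<epsilon> v v" using uv rel_sym by blast+
        then show "\<exists>p q. ker \<epsilon> u p \<and> (p, q) \<in> mid \<gamma> t \<and> ker \<epsilon> v q" using m by blast
      qed
      finally show ?thesis .
    qed
    show ?thesis by (subst *) (simp only: eq)
  qed
  then show thesis using that uv by blast
qed


lemma marked_bounds:
  assumes "\<epsilon> \<in> diagrams n" "marked \<epsilon> i"
  shows "1 \<le> i" "i \<le> n"
  using assms rel_bounds unfolding marked_def by blast+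

text \<open>A single string from a to b connects the two transversals iff it starts in one of them
  and ends in the other.\<close>

lemma nf2_one_pair:
  assumes n: "2 \<le> n" and e: "\<epsilon> \<in> family_projections n pl br"
    and g: "\<gamma> \<in> diagrams n" and nf: "normal_form2 \<epsilon> \<gamma>"
    and i: "1 \<le> a" "a \<le> n" "1 \<le> b" "b \<le> n"
  shows "diagram_mult n \<gamma> (one_pair n (Upper a) (Upper b)) =
    (if marked \<epsilon> a \<and> marked \<epsilon> b \<and> \<not> ker \<epsilon> a b then kappa n 2 else dots n)"
proof (rule nf2_mult[OF n g nf])
  fix u v assume uv: "marked \<epsilon> u" "marked \<epsilon> v" "\<not> ker \<epsilon> u v"
    "\<And>i. marked \<epsilon> i \<Longrightarrow> ker \<epsilon> u i \<or> ker \<epsilon> v i"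
    and t: "\<And>t. t \<in> diagrams n \<Longrightarrow> (\<And>i. isolated t (Lower i)) \<Longrightarrow>
      diagram_mult n \<gamma> t = (if (u, v) \<in> mid \<gamma> t then kappa n 2 else dots n)"
  let ?t = "one_pair n (Upper a) (Upper b)"
  note d = family_projectionsD[OF e]
  note tr = rel_trans[OF d(2)]
  have v: "Upper a \<in> vertices n" "Upper b \<in> vertices n" using i by auto
  have td: "?t \<in> diagrams n" using one_pair_in_family[OF v] family_imp_diagram by blast
  have iso: "isolated ?t (Lower i)" for i by (rule isolated_one_pair[OF v]) auto
  have k: "ker \<gamma> i j \<longleftrightarrow> ker \<epsilon> i j" for i j using nf unfolding normal_form2_def by blast
  have "(u, v) \<in> mid \<gamma> ?t \<longleftrightarrow> marked \<epsilon> a \<and> marked \<epsilon> b \<and> \<not> ker \<epsilon> a b"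
  proof
    assume m: "(u, v) \<in> mid \<gamma> ?t"
    \<comment> \<open>What u reaches: its own class and, if the string starts there, the class at
      the other end of the string.\<close>
    let ?Z = "{p. ker \<epsilon> u p \<or> ker \<epsilon> u a \<and> ker \<epsilon> b p \<or> ker \<epsilon> u b \<and> ker \<epsilon> a p}"
    have "v \<in> ?Z"
    proof (rule mid_closed[OF m])
      show "u \<in> ?Z" using uv rel_sym by blast
      show "j \<in> ?Z" if "i \<in> ?Z" "ker \<gamma> i j" for i j
        using that k tr by blast
      show "j \<in> ?Z" if "i \<in> ?Z" "rel ?t (Upper i) (Upper j)" for i j
      proof -
        have "i = j \<or> i = a \<and> j = b \<or> i = b \<and> j = a"
          using that(2) by (auto simp: rel_one_pair[OF v] edge_def)
        moreover have "ker \<epsilon> a a" "ker \<epsilon> b b" using i by (simp_all add: rel_refl[OF d(2)])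
        ultimately show ?thesis using that(1) by blast
      qed
    qed
    then have "ker \<epsilon> u a \<and> ker \<epsilon> b v \<or> ker \<epsilon> u b \<and> ker \<epsilon> a v" using uv by blast
    moreover have "marked \<epsilon> i" if "ker \<epsilon> u i \<or> ker \<epsilon> i v" for i
      using that uv marked_cong[OF d(2-4)] rel_sym by blast
    ultimately show "marked \<epsilon> a \<and> marked \<epsilon> b \<and> \<not> ker \<epsilon> a b"
      using uv(3) tr rel_sym by blast
  next
    assume m: "marked \<epsilon> a \<and> marked \<epsilon> b \<and> \<not> ker \<epsilon> a b"
    then have "ker \<epsilon> u a \<or> ker \<epsilon> v a" "ker \<epsilon> u b \<or> ker \<epsilon> v b" using uv by blast+
    then have "ker \<epsilon> u a \<and> ker \<epsilon> b v \<or> ker \<epsilon> u b \<and> ker \<epsilon> a v"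
      using m tr rel_sym by blast
    moreover have "(a, b) \<in> mid \<gamma> ?t" by (rule mid_upper) (simp add: rel_one_pair[OF v] edge_def)
    moreover from this have "(b, a) \<in> mid \<gamma> ?t" by (rule mid_sym)
    ultimately show "(u, v) \<in> mid \<gamma> ?t"
      using mid_lower[of _ _ \<gamma> ?t] k by (meson mid_trans)
  qed
  then show ?thesis using t[OF td iso] by simp
qed

text \<open>The strings tie the two transversals to the classes of x and y, which belong to no
  transversal; a connection arises only if these two classes are the same.\<close>

lemma nf2_two_pairs:
  assumes n: "2 \<le> n" and e: "\<epsilon> \<in> family_projections n pl br"
    and g: "\<gamma> \<in> diagrams n" and nf: "normal_form2 \<epsilon> \<gamma>"
    and m: "marked \<epsilon> a" "marked \<epsilon> b" "\<not> ker \<epsilon> a b"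
    and x: "\<not> marked \<epsilon> x" "\<not> marked \<epsilon> y" "1 \<le> x" "x \<le> n" "1 \<le> y" "y \<le> n" "x \<noteq> y"
  shows "diagram_mult n \<gamma> (two_pairs n (Upper a) (Upper x) (Upper b) (Upper y)) =
    (if ker \<epsilon> x y then kappa n 2 else dots n)"
proof (rule nf2_mult[OF n g nf])
  fix u v assume uv: "marked \<epsilon> u" "marked \<epsilon> v" "\<not> ker \<epsilon> u v"
    "\<And>i. marked \<epsilon> i \<Longrightarrow> ker \<epsilon> u i \<or> ker \<epsilon> v i"
    and t: "\<And>t. t \<in> diagrams n \<Longrightarrow> (\<And>i. isolated t (Lower i)) \<Longrightarrow>
      diagram_mult n \<gamma> t = (if (u, v) \<in> mid \<gamma> t then kappa n 2 else dots n)"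
  let ?t = "two_pairs n (Upper a) (Upper x) (Upper b) (Upper y)"
  note d = family_projectionsD[OF e]
  note tr = rel_trans[OF d(2)]
  have refl: "ker \<epsilon> i i" if "1 \<le> i" "i \<le> n" for i using that by (simp add: rel_refl[OF d(2)])
  have ab: "ker \<epsilon> a a" "ker \<epsilon> b b" using refl marked_bounds[OF d(2)] m by blast+
  have dis: "{Upper a, Upper x} \<inter> {Upper b, Upper y} = {}" using m x ab by auto
  have v: "Upper a \<in> vertices n" "Upper x \<in> vertices n" "Upper b \<in> vertices n" "Upper y \<in> vertices n"
    using marked_bounds[OF d(2)] m x by auto
  note r = rel_two_pairs[OF disjI2[OF dis] v]
  have td: "?t \<in> diagrams n"
    unfolding two_pairs_def by (rule quotient_in_diagrams[OF equiv_two_pairs]) (use dis in blast)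
  have iso: "isolated ?t (Lower i)" for i by (rule isolated_two_pairs[OF dis v]) auto
  have k: "ker \<gamma> i j \<longleftrightarrow> ker \<epsilon> i j" for i j using nf unfolding normal_form2_def by blast
  have ab_uv: "ker \<epsilon> u a \<and> ker \<epsilon> v b \<or> ker \<epsilon> v a \<and> ker \<epsilon> u b"
    using uv(4)[OF m(1)] uv(4)[OF m(2)] m(3) tr rel_sym by blast
  have "(u, v) \<in> mid \<gamma> ?t \<longleftrightarrow> ker \<epsilon> x y"
  proof
    assume mm: "(u, v) \<in> mid \<gamma> ?t"
    \<comment> \<open>If x and y lie in different classes, the classes of a and x together are
      closed and miss the class of b. Exactly one of u and v would then lie in this set.\<close>
    let ?Z = "{p. ker \<epsilon> a p \<or> ker \<epsilon> x p}"
    show "ker \<epsilon> x y"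
    proof (rule ccontr)
      assume xy: "\<not> ker \<epsilon> x y"
      have unm: "\<not> ker \<epsilon> i j" if "marked \<epsilon> i" "\<not> marked \<epsilon> j" for i j
        using that marked_cong[OF d(2-4)] by blast
      have unm': "\<not> ker \<epsilon> j i" if "marked \<epsilon> i" "\<not> marked \<epsilon> j" for i j
        using that unm rel_sym by blast
      have cl1: "j \<in> ?Z" if "i \<in> ?Z" "ker \<gamma> i j" for i j
        using that k tr by blast
      have cl2: "j \<in> ?Z" if "i \<in> ?Z" "rel ?t (Upper i) (Upper j)" for i j
      proof -
        have "i = j \<or> edge a x i j \<or> edge b y i j"
          using that(2) by (auto simp: r edge_def)
        moreover have "b \<notin> ?Z" "y \<notin> ?Z" using m(3) xy unm[OF m(1) x(2)] unm'[OF m(2) x(1)] by blast+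
        moreover have "a \<in> ?Z" "x \<in> ?Z" using ab refl x by auto
        ultimately show ?thesis using that(1) unfolding edge_def by blast
      qed
      have "u \<in> ?Z \<longleftrightarrow> v \<in> ?Z"
        using mid_closed[OF mm, of ?Z] mid_closed[OF mid_sym[OF mm], of ?Z] cl1 cl2 by blast
      moreover have "u \<in> ?Z \<longleftrightarrow> ker \<epsilon> a u" "v \<in> ?Z \<longleftrightarrow> ker \<epsilon> a v"
        using unm'[OF uv(1) x(1)] unm'[OF uv(2) x(1)] by blast+
      ultimately show False using ab_uv uv(3) tr rel_sym by blast
    qed
  next
    assume "ker \<epsilon> x y"
    then have xy: "(x, y) \<in> mid \<gamma> ?t" using mid_lower k by blast
    have "(a, x) \<in> mid \<gamma> ?t" by (rule mid_upper) (simp add: r edge_def)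
    moreover have "(b, y) \<in> mid \<gamma> ?t" by (rule mid_upper) (simp add: r edge_def)
    ultimately have ab: "(a, b) \<in> mid \<gamma> ?t" using xy mid_sym mid_trans by metis
    have l: "(i, j) \<in> mid \<gamma> ?t" if "ker \<epsilon> i j" for i j using that mid_lower k by blast
    from ab_uv show "(u, v) \<in> mid \<gamma> ?t"
    proof
      assume "ker \<epsilon> u a \<and> ker \<epsilon> v b"
      then show ?thesis using ab l mid_sym mid_trans by metis
    next
      assume "ker \<epsilon> v a \<and> ker \<epsilon> u b"
      then show ?thesis using ab l mid_sym mid_trans by metis
    qed
  qed
  then show ?thesis using t[OF td iso] by simp
qed

lemma nf1_mult:
  assumes n: "2 \<le> n" and g: "\<gamma> \<in> diagrams n" and nf: "normal_form1 \<epsilon> \<gamma>"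
    and t: "t \<in> diagrams n" and iso: "\<And>i. i \<noteq> 1 \<Longrightarrow> isolated t (Lower i)"
  shows "diagram_mult n \<gamma> t =
    (if \<exists>p q. marked \<epsilon> p \<and> (p, q) \<in> mid \<gamma> t \<and> rel t (Upper q) (Lower 1)
     then kappa n 1 else dots n)"
proof -
  have "isolated \<gamma> (Upper i)" if "i \<noteq> 1" for i
    using nf isolated_outside[OF g, of "Upper i"] that unfolding normal_form1_def
    by (cases "i = 0") auto
  then have *: "diagram_mult n \<gamma> t =
      (if rel (diagram_mult n \<gamma> t) (Upper 1) (Lower 1) then kappa n 1 else dots n)"
    unfolding kappa_simps by (intro mult_eq_one_pairI[OF g t]) (use n iso in auto)
  have eq: "rel (diagram_mult n \<gamma> t) (Upper 1) (Lower 1) \<longleftrightarrow>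
      (\<exists>p q. marked \<epsilon> p \<and> (p, q) \<in> mid \<gamma> t \<and> rel t (Upper q) (Lower 1))"
    using nf unfolding rel_mult_cases[OF g t] normal_form1_def by blast
  show ?thesis by (subst *) (simp only: eq)
qed

lemma nf1_one_pair:
  assumes n: "2 \<le> n" and e: "\<epsilon> \<in> family_projections n pl br"
    and g: "\<gamma> \<in> diagrams n" and nf: "normal_form1 \<epsilon> \<gamma>" and a: "1 \<le> a" "a \<le> n"
  shows "diagram_mult n \<gamma> (one_pair n (Upper a) (Lower 1)) =
    (if marked \<epsilon> a then kappa n 1 else dots n)"
proof -
  let ?t = "one_pair n (Upper a) (Lower 1)"
  note d = family_projectionsD[OF e]
  have v: "Upper a \<in> vertices n" "Lower 1 \<in> vertices n" using a n by auto
  have td: "?t \<in> diagrams n" using one_pair_in_family[OF v] family_imp_diagram by blast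
  have iso: "isolated ?t (Lower i)" if "i \<noteq> 1" for i by (rule isolated_one_pair[OF v]) (use that in auto)
  have k: "ker \<gamma> i j \<longleftrightarrow> ker \<epsilon> i j" for i j using nf unfolding normal_form1_def by blast
  have m: "(p, q) \<in> mid \<gamma> ?t \<longleftrightarrow> p = q \<or> ker \<epsilon> p q" for p q
    unfolding k[symmetric] by (rule mid_right[OF g]) (auto simp: rel_one_pair[OF v] edge_def)
  have rt: "rel ?t (Upper q) (Lower 1) \<longleftrightarrow> q = a" for q
    by (auto simp: rel_one_pair[OF v] edge_def)
  have "(\<exists>p q. marked \<epsilon> p \<and> (p, q) \<in> mid \<gamma> ?t \<and> rel ?t (Upper q) (Lower 1)) \<longleftrightarrow> marked \<epsilon> a"
    unfolding m rt using marked_cong[OF d(2-4)] rel_sym by blast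
  then show ?thesis using nf1_mult[OF n g nf td iso] by simp
qed

text \<open>A path from 1 to 1' has to follow the transversal to a, the string to x, the kernel
  class to y and the string down to 1'.\<close>

lemma nf1_two_pairs:
  assumes n: "2 \<le> n" and e: "\<epsilon> \<in> family_projections n pl br"
    and g: "\<gamma> \<in> diagrams n" and nf: "normal_form1 \<epsilon> \<gamma>"
    and m: "marked \<epsilon> a"
    and x: "\<not> marked \<epsilon> x" "\<not> marked \<epsilon> y" "1 \<le> x" "x \<le> n" "1 \<le> y" "y \<le> n" "x \<noteq> y"
  shows "diagram_mult n \<gamma> (two_pairs n (Upper a) (Upper x) (Upper y) (Lower 1)) =
    (if ker \<epsilon> x y then kappa n 1 else dots n)"
proof -
  let ?t = "two_pairs n (Upper a) (Upper x) (Upper y) (Lower 1)"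
  note d = family_projectionsD[OF e]
  note tr = rel_trans[OF d(2)]
  have refl: "ker \<epsilon> i i" if "1 \<le> i" "i \<le> n" for i using that by (simp add: rel_refl[OF d(2)])
  have dis: "{Upper a, Upper x} \<inter> {Upper y, Lower 1} = {}" using m x by auto
  have v: "Upper a \<in> vertices n" "Upper x \<in> vertices n" "Upper y \<in> vertices n" "Lower 1 \<in> vertices n"
    using marked_bounds[OF d(2)] m x n by auto
  note r = rel_two_pairs[OF disjI2[OF dis] v]
  have td: "?t \<in> diagrams n"
    unfolding two_pairs_def by (rule quotient_in_diagrams[OF equiv_two_pairs]) (use dis in blast)
  have iso: "isolated ?t (Lower i)" if "i \<noteq> 1" for i
    by (rule isolated_two_pairs[OF dis v]) (use that in auto)
  have k: "ker \<gamma> i j \<longleftrightarrow> ker \<epsilon> i j" for i j using nf unfolding normal_form1_def by blast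
  have rt: "rel ?t (Upper q) (Lower 1) \<longleftrightarrow> q = y" for q by (auto simp: r edge_def)
  have "(\<exists>p. marked \<epsilon> p \<and> (p, y) \<in> mid \<gamma> ?t) \<longleftrightarrow> ker \<epsilon> x y"
  proof
    assume "\<exists>p. marked \<epsilon> p \<and> (p, y) \<in> mid \<gamma> ?t"
    then obtain p where p: "marked \<epsilon> p" "(p, y) \<in> mid \<gamma> ?t" by blast
    have "y \<in> {p. marked \<epsilon> p \<or> ker \<epsilon> x p}"
    proof (rule mid_closed[OF p(2)])
      show "j \<in> {p. marked \<epsilon> p \<or> ker \<epsilon> x p}" if "i \<in> {p. marked \<epsilon> p \<or> ker \<epsilon> x p}" "ker \<gamma> i j" for i j
        using that k tr marked_cong[OF d(2-4)] by blast
      show "j \<in> {p. marked \<epsilon> p \<or> ker \<epsilon> x p}"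
        if "i \<in> {p. marked \<epsilon> p \<or> ker \<epsilon> x p}" "rel ?t (Upper i) (Upper j)" for i j
        using that m refl x by (auto simp: r edge_def)
    qed (use p in simp)
    then show "ker \<epsilon> x y" using x by simp
  next
    assume "ker \<epsilon> x y"
    then have "(x, y) \<in> mid \<gamma> ?t" using mid_lower k by blast
    moreover have "(a, x) \<in> mid \<gamma> ?t" by (rule mid_upper) (simp add: r edge_def)
    ultimately show "\<exists>p. marked \<epsilon> p \<and> (p, y) \<in> mid \<gamma> ?t" using mid_trans m by blast
  qed
  then show ?thesis using nf1_mult[OF n g nf td iso] unfolding rt by simp
qed

text \<open>The strings carry x and y down to 1' and 2', where the kernel is read off.\<close>

lemma nf0_two_pairs:
  assumes n: "2 \<le> n" and g: "\<gamma> \<in> diagrams n" and nf: "normal_form0 \<epsilon> \<gamma>"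
    and x: "1 \<le> x" "x \<le> n" "1 \<le> y" "y \<le> n" "x \<noteq> y"
  shows "diagram_mult n \<gamma> (two_pairs n (Upper x) (Lower 1) (Upper y) (Lower 2)) =
    (if ker \<epsilon> x y then kappa n 0 else dots n)"
proof -
  let ?t = "two_pairs n (Upper x) (Lower 1) (Upper y) (Lower 2)"
  have dis: "{Upper x, Lower 1} \<inter> {Upper y, Lower 2} = {}" using x by auto
  have v: "Upper x \<in> vertices n" "Lower 1 \<in> vertices n" "Upper y \<in> vertices n" "Lower 2 \<in> vertices n"
    using x n by auto
  note r = rel_two_pairs[OF disjI2[OF dis] v]
  have td: "?t \<in> diagrams n"
    unfolding two_pairs_def by (rule quotient_in_diagrams[OF equiv_two_pairs]) (use dis in blast)
  have iso: "isolated ?t (Lower i)" if "i \<noteq> 1" "i \<noteq> 2" for i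
    by (rule isolated_two_pairs[OF dis v]) (use that in auto)
  have k: "ker \<gamma> i j \<longleftrightarrow> ker \<epsilon> i j" for i j using nf unfolding normal_form0_def by blast
  have m: "(p, q) \<in> mid \<gamma> ?t \<longleftrightarrow> p = q \<or> ker \<epsilon> p q" for p q
    unfolding k[symmetric] by (rule mid_right[OF g]) (auto simp: r edge_def)
  have rt: "rel ?t (Lower 1) (Upper q) \<longleftrightarrow> q = x" "rel ?t (Upper q) (Lower 2) \<longleftrightarrow> q = y"
    "\<not> rel ?t (Lower 1) (Lower 2)" for q
    using x by (auto simp: r edge_def)
  have eq: "rel (diagram_mult n \<gamma> ?t) (Lower 1) (Lower 2) \<longleftrightarrow> ker \<epsilon> x y"
    unfolding rel_mult_cases[OF g td] m rt(1,2) using x rt(3) by simp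
  have "isolated \<gamma> (Upper i)" for i using nf unfolding normal_form0_def by blast
  then have *: "diagram_mult n \<gamma> ?t =
      (if rel (diagram_mult n \<gamma> ?t) (Lower 1) (Lower 2) then kappa n 0 else dots n)"
    unfolding kappa_simps by (intro mult_eq_one_pairI[OF g td]) (use n iso in auto)
  show ?thesis by (subst *) (simp only: eq)
qed

text \<open>For rank at most 1 only the upper vertex 1 could be joined to anything. For rank 2 the
  vertices 1 and 2 stay apart, since \<open>dots n\<close> adds no connection between the two
  transversals.\<close>

lemma normal_form_dots:
  assumes n: "2 \<le> n" and g: "\<gamma> \<in> diagrams n" and nf: "normal_form \<epsilon> \<gamma>"
  shows "diagram_mult n \<gamma> (dots n) = dots n"
proof (cases "diagram_rank \<epsilon> = 2")
  case True
  then have nf2: "normal_form2 \<epsilon> \<gamma>" using nf by (simp add: normal_form_def)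
  have dd: "dots n \<in> diagrams n" using dots_in_family n family_imp_diagram by force
  show ?thesis
  proof (rule nf2_mult[OF n g nf2])
    fix u v assume uv: "\<not> ker \<epsilon> u v" "marked \<epsilon> u" "marked \<epsilon> v"
        "\<And>i. marked \<epsilon> i \<Longrightarrow> ker \<epsilon> u i \<or> ker \<epsilon> v i"
      and t: "\<And>t. t \<in> diagrams n \<Longrightarrow> (\<And>i. isolated t (Lower i)) \<Longrightarrow>
      diagram_mult n \<gamma> t = (if (u, v) \<in> mid \<gamma> t then kappa n 2 else dots n)"
    have "(u, v) \<in> mid \<gamma> (dots n) \<longleftrightarrow> u = v \<or> ker \<gamma> u v"
      by (rule mid_right[OF g]) (use n in \<open>auto simp: rel_dots\<close>)
    then have "(u, v) \<notin> mid \<gamma> (dots n)"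
      using nf2 uv unfolding normal_form2_def by blast
    then show ?thesis using t[OF dd] isolated_dots n by simp
  qed
next
  case False
  then have "normal_form0 \<epsilon> \<gamma> \<or> normal_form1 \<epsilon> \<gamma>" using nf by (auto simp: normal_form_def)
  then show ?thesis
    using n dots_in_family[of n] family_imp_diagram
    by (intro mult_dotsI[OF _ g]) (auto simp: normal_form0_def normal_form1_def isolated_dots)
qed

subsection \<open>Separating diagrams in normal form\<close>

lemma separation2:
  assumes n: "2 \<le> n"
    and e: "\<epsilon> \<in> family_projections n pl br" "diagram_rank \<epsilon> = 2" "normal_form2 \<epsilon> \<gamma>" "\<gamma> \<in> diagrams n"
    and d: "\<delta> \<in> family_projections n pl br" "diagram_rank \<delta> = 2" "normal_form2 \<delta> \<eta>" "\<eta> \<in> diagrams n"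
    and ne: "\<epsilon> \<noteq> \<delta>"
  obtains t P Q where "t \<in> diagram_family n pl br" "P \<noteq> Q"
    "diagram_mult n \<gamma> t = (if P then kappa n 2 else dots n)"
    "diagram_mult n \<eta> t = (if Q then kappa n 2 else dots n)"
proof -
  note result = that
  \<comment> \<open>\<open>W\<close> relates indices from different transversals; these are the
    pairs that a single string detects.\<close>
  define W where "W \<alpha> i j \<longleftrightarrow> marked \<alpha> i \<and> marked \<alpha> j \<and> \<not> ker \<alpha> i j" for \<alpha> i j
  note E = family_projectionsD[OF e(1)] and D = family_projectionsD[OF d(1)]
  have bd: "1 \<le> i \<and> i \<le> n \<and> 1 \<le> j \<and> j \<le> n" if "W \<alpha> i j" "\<alpha> \<in> diagrams n" for \<alpha> i j
    using that marked_bounds unfolding W_def by blast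
  show thesis
  proof (cases "\<exists>a b. W \<epsilon> a b \<noteq> W \<delta> a b")
    case True
    then obtain a b where ab: "W \<epsilon> a b \<noteq> W \<delta> a b" by blast
    have i: "1 \<le> a" "a \<le> n" "1 \<le> b" "b \<le> n" using ab bd E(2) D(2) by blast+
    show thesis
      by (rule that[OF _ ab]) (use nf2_one_pair[OF n e(1,4,3) i] nf2_one_pair[OF n d(1,4,3) i]
        one_pair_in_family i in \<open>auto simp: W_def\<close>)
  next
    case False
    then have W: "W \<epsilon> a b \<longleftrightarrow> W \<delta> a b" for a b by blast
    \<comment> \<open>With two transversals, each marked index has a counterpart in the other one,
      so \<open>W\<close> determines the marked set.\<close>
    have partner: "marked \<alpha> i \<longleftrightarrow> (\<exists>j. W \<alpha> i j)" if nf: "normal_form2 \<alpha> \<beta>" and al: "\<alpha> \<in> diagrams n" for \<alpha> \<beta> i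
    proof -
      obtain u v where "marked \<alpha> u" "marked \<alpha> v" "\<not> ker \<alpha> u v" "\<forall>i. marked \<alpha> i \<longrightarrow> ker \<alpha> u i \<or> ker \<alpha> v i"
        using nf unfolding normal_form2_def by metis
      then show ?thesis using rel_trans[OF al] rel_sym unfolding W_def by metis
    qed
    have mk: "marked \<epsilon> i \<longleftrightarrow> marked \<delta> i" for i
      using partner[OF e(3) E(2)] partner[OF d(3) D(2)] W by simp
    obtain x y where xy: "ker \<epsilon> x y \<noteq> ker \<delta> x y"
      using ne projection_eqI[OF E(2-4) D(2-4)] mk by blast
    have "marked \<epsilon> y" if "marked \<epsilon> x"
      using that xy marked_cong[OF E(2-4)] marked_cong[OF D(2-4)] mk by blast
    moreover have "marked \<epsilon> x" if "marked \<epsilon> y"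
      using that xy marked_cong[OF E(2-4)] marked_cong[OF D(2-4)] mk rel_sym by blast
    \<comment> \<open>Equal marked sets and equal \<open>W\<close> leave no room for different
      kernels on marked indices, so x and y are unmarked.\<close>
    moreover have "\<not> (marked \<epsilon> x \<and> marked \<epsilon> y)"
      using W[of x y] xy mk unfolding W_def by blast
    ultimately have x: "\<not> marked \<epsilon> x" "\<not> marked \<epsilon> y" by blast+
    have x': "\<not> marked \<delta> x" "\<not> marked \<delta> y" using x mk by blast+
    have i: "1 \<le> x" "x \<le> n" "1 \<le> y" "y \<le> n" using xy rel_bounds[OF E(2)] rel_bounds[OF D(2)] by blast+
    have ne: "x \<noteq> y" using xy i by (auto simp: rel_refl[OF E(2)] rel_refl[OF D(2)])
    obtain a b where ab: "W \<epsilon> a b" using e(3) unfolding normal_form2_def W_def by metis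
    have m: "marked \<epsilon> a" "marked \<epsilon> b" "\<not> ker \<epsilon> a b" "marked \<delta> a" "marked \<delta> b" "\<not> ker \<delta> a b"
      using ab W unfolding W_def by blast+
    have "a \<noteq> b" using m bd[OF ab E(2)] by (auto simp: rel_refl[OF E(2)])
    then have dst: "a \<noteq> b" "a \<noteq> x" "a \<noteq> y" "b \<noteq> x" "b \<noteq> y" using x m by auto
    \<comment> \<open>The pair of p and q is x and y in an order for which the strings from a to p
      and from b to q do not cross.\<close>
    have thesis if p: "p \<in> {x, y}" "q \<in> {x, y}" "p \<noteq> q" "between a p b \<longleftrightarrow> between a p q" for p q
    proof (rule result)
      let ?t = "two_pairs n (Upper a) (Upper p) (Upper b) (Upper q)"
      show "?t \<in> diagram_family n pl br"
        by (rule two_pairs_in_family) (use p dst i bd[OF ab E(2)] in auto)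
      have v: "\<not> marked \<epsilon> p" "\<not> marked \<epsilon> q" "1 \<le> p" "p \<le> n" "1 \<le> q" "q \<le> n" "p \<noteq> q"
        and v': "\<not> marked \<delta> p" "\<not> marked \<delta> q" "1 \<le> p" "p \<le> n" "1 \<le> q" "q \<le> n" "p \<noteq> q"
        using x x' i p by auto
      show "ker \<epsilon> p q \<noteq> ker \<delta> p q"
        using p xy rel_sym by blast
      show "diagram_mult n \<gamma> ?t = (if ker \<epsilon> p q then kappa n 2 else dots n)"
        by (rule nf2_two_pairs[OF n e(1,4,3) m(1-3) v])
      show "diagram_mult n \<eta> ?t = (if ker \<delta> p q then kappa n 2 else dots n)"
        by (rule nf2_two_pairs[OF n d(1,4,3) m(4-6) v'])
    qed
    \<comment> \<open>Of the three ways to pair four points on a line exactly one crosses, so at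
      least one of the two orders is planar.\<close>
    moreover have "(between a x b \<longleftrightarrow> between a x y) \<or> (between a y b \<longleftrightarrow> between a y x)"
      using dst ne unfolding between_def by linarith
    ultimately show thesis using ne by blast
  qed
qed

lemma separation1:
  assumes n: "2 \<le> n"
    and e: "\<epsilon> \<in> family_projections n pl br" "diagram_rank \<epsilon> = 1" "normal_form1 \<epsilon> \<gamma>" "\<gamma> \<in> diagrams n"
    and d: "\<delta> \<in> family_projections n pl br" "diagram_rank \<delta> = 1" "normal_form1 \<delta> \<eta>" "\<eta> \<in> diagrams n"
    and ne: "\<epsilon> \<noteq> \<delta>"
  obtains t P Q where "t \<in> diagram_family n pl br" "P \<noteq> Q"
    "diagram_mult n \<gamma> t = (if P then kappa n 1 else dots n)"
    "diagram_mult n \<eta> t = (if Q then kappa n 1 else dots n)"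
proof (cases "\<exists>a. marked \<epsilon> a \<noteq> marked \<delta> a")
  note result = that
  note E = family_projectionsD[OF e(1)] and D = family_projectionsD[OF d(1)]
  {
    case True
    then obtain a where a: "marked \<epsilon> a \<noteq> marked \<delta> a" by blast
    have i: "1 \<le> a" "a \<le> n" using a marked_bounds[OF E(2)] marked_bounds[OF D(2)] by blast+
    show thesis
      by (rule that[OF _ a]) (use nf1_one_pair[OF n e(1,4,3) i] nf1_one_pair[OF n d(1,4,3) i]
        one_pair_in_family i n in auto)
  next
    case False
    then have mk: "marked \<epsilon> i \<longleftrightarrow> marked \<delta> i" for i by blast
    obtain x y where xy: "ker \<epsilon> x y \<noteq> ker \<delta> x y"
      using ne projection_eqI[OF E(2-4) D(2-4)] mk by blast
    \<comment> \<open>For rank 1 the marked indices form a single class, so the kernels cannot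
      differ there.\<close>
    have all: "ker \<alpha> i j" if mij: "marked \<alpha> i" "marked \<alpha> j"
      and al: "\<alpha> \<in> family_projections n pl br" "diagram_rank \<alpha> = 1" for \<alpha> i j
    proof -
      note A = family_projectionsD[OF al(1)]
      obtain u where "\<And>k. marked \<alpha> k \<Longrightarrow> ker \<alpha> u k"
        by (rule rank_cases[OF A(2-5)]) (use al(2) in auto)
      then have "ker \<alpha> u i" "ker \<alpha> u j" using mij by blast+
      then show ?thesis using rel_trans[OF A(2)] rel_sym by blast
    qed
    have "marked \<epsilon> y" if "marked \<epsilon> x"
      using that xy marked_cong[OF E(2-4)] marked_cong[OF D(2-4)] mk by blast
    moreover have "marked \<epsilon> x" if "marked \<epsilon> y"
      using that xy marked_cong[OF E(2-4)] marked_cong[OF D(2-4)] mk rel_sym by blast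
    moreover have "\<not> (marked \<epsilon> x \<and> marked \<epsilon> y)"
      using all[OF _ _ e(1,2)] all[OF _ _ d(1,2)] xy mk by blast
    ultimately have x: "\<not> marked \<epsilon> x" "\<not> marked \<epsilon> y" by blast+
    have x': "\<not> marked \<delta> x" "\<not> marked \<delta> y" using x mk by blast+
    have i: "1 \<le> x" "x \<le> n" "1 \<le> y" "y \<le> n" using xy rel_bounds[OF E(2)] rel_bounds[OF D(2)] by blast+
    have ne: "x \<noteq> y" using xy i by (auto simp: rel_refl[OF E(2)] rel_refl[OF D(2)])
    obtain a where a: "marked \<epsilon> a"
      by (rule rank_cases[OF E(2-5)]) (use e(2) in auto)
    then have a': "marked \<delta> a" "1 \<le> a" "a \<le> n" using mk marked_bounds[OF E(2)] by blast+
    have dst: "a \<noteq> x" "a \<noteq> y" using a x by auto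
    \<comment> \<open>In the boundary order 1' comes last, so the string from q to 1' crosses the
      string from a to p iff q lies between a and p.\<close>
    have thesis if p: "p \<in> {x, y}" "q \<in> {x, y}" "p \<noteq> q" "\<not> between a p q" for p q
    proof (rule result)
      let ?t = "two_pairs n (Upper a) (Upper p) (Upper q) (Lower 1)"
      show "?t \<in> diagram_family n pl br"
        by (rule two_pairs_in_family) (use p dst i n a' in \<open>auto simp: between_def\<close>)
      have v: "\<not> marked \<epsilon> p" "\<not> marked \<epsilon> q" "1 \<le> p" "p \<le> n" "1 \<le> q" "q \<le> n" "p \<noteq> q"
        and v': "\<not> marked \<delta> p" "\<not> marked \<delta> q" "1 \<le> p" "p \<le> n" "1 \<le> q" "q \<le> n" "p \<noteq> q"
        using x x' i p by auto
      show "ker \<epsilon> p q \<noteq> ker \<delta> p q"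
        using p xy rel_sym by blast
      show "diagram_mult n \<gamma> ?t = (if ker \<epsilon> p q then kappa n 1 else dots n)"
        by (rule nf1_two_pairs[OF n e(1,4,3) a v])
      show "diagram_mult n \<eta> ?t = (if ker \<delta> p q then kappa n 1 else dots n)"
        by (rule nf1_two_pairs[OF n d(1,4,3) a'(1) v'])
    qed
    moreover have "\<not> between a x y \<or> \<not> between a y x"
      unfolding between_def by linarith
    ultimately show thesis using ne by blast
  }
qed

lemma separation0:
  assumes n: "2 \<le> n"
    and e: "\<epsilon> \<in> family_projections n pl br" "diagram_rank \<epsilon> = 0" "normal_form0 \<epsilon> \<gamma>" "\<gamma> \<in> diagrams n"
    and d: "\<delta> \<in> family_projections n pl br" "diagram_rank \<delta> = 0" "normal_form0 \<delta> \<eta>" "\<eta> \<in> diagrams n"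
    and ne: "\<epsilon> \<noteq> \<delta>"
  obtains t P Q where "t \<in> diagram_family n pl br" "P \<noteq> Q"
    "diagram_mult n \<gamma> t = (if P then kappa n 0 else dots n)"
    "diagram_mult n \<eta> t = (if Q then kappa n 0 else dots n)"
proof -
  note E = family_projectionsD[OF e(1)] and D = family_projectionsD[OF d(1)]
  have "\<not> marked \<epsilon> i" for i by (rule rank_cases[OF E(2-5)]) (use e(2) in auto)
  moreover have "\<not> marked \<delta> i" for i by (rule rank_cases[OF D(2-5)]) (use d(2) in auto)
  ultimately obtain x' y' where xy': "ker \<epsilon> x' y' \<noteq> ker \<delta> x' y'"
    using ne projection_eqI[OF E(2-4) D(2-4)] by blast
  have "x' \<noteq> y'" using xy' rel_bounds[OF E(2)] rel_bounds[OF D(2)] rel_refl[OF E(2)] rel_refl[OF D(2)]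
    by (metis vertices_simps(2))
  \<comment> \<open>The order x < y keeps the strings from x to 1' and from y to 2' from
    crossing.\<close>
  then obtain x y where xy: "ker \<epsilon> x y \<noteq> ker \<delta> x y" "x < y"
    using xy' rel_sym by (metis linorder_neqE_nat)
  have i: "1 \<le> x" "x \<le> n" "1 \<le> y" "y \<le> n" using xy rel_bounds[OF E(2)] rel_bounds[OF D(2)] by blast+
  have ne: "x \<noteq> y" using xy by simp
  show thesis
  proof (rule that[OF _ xy(1)])
    show "two_pairs n (Upper x) (Lower 1) (Upper y) (Lower 2) \<in> diagram_family n pl br"
      by (rule two_pairs_in_family) (use i n xy(2) in \<open>auto simp: between_def\<close>)
  qed (rule nf0_two_pairs[OF n e(4,3) i ne] nf0_two_pairs[OF n d(4,3) i ne])+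
qed

lemma separation:
  assumes n: "2 \<le> n"
    and e: "\<epsilon> \<in> family_projections n pl br" "normal_form \<epsilon> \<gamma>" "\<gamma> \<in> diagrams n"
    and d: "\<delta> \<in> family_projections n pl br" "normal_form \<delta> \<eta>" "\<eta> \<in> diagrams n"
    and r: "diagram_rank \<epsilon> = diagram_rank \<delta>" and ne: "\<epsilon> \<noteq> \<delta>"
  obtains t P Q where "t \<in> diagram_family n pl br" "P \<noteq> Q"
    "diagram_mult n \<gamma> t = (if P then kappa n (diagram_rank \<epsilon>) else dots n)"
    "diagram_mult n \<eta> t = (if Q then kappa n (diagram_rank \<epsilon>) else dots n)"
proof -
  from e(2) consider "diagram_rank \<epsilon> = 0" "normal_form0 \<epsilon> \<gamma>" | "diagram_rank \<epsilon> = 1" "normal_form1 \<epsilon> \<gamma>"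
    | "diagram_rank \<epsilon> = 2" "normal_form2 \<epsilon> \<gamma>" unfolding normal_form_def by (elim disjE conjE)
  then show thesis
  proof cases
    case 1
    then have "diagram_rank \<delta> = 0" "normal_form0 \<delta> \<eta>" using r d(2) unfolding normal_form_def by auto
    then show thesis using separation0[OF n e(1) 1 e(3) d(1) _ _ d(3) ne] that 1(1) by metis
  next
    case 2
    then have "diagram_rank \<delta> = 1" "normal_form1 \<delta> \<eta>" using r d(2) unfolding normal_form_def by auto
    then show thesis using separation1[OF n e(1) 2 e(3) d(1) _ _ d(3) ne] that 2(1) by metis
  next
    case 3
    then have "diagram_rank \<delta> = 2" "normal_form2 \<delta> \<eta>" using r d(2) unfolding normal_form_def by auto
    then show thesis using separation2[OF n e(1) 3 e(3) d(1) _ _ d(3) ne] that 3(1) by metis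
  qed
qed

text \<open>Without transversals the upper pair survives every right factor, and the lower row of
  the product comes from t alone, where at most 1' may be joined to the upper row. Thus all tests of
  \<open>rank_test\<close> fix \<open>kappa n 2\<close>.\<close>

lemma kappa2_mult:
  assumes n: "2 \<le> n" and t: "t \<in> diagrams n"
    and "\<And>i. i \<noteq> 1 \<Longrightarrow> isolated t (Lower i)"
  shows "diagram_mult n (kappa n 2) t = kappa n 2"
proof -
  have v: "Upper 1 \<in> vertices n" "Upper 2 \<in> vertices n" using n by auto
  note r = rel_one_pair[OF v]
  have k: "kappa n 2 \<in> diagrams n" using kappa_in_family[OF n] family_imp_diagram by blast
  have iso: "isolated (diagram_mult n (kappa n 2) t) (Lower i)" for i
  proof (cases "i = 1")
    case True
    have "\<not> rel (kappa n 2) (Upper j) (Lower p)" for j p by (auto simp: kappa_simps r edge_def)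
    then have "\<not> rel (diagram_mult n (kappa n 2) t) (Lower 1) (Upper j)" for j
      unfolding rel_mult_cases[OF k t] by blast
    moreover have "j = 1" if "rel (diagram_mult n (kappa n 2) t) (Lower 1) (Lower j)" for j
      using isolated_mult(2)[OF k t, of j] assms(3)[of j] rel_sym[OF that] unfolding isolated_def by blast
    ultimately have "y = Lower 1" if "rel (diagram_mult n (kappa n 2) t) (Lower 1) y" for y
      using that rel_Middle[OF diagram_mult_in_diagrams] by (cases y) auto
    then show ?thesis using True unfolding isolated_def by blast
  qed (use isolated_mult(2)[OF k t] assms(3) in blast)
  have U: "isolated (kappa n 2) (Upper i)" if "i \<noteq> 1" "i \<noteq> 2" for i
    unfolding kappa_simps by (rule isolated_one_pair[OF v]) (use that in auto)
  have "rel (diagram_mult n (kappa n 2) t) (Upper 1) (Upper 2)"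
    unfolding rel_mult_cases[OF k t] by (simp add: kappa_simps r edge_def)
  moreover have "diagram_mult n (kappa n 2) t =
      (if rel (diagram_mult n (kappa n 2) t) (Upper 1) (Upper 2) then one_pair n (Upper 1) (Upper 2) else dots n)"
  proof (rule eq_one_pairI[OF diagram_mult_in_diagrams v])
    fix w assume "w \<in> vertices n" "w \<noteq> Upper 1" "w \<noteq> Upper 2"
    then show "isolated (diagram_mult n (kappa n 2) t) w"
      using iso isolated_mult(1)[OF k t U] by (cases w) auto
  qed
  ultimately show ?thesis by (simp only: kappa_simps if_True)
qed

text \<open>One string suffices: from u to 1' for rank 1, from u to v for rank 2. In the first case
  normal forms of smaller rank have an isolated upper row and t has only 1' left below; in the
  second they have only 1 left and the lower row of t is isolated. In both cases the product has
  nothing left to join.\<close>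

lemma rank_test:
  assumes n: "2 \<le> n" and e: "\<epsilon> \<in> family_projections n pl br" "normal_form \<epsilon> \<gamma>" "\<gamma> \<in> diagrams n"
    and r: "diagram_rank \<epsilon> \<noteq> 0"
  obtains t where "t \<in> diagram_family n pl br" "diagram_mult n \<gamma> t = kappa n (diagram_rank \<epsilon>)"
    "diagram_mult n (kappa n 2) t = kappa n 2" "diagram_mult n (dots n) t = dots n"
    "\<And>\<delta> \<eta>. \<eta> \<in> diagrams n \<Longrightarrow> normal_form \<delta> \<eta> \<Longrightarrow> diagram_rank \<delta> < diagram_rank \<epsilon> \<Longrightarrow>
      diagram_mult n \<eta> t = dots n"
proof -
  note E = family_projectionsD[OF e(1)]
  have n1: "1 \<le> n" using n by simp
  have dd: "dots n \<in> diagrams n" using dots_in_family[OF n1] family_imp_diagram by blast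
  show thesis
  proof (rule rank_cases[OF E(2-5)])
    fix u assume u: "diagram_rank \<epsilon> = 1" "marked \<epsilon> u"
    let ?t = "one_pair n (Upper u) (Lower 1)"
    have nf: "normal_form1 \<epsilon> \<gamma>" using e(2) u(1) unfolding normal_form_def by simp
    have b: "1 \<le> u" "u \<le> n" using marked_bounds[OF E(2) u(2)] .
    have v: "Upper u \<in> vertices n" "Lower 1 \<in> vertices n" using b n by auto
    have t: "?t \<in> diagrams n" using one_pair_in_family[OF v] family_imp_diagram by blast
    have iso: "isolated ?t (Lower i)" if "i \<noteq> 1" for i
      by (rule isolated_one_pair[OF v]) (use that in auto)
    show thesis
    proof (rule that[of ?t])
      show "?t \<in> diagram_family n pl br" by (rule one_pair_in_family[OF v])
      show "diagram_mult n \<gamma> ?t = kappa n (diagram_rank \<epsilon>)"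
        using nf1_one_pair[OF n e(1,3) nf b] u by simp
      show "diagram_mult n (kappa n 2) ?t = kappa n 2" by (rule kappa2_mult[OF n t iso])
      show "diagram_mult n (dots n) ?t = dots n"
        by (rule mult_dotsI'[OF n1 dd t]) (use iso isolated_dots[OF n1] in auto)
      fix \<delta> \<eta> assume "\<eta> \<in> diagrams n" "normal_form \<delta> \<eta>" "diagram_rank \<delta> < diagram_rank \<epsilon>"
      then show "diagram_mult n \<eta> ?t = dots n" using u iso
        by (intro mult_dotsI'[OF n1 _ t]) (auto simp: normal_form_def normal_form0_def)
    qed
  next
    fix u v assume u: "diagram_rank \<epsilon> = 2" "marked \<epsilon> u" "marked \<epsilon> v" "\<not> ker \<epsilon> u v"
    let ?t = "one_pair n (Upper u) (Upper v)"
    have nf: "normal_form2 \<epsilon> \<gamma>" using e(2) u(1) unfolding normal_form_def by simp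
    have b: "1 \<le> u" "u \<le> n" "1 \<le> v" "v \<le> n"
      using marked_bounds[OF E(2) u(2)] marked_bounds[OF E(2) u(3)] by auto
    have v: "Upper u \<in> vertices n" "Upper v \<in> vertices n" using b n by auto
    have t: "?t \<in> diagrams n" using one_pair_in_family[OF v] family_imp_diagram by blast
    have iso: "isolated ?t (Lower i)" for i
      by (rule isolated_one_pair[OF v]) auto
    show thesis
    proof (rule that[of ?t])
      show "?t \<in> diagram_family n pl br" by (rule one_pair_in_family[OF v])
      show "diagram_mult n \<gamma> ?t = kappa n (diagram_rank \<epsilon>)"
        using nf2_one_pair[OF n e(1,3) nf b] u by simp
      show "diagram_mult n (kappa n 2) ?t = kappa n 2" by (rule kappa2_mult[OF n t iso])
      show "diagram_mult n (dots n) ?t = dots n"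
        by (rule mult_dotsI'[OF n1 dd t]) (use iso isolated_dots[OF n1] in auto)
      fix \<delta> \<eta> assume "\<eta> \<in> diagrams n" "normal_form \<delta> \<eta>" "diagram_rank \<delta> < diagram_rank \<epsilon>"
      then show "diagram_mult n \<eta> ?t = dots n" using u iso
        by (intro mult_dotsI[OF n1 _ t]) (auto simp: normal_form_def normal_form0_def normal_form1_def)
    qed
  qed (use r in simp)
qed

lemma finite_family_projections: "finite (family_projections n pl br)"
  by (rule finite_subset[OF _ finite_diagrams[of n]])
    (auto simp: family_projections_def diagram_family_def)

subsection \<open>The lower bound\<close>

text \<open>The action is asked to respect products, while the identity may act as any idempotent
  map; this fits semigroup embeddings.\<close>

lemma faithful_action_lower_bound:
  fixes X :: "'x set" and act :: "'x \<Rightarrow> diagram \<Rightarrow> 'x"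
  assumes n: "2 \<le> n" and X: "finite X"
    and closed: "\<And>x a. x \<in> X \<Longrightarrow> a \<in> diagram_family n pl br \<Longrightarrow> act x a \<in> X"
    and act: "\<And>x a b. x \<in> X \<Longrightarrow> a \<in> diagram_family n pl br \<Longrightarrow> b \<in> diagram_family n pl br \<Longrightarrow>
      act x (diagram_mult n a b) = act (act x a) b"
    and faithful: "\<And>a b. a \<in> diagram_family n pl br \<Longrightarrow> b \<in> diagram_family n pl br \<Longrightarrow>
      (\<And>x. x \<in> X \<Longrightarrow> act x a = act x b) \<Longrightarrow> a = b"
  shows "1 + card (family_projections n pl br) \<le> card X"
proof -
  let ?F = "diagram_family n pl br" and ?Q = "family_projections n pl br"
  let ?w = "dots n"
  have n1: "1 \<le> n" using n by simp
  have w: "?w \<in> ?F" using dots_in_family[OF n1] .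
  have k: "kappa n r \<in> ?F" for r using kappa_in_family[OF n] .
  have "\<forall>r. \<exists>x\<in>X. act x (kappa n r) \<noteq> act x ?w"
    using faithful[OF k w] kappa_neq_dots[OF n] by blast
  then obtain p where p: "\<And>r. p r \<in> X" "\<And>r. act (p r) (kappa n r) \<noteq> act (p r) ?w" by metis
  have "\<forall>\<epsilon>\<in>?Q. \<exists>\<gamma>. \<gamma> \<in> ?F \<and> normal_form \<epsilon> \<gamma>" using normal_form_exists[OF n] by metis
  then obtain c where c: "\<And>\<epsilon>. \<epsilon> \<in> ?Q \<Longrightarrow> c \<epsilon> \<in> ?F" "\<And>\<epsilon>. \<epsilon> \<in> ?Q \<Longrightarrow> normal_form \<epsilon> (c \<epsilon>)" by metis
  have cd: "c \<epsilon> \<in> diagrams n" if "\<epsilon> \<in> ?Q" for \<epsilon> using c(1)[OF that] family_imp_diagram by blast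
  define y where "y \<epsilon> = act (p (diagram_rank \<epsilon>)) (c \<epsilon>)" for \<epsilon>
  have y: "act (y \<epsilon>) t = act (p (diagram_rank \<epsilon>)) (diagram_mult n (c \<epsilon>) t)"
    if "\<epsilon> \<in> ?Q" "t \<in> ?F" for \<epsilon> t
    unfolding y_def using act[OF p(1) c(1)[OF that(1)] that(2)] by simp
  \<comment> \<open>All points of one rank have the same image under \<open>dots n\<close>; the
    images under tests are compared with it.\<close>
  have yw: "act (y \<epsilon>) ?w = act (p (diagram_rank \<epsilon>)) ?w" if "\<epsilon> \<in> ?Q" for \<epsilon>
    using y[OF that w] normal_form_dots[OF n cd[OF that] c(2)[OF that]] by simp
  have same: "y \<epsilon> \<noteq> y \<delta>"
    if q: "\<epsilon> \<in> ?Q" "\<delta> \<in> ?Q" "diagram_rank \<epsilon> = diagram_rank \<delta>" "\<epsilon> \<noteq> \<delta>" for \<epsilon> \<delta>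
  proof (rule separation[OF n q(1) c(2)[OF q(1)] cd[OF q(1)] q(2) c(2)[OF q(2)] cd[OF q(2)] q(3,4)])
    fix t P Q assume t: "t \<in> ?F" "P \<noteq> Q"
      "diagram_mult n (c \<epsilon>) t = (if P then kappa n (diagram_rank \<epsilon>) else dots n)"
      "diagram_mult n (c \<delta>) t = (if Q then kappa n (diagram_rank \<epsilon>) else dots n)"
    have "act (y \<epsilon>) t \<noteq> act (y \<delta>) t"
      using y[OF q(1) t(1)] y[OF q(2) t(1)] t(2-4) q(3) p(2)[of "diagram_rank \<epsilon>"] by (cases P; cases Q) auto
    then show ?thesis by auto
  qed
  \<comment> \<open>The test for the larger rank agrees with \<open>dots n\<close> on the point of
    smaller rank but not on the other point.\<close>
  have less: "y \<epsilon> \<noteq> y \<delta>"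
    if q: "\<epsilon> \<in> ?Q" "\<delta> \<in> ?Q" "diagram_rank \<delta> < diagram_rank \<epsilon>" for \<epsilon> \<delta>
  proof (rule rank_test[OF n q(1) c(2)[OF q(1)] cd[OF q(1)]])
    show "diagram_rank \<epsilon> \<noteq> 0" using q(3) by simp
    fix t assume t: "t \<in> ?F" "diagram_mult n (c \<epsilon>) t = kappa n (diagram_rank \<epsilon>)"
      and l: "\<And>\<delta> \<eta>. \<eta> \<in> diagrams n \<Longrightarrow> normal_form \<delta> \<eta> \<Longrightarrow> diagram_rank \<delta> < diagram_rank \<epsilon> \<Longrightarrow>
        diagram_mult n \<eta> t = dots n"
    have "act (y \<epsilon>) t \<noteq> act (y \<epsilon>) ?w" using y[OF q(1) t(1)] yw[OF q(1)] t(2) p(2) by simp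
    moreover have "act (y \<delta>) t = act (y \<delta>) ?w"
      using y[OF q(2) t(1)] yw[OF q(2)] l[OF cd[OF q(2)] c(2)[OF q(2)] q(3)] by simp
    ultimately show ?thesis by auto
  qed
  have inj: "inj_on y ?Q"
  proof (rule inj_onI, rule ccontr)
    fix \<epsilon> \<delta> assume q: "\<epsilon> \<in> ?Q" "\<delta> \<in> ?Q" "y \<epsilon> = y \<delta>" "\<epsilon> \<noteq> \<delta>"
    then show False using same[of \<epsilon> \<delta>] less[of \<epsilon> \<delta>] less[of \<delta> \<epsilon>]
      by (metis linorder_neqE_nat)
  qed
  \<comment> \<open>The images of \<open>p 2\<close> under the two candidates differ, so at least
    one of them is not the image of \<open>p 0\<close> under \<open>dots n\<close>, to which
    \<open>dots n\<close> sends all points of rank 0.\<close>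
  obtain z where z: "z \<in> {kappa n 2, ?w}" "act (p 2) z \<noteq> act (p 0) ?w" using p(2)[of 2] by (metis insert_iff)
  have zF: "z \<in> ?F" using z(1) k[of 2] w by blast
  have zw: "diagram_mult n z ?w = z"
    using z(1) kappa2_mult[OF n family_imp_diagram[OF w] isolated_dots[OF n1]]
      mult_dotsI[OF n1 family_imp_diagram[OF w] family_imp_diagram[OF w] isolated_dots[OF n1] isolated_dots[OF n1]]
    by blast
  have ew: "act (act (p 2) z) ?w = act (p 2) z" using act[OF p(1) zF w] zw by simp
  have "act (p 2) z \<notin> y ` ?Q"
  proof
    assume "act (p 2) z \<in> y ` ?Q"
    then obtain \<epsilon> where q: "\<epsilon> \<in> ?Q" "act (p 2) z = y \<epsilon>" by auto
    \<comment> \<open>The further point is fixed by \<open>dots n\<close>, so it has not rank 0 by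
      the choice of z. For larger rank, a test and \<open>dots n\<close> differ on
      \<open_point>.\<close>
    show False
    proof (cases "diagram_rank \<epsilon> = 0")
      case True
      then show False using yw[OF q(1)] ew q(2) z(2) by simp
    next
      case False
      show False
      proof (rule rank_test[OF n q(1) c(2)[OF q(1)] cd[OF q(1)] False])
        fix t assume t: "t \<in> ?F" "diagram_mult n (c \<epsilon>) t = kappa n (diagram_rank \<epsilon>)"
          "diagram_mult n (kappa n 2) t = kappa n 2" "diagram_mult n ?w t = ?w"
        have "act (act (p 2) z) t = act (p 2) z" using act[OF p(1) zF t(1)] t(3,4) z(1) by auto
        moreover have "act (y \<epsilon>) t \<noteq> act (y \<epsilon>) ?w" using y[OF q(1) t(1)] yw[OF q(1)] t(2) p(2) by simp
        ultimately show False using ew q(2) by simp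
      qed
    qed
  qed
  then have "card (insert (act (p 2) z) (y ` ?Q)) = 1 + card ?Q"
    using finite_family_projections inj by (simp add: card_image)
  moreover have "insert (act (p 2) z) (y ` ?Q) \<subseteq> X"
    using closed p(1) zF c(1) unfolding y_def by blast
  ultimately show ?thesis using card_mono[OF X] by metis
qed

subsection \<open>An action with one more point than projections\<close>

text \<open>Merging the indices joined to 1 with those joined to 2 forgets only an exchange of 1 and
  2: outside \<open>None\<close> each of the two sets is empty or a kernel class, and they are
  disjoint. \<open>None\<close> is the sink, as right multiplication never separates 1 from
  2.\<close>

definition state :: "diagram \<Rightarrow> ((nat \<times> nat) set \<times> nat set) option" where
  "state \<alpha> = (if rel \<alpha> (Upper 1) (Upper 2) then None
    else Some ({(i, j). ker \<alpha> i j}, {i. rel \<alpha> (Upper 1) (Lower i) \<or> rel \<alpha> (Upper 2) (Lower i)}))"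

lemma state_eq_Some_iff:
  "state \<alpha> = Some (k, m) \<longleftrightarrow> \<not> rel \<alpha> (Upper 1) (Upper 2) \<and> k = {(i, j). ker \<alpha> i j} \<and>
     m = {i. rel \<alpha> (Upper 1) (Lower i) \<or> rel \<alpha> (Upper 2) (Lower i)}"
  by (auto simp: state_def)

lemma mid_cong: "(\<And>i j. ker \<alpha> i j \<longleftrightarrow> ker \<beta> i j) \<Longrightarrow> mid \<alpha> \<gamma> = mid \<beta> \<gamma>"
  by (simp add: mid_def)

text \<open>The right hand side depends on \<alpha> only through k, m and \<open>mid\<close>, and
  \<open>mid\<close> sees only the lower kernel of \<alpha>; so right multiplication acts on states.
  It joins 1 to 2 when it connects indices of m from different classes.\<close>

lemma state_mult_Some:
  assumes a: "\<alpha> \<in> diagrams n" and s: "\<sigma> \<in> diagrams n" and st: "state \<alpha> = Some (k, m)"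
  shows "state (diagram_mult n \<alpha> \<sigma>) =
    (if \<exists>p\<in>m. \<exists>q\<in>m. (p, q) \<notin> k \<and> (p, q) \<in> mid \<alpha> \<sigma> then None
     else Some ({(i, j). ker \<sigma> i j \<or>
        (\<exists>p q. rel \<sigma> (Lower i) (Upper p) \<and> (p, q) \<in> mid \<alpha> \<sigma> \<and> rel \<sigma> (Upper q) (Lower j))},
      {i. \<exists>p\<in>m. \<exists>q. (p, q) \<in> mid \<alpha> \<sigma> \<and> rel \<sigma> (Upper q) (Lower i)}))"
proof -
  have n12: "\<not> rel \<alpha> (Upper 1) (Upper 2)" and k: "(i, j) \<in> k \<longleftrightarrow> ker \<alpha> i j"
    and m: "i \<in> m \<longleftrightarrow> rel \<alpha> (Upper 1) (Lower i) \<or> rel \<alpha> (Upper 2) (Lower i)" for i j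
    using st by (auto simp: state_eq_Some_iff)
  note t = rel_trans[OF a]
  have "rel (diagram_mult n \<alpha> \<sigma>) (Upper 1) (Upper 2) \<longleftrightarrow>
      (\<exists>p\<in>m. \<exists>q\<in>m. (p, q) \<notin> k \<and> (p, q) \<in> mid \<alpha> \<sigma>)" (is "?L \<longleftrightarrow> ?R")
  proof
    assume ?L
    then obtain p q where pq: "rel \<alpha> (Upper 1) (Lower p)" "(p, q) \<in> mid \<alpha> \<sigma>" "rel \<alpha> (Lower q) (Upper 2)"
      using n12 by (auto simp: rel_mult_cases[OF a s])
    then have "(p, q) \<notin> k" using n12 t unfolding k by blast
    then show ?R using pq m rel_sym by blast
  next
    assume ?R
    then obtain p q where pq: "p \<in> m" "q \<in> m" "(p, q) \<notin> k" "(p, q) \<in> mid \<alpha> \<sigma>" by blast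
    \<comment> \<open>Were p and q both joined to 1, or both to 2, they would lie in one
      class.\<close>
    then have "rel \<alpha> (Upper 1) (Lower p) \<and> rel \<alpha> (Upper 2) (Lower q) \<or>
        rel \<alpha> (Upper 1) (Lower q) \<and> rel \<alpha> (Upper 2) (Lower p)"
      using t rel_sym unfolding m k by blast
    then show ?L unfolding rel_mult_cases[OF a s] using pq(4) mid_sym[OF pq(4)] rel_sym by blast
  qed
  moreover have "rel (diagram_mult n \<alpha> \<sigma>) (Upper 1) (Lower i) \<or> rel (diagram_mult n \<alpha> \<sigma>) (Upper 2) (Lower i) \<longleftrightarrow>
      (\<exists>p\<in>m. \<exists>q. (p, q) \<in> mid \<alpha> \<sigma> \<and> rel \<sigma> (Upper q) (Lower i))" for i
    unfolding rel_mult_cases[OF a s] Bex_def m by blast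
  ultimately show ?thesis
    by (simp add: state_def rel_mult_Lower_Lower[OF a s])
qed

lemma state_mult_None:
  assumes "\<alpha> \<in> diagrams n" "\<sigma> \<in> diagrams n" "state \<alpha> = None"
  shows "state (diagram_mult n \<alpha> \<sigma>) = None"
  using assms rel_mult_Upper_Upper[OF assms(1,2)] by (auto simp: state_def split: if_splits)

lemma state_mult_cong:
  assumes "\<alpha> \<in> diagrams n" "\<beta> \<in> diagrams n" "\<sigma> \<in> diagrams n" and eq: "state \<alpha> = state \<beta>"
  shows "state (diagram_mult n \<alpha> \<sigma>) = state (diagram_mult n \<beta> \<sigma>)"
proof (cases "state \<alpha>")
  case None
  then show ?thesis using state_mult_None assms by simp
next
  case (Some km)
  then obtain k m where km: "state \<alpha> = Some (k, m)" "state \<beta> = Some (k, m)"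
    using eq by (cases km) auto
  then have "ker \<alpha> i j \<longleftrightarrow> ker \<beta> i j" for i j by (auto simp: state_eq_Some_iff)
  then have "mid \<alpha> \<sigma> = mid \<beta> \<sigma>" by (rule mid_cong)
  then show ?thesis
    using state_mult_Some[OF assms(1,3) km(1)] state_mult_Some[OF assms(2,3) km(2)] by simp
qed

text \<open>Left factors serve as probes. After \<open>select_two\<close> the state is
  \<open>None\<close> iff u and v are joined; \<open>select_one\<close> isolates the upper vertex 2,
  so the state shows the lower kernel and the indices joined to u.\<close>

lemma state_faithful:
  assumes n: "2 \<le> n" and a: "\<alpha> \<in> diagram_family n pl br" and b: "\<beta> \<in> diagram_family n pl br"
    and eq: "\<And>\<gamma>. \<gamma> \<in> diagram_family n pl br \<Longrightarrow>
      state (diagram_mult n \<gamma> \<alpha>) = state (diagram_mult n \<gamma> \<beta>)"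
  shows "\<alpha> = \<beta>"
proof -
  note d = family_imp_diagram[OF a] family_imp_diagram[OF b]
  have n1: "1 \<le> n" using n by simp
  have UU': "rel \<alpha> (Upper u) (Upper v) \<longleftrightarrow> rel \<beta> (Upper u) (Upper v)"
    if uv: "1 \<le> u" "u < v" "v \<le> n" for u v
  proof -
    have "state (diagram_mult n (select_two n u v) \<delta>) = None \<longleftrightarrow> rel \<delta> (Upper u) (Upper v)"
      if "\<delta> \<in> diagrams n" for \<delta>
      using select_two_mult(1)[OF that n uv] by (simp add: state_def)
    then show ?thesis using eq[OF select_two_in_family[OF n uv]] d by metis
  qed
  have UU: "rel \<alpha> (Upper u) (Upper v) \<longleftrightarrow> rel \<beta> (Upper u) (Upper v)" for u v
  proof (cases "1 \<le> u \<and> u \<le> n \<and> 1 \<le> v \<and> v \<le> n")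
    case True
    then show ?thesis
      using UU'[of u v] UU'[of v u] rel_sym[of _ _ \<alpha>] rel_sym[of _ _ \<beta>] rel_refl[OF d(1)] rel_refl[OF d(2)]
      by (metis linorder_neqE_nat vertices_simps(1))
  next
    case False
    then show ?thesis using rel_bounds[OF d(1)] rel_bounds[OF d(2)] by blast
  qed
  have st: "state (diagram_mult n (select_one n u) \<delta>) =
      Some ({(i, j). ker \<delta> i j}, {i. rel \<delta> (Upper u) (Lower i)})"
    if "\<delta> \<in> diagrams n" "1 \<le> u" "u \<le> n" for u \<delta>
  proof -
    note s = select_one_mult[OF that(1) n1 that(2,3)]
    have "isolated (diagram_mult n (select_one n u) \<delta>) (Upper 2)" by (rule s(3)) simp
    then have "\<not> rel (diagram_mult n (select_one n u) \<delta>) (Upper 2) (Lower i)"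
      "\<not> rel (diagram_mult n (select_one n u) \<delta>) (Upper 1) (Upper 2)" for i
      unfolding isolated_def using rel_sym by fastforce+
    then show ?thesis by (simp add: state_def s)
  qed
  have "{(i, j). ker \<alpha> i j} = {(i, j). ker \<beta> i j} \<and>
      {i. rel \<alpha> (Upper u) (Lower i)} = {i. rel \<beta> (Upper u) (Lower i)}"
    if u: "1 \<le> u" "u \<le> n" for u
  proof -
    have "select_one n u \<in> diagram_family n pl br"
      by (rule one_pair_in_family) (use u n in auto)
    then show ?thesis using eq st[OF d(1) u] st[OF d(2) u] by force
  qed
  then have *: "(ker \<alpha> i j \<longleftrightarrow> ker \<beta> i j) \<and> (rel \<alpha> (Upper u) (Lower j) \<longleftrightarrow> rel \<beta> (Upper u) (Lower j))"
    if "1 \<le> u" "u \<le> n" for u i j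
    using that by blast
  have LL: "ker \<alpha> i j \<longleftrightarrow> ker \<beta> i j" for i j using *[of 1] n by simp
  have UL: "rel \<alpha> (Upper i) (Lower j) \<longleftrightarrow> rel \<beta> (Upper i) (Lower j)" for i j
    using * rel_bounds[OF d(1)] rel_bounds[OF d(2)] by blast
  then have LU: "rel \<alpha> (Lower j) (Upper i) \<longleftrightarrow> rel \<beta> (Lower j) (Upper i)" for i j
    using rel_sym by blast
  show ?thesis
  proof (rule diagram_eqI[OF d])
    show "rel \<alpha> x y \<longleftrightarrow> rel \<beta> x y" for x y
      using UU LL UL LU by (cases x; cases y) (auto simp: rel_Middle[OF d(1)] rel_Middle[OF d(2)])
  qed
qed

text \<open>The projection is \<open>diagram_star c\<close> times c, where c is \<alpha> with all
  upper vertices but 1 and 2 isolated. As 1 and 2 are not joined, the upper row of c is discrete.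
  Hence both rows of the product carry the lower kernel of \<alpha>, and its transversals come from
  1 and 2.\<close>

lemma state_imp_projection:
  assumes n: "2 \<le> n" and a: "\<alpha> \<in> diagram_family n pl br" and st: "state \<alpha> = Some (k, m)"
  obtains \<epsilon> where "\<epsilon> \<in> family_projections n pl br" "k = {(i, j). ker \<epsilon> i j}" "m = {i. marked \<epsilon> i}"
proof -
  note d = family_imp_diagram[OF a]
  note t = rel_trans[OF d]
  have n12: "\<not> rel \<alpha> (Upper 1) (Upper 2)" and k: "k = {(i, j). ker \<alpha> i j}"
    and m: "m = {i. rel \<alpha> (Upper 1) (Lower i) \<or> rel \<alpha> (Upper 2) (Lower i)}"
    using st by (auto simp: state_eq_Some_iff)
  have uv: "1 \<le> (1::nat)" "1 < (2::nat)" by auto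
  define c where "c = diagram_mult n (select_two n 1 2) \<alpha>"
  note s = select_two_mult[OF d n uv n, folded c_def]
  have cF: "c \<in> diagram_family n pl br"
    unfolding c_def by (rule diagram_family_mult[OF select_two_in_family[OF n uv n] a])
  note cd = family_imp_diagram[OF cF]
  note sF = diagram_family_star[OF cF]
  note sd = family_imp_diagram[OF sF]
  define \<epsilon> where "\<epsilon> = diagram_mult n (diagram_star c) c"
  have eF: "\<epsilon> \<in> diagram_family n pl br" unfolding \<epsilon>_def by (rule diagram_family_mult[OF sF cF])
  note ed = family_imp_diagram[OF eF]
  have small: "p = 1 \<or> p = 2" if "rel c (Upper p) y" "y \<noteq> Upper p" for p y
  proof -
    have "\<not> isolated c (Upper p)" using that unfolding isolated_def by blast
    then have "\<not> 3 \<le> p" using s(5) by blast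
    moreover have "1 \<le> p" using rel_bounds(1)[OF cd that(1)] by simp
    ultimately show ?thesis by linarith
  qed
  have disc: "p = q" if "rel c (Upper p) (Upper q)" for p q
  proof (rule ccontr)
    assume ne: "p \<noteq> q"
    then have "p = 1 \<or> p = 2" "q = 1 \<or> q = 2"
      using small[OF that] small[OF rel_sym[OF that]] by auto
    then show False using that rel_sym[OF that] ne s(1) n12 by auto
  qed
  have disc': "p = q" if "rel (diagram_star c) (Lower p) (Lower q)" for p q
    using that disc by (simp add: rel_star)
  have mid: "(p, q) \<in> mid (diagram_star c) c \<longleftrightarrow> p = q" for p q
    using mid_left[OF cd disc'] disc by blast
  have LL: "ker \<epsilon> i j \<longleftrightarrow> ker \<alpha> i j" for i j
    unfolding \<epsilon>_def s(4)[symmetric] by (rule rel_mult_discrete_left(2)[OF sd cd]) (rule disc')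
  have UU: "rel \<epsilon> (Upper i) (Upper j) \<longleftrightarrow> ker \<alpha> i j" for i j
    unfolding \<epsilon>_def rel_mult_cases[OF sd cd] mid rel_star flip_vertex.simps s(4)[symmetric]
    using rel_trans[OF cd] by blast
  have UL: "rel \<epsilon> (Upper i) (Lower j) \<longleftrightarrow> ker \<alpha> i j \<and> i \<in> m" for i j
  proof -
    have "rel \<epsilon> (Upper i) (Lower j) \<longleftrightarrow> (\<exists>p. rel c (Lower i) (Upper p) \<and> rel c (Upper p) (Lower j))"
      unfolding \<epsilon>_def
      by (subst rel_mult_discrete_left(1)[OF sd cd]) (use disc' in \<open>auto simp: rel_star\<close>)
    also have "\<dots> \<longleftrightarrow> (\<exists>p\<in>{1, 2}. rel c (Lower i) (Upper p) \<and> rel c (Upper p) (Lower j))"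
      using small by blast
    also have "\<dots> \<longleftrightarrow> ker c i j \<and> (rel c (Upper 1) (Lower i) \<or> rel c (Upper 2) (Lower i))"
      using rel_trans[OF cd] rel_sym[of _ _ c] by blast
    finally show ?thesis unfolding m s by simp
  qed
  then have LU: "rel \<epsilon> (Lower j) (Upper i) \<longleftrightarrow> ker \<alpha> i j \<and> i \<in> m" for i j
    using rel_sym by blast
  have m_closed: "j \<in> m" if "i \<in> m" "ker \<alpha> i j" for i j
    using that t unfolding m by blast
  \<comment> \<open>\<open>ker \<alpha>\<close> is reflexive only at the indices 1 to n; this covers
    the indices that occur.\<close>
  have refl: "ker \<alpha> i i" if "ker \<alpha> i j \<or> ker \<alpha> j i \<or> i \<in> m" for i j
    using that t rel_sym unfolding m by blast
  have star: "diagram_star \<epsilon> = \<epsilon>"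
  proof (rule diagram_eqI[OF family_imp_diagram[OF diagram_family_star[OF eF]] ed])
    show "rel (diagram_star \<epsilon>) x y \<longleftrightarrow> rel \<epsilon> x y" for x y
      using m_closed rel_sym[of _ _ \<alpha>]
      by (cases x; cases y) (auto simp: rel_star UU LL UL LU rel_Middle[OF ed])
  qed
  have idem: "diagram_mult n \<epsilon> \<epsilon> = \<epsilon>"
  proof (rule diagram_eqI[OF diagram_mult_in_diagrams ed])
    have mid': "(p, q) \<in> mid \<epsilon> \<epsilon> \<longleftrightarrow> p = q \<or> ker \<alpha> p q" for p q
    proof
      assume "(p, q) \<in> mid \<epsilon> \<epsilon>"
      then have "q \<in> {q. p = q \<or> ker \<alpha> p q}"
        by (rule mid_closed) (use t LL UU in blast)+
      then show "p = q \<or> ker \<alpha> p q" by simp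
    qed (use mid_lower[of p q \<epsilon> \<epsilon>] LL in auto)
    have 1: "rel (diagram_mult n \<epsilon> \<epsilon>) (Upper i) (Upper j) \<longleftrightarrow> ker \<alpha> i j" for i j
      unfolding rel_mult_cases[OF ed ed] mid' UU UL LU LL using t rel_sym by blast
    have 2: "rel (diagram_mult n \<epsilon> \<epsilon>) (Lower i) (Lower j) \<longleftrightarrow> ker \<alpha> i j" for i j
      unfolding rel_mult_cases[OF ed ed] mid' UU UL LU LL using t rel_sym by blast
    have 3: "rel (diagram_mult n \<epsilon> \<epsilon>) (Upper i) (Lower j) \<longleftrightarrow> ker \<alpha> i j \<and> i \<in> m" for i j
      unfolding rel_mult_cases[OF ed ed] mid' UU UL LU LL using t refl m_closed by blast
    have 4: "rel (diagram_mult n \<epsilon> \<epsilon>) (Lower j) (Upper i) \<longleftrightarrow> ker \<alpha> i j \<and> i \<in> m" for i j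
      using 3 rel_sym by blast
    show "rel (diagram_mult n \<epsilon> \<epsilon>) x y \<longleftrightarrow> rel \<epsilon> x y" for x y
      by (cases x; cases y)
        (simp_all add: 1 2 3 4 UU LL UL LU rel_Middle[OF ed] rel_Middle[OF diagram_mult_in_diagrams])
  qed
  have mk: "marked \<epsilon> i \<longleftrightarrow> i \<in> m" for i
    using UL[of i i] refl unfolding marked_def by blast
  have "diagram_rank \<epsilon> \<le> 2"
  proof -
    let ?b = "\<lambda>i. in_common_block \<epsilon> `` {Upper i}"
    have b: "?b i = ?b j" if "i \<in> m" "j \<in> m" "ker \<alpha> i j" for i j
      using block_eq_iff[OF ed idem star] that mk LL by blast
    \<comment> \<open>If p has no lower partner the value is arbitrary; the two-element set below is
      only an upper bound.\<close>
    define h where "h p = (SOME i. rel \<alpha> (Upper p) (Lower i))" for p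
    have h: "rel \<alpha> (Upper p) (Lower (h p))" if "rel \<alpha> (Upper p) (Lower i)" for p i
      unfolding h_def using that by (rule someI)
    have "transversals \<epsilon> \<subseteq> {?b (h 1), ?b (h 2)}"
    proof
      fix B assume "B \<in> transversals \<epsilon>"
      then obtain i where i: "i \<in> m" "B = ?b i" using transversals_eq[OF ed idem star] mk by auto
      then obtain p where p: "p \<in> {1, 2}" "rel \<alpha> (Upper p) (Lower i)" unfolding m by blast
      have "h p \<in> m" using h[OF p(2)] p(1) unfolding m by blast
      moreover have "ker \<alpha> i (h p)" using t rel_sym h[OF p(2)] p(2) by blast
      ultimately have "?b i = ?b (h p)" using b i by blast
      then show "B \<in> {?b (h 1), ?b (h 2)}" using i p by blast
    qed
    then have "card (transversals \<epsilon>) \<le> card {?b (h 1), ?b (h 2)}" by (intro card_mono) auto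
    also have "\<dots> \<le> 2" by (simp add: card_insert_if)
    finally show ?thesis by (simp add: diagram_rank_def)
  qed
  then have "\<epsilon> \<in> family_projections n pl br"
    using eF idem star by (simp add: family_projections_def)
  then show thesis using that LL mk k by auto
qed

text \<open>A state other than \<open>None\<close> consists of the kernel and the marked set of a
  projection. Upper bounds suffice here, since the lower bound for faithful actions forces
  equality.\<close>

lemma card_states:
  assumes "2 \<le> n"
  shows "finite (state ` diagram_family n pl br)"
    "card (state ` diagram_family n pl br - {None}) \<le> card (family_projections n pl br)"
    "card (state ` diagram_family n pl br) \<le> 1 + card (family_projections n pl br)"
proof -
  let ?Y = "state ` diagram_family n pl br"
  have "finite (diagram_family n pl br)"
    by (rule finite_subset[OF _ finite_diagrams[of n]]) (auto simp: diagram_family_def)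
  then show fin: "finite ?Y" by simp
  have "?Y - {None} \<subseteq> (\<lambda>\<epsilon>. Some ({(i, j). ker \<epsilon> i j}, {i. marked \<epsilon> i})) ` family_projections n pl br"
  proof
    fix y assume y: "y \<in> ?Y - {None}"
    then obtain k m where km: "y = Some (k, m)" by auto
    then obtain \<alpha> where "\<alpha> \<in> diagram_family n pl br" "state \<alpha> = Some (k, m)" using y by auto
    then show "y \<in> (\<lambda>\<epsilon>. Some ({(i, j). ker \<epsilon> i j}, {i. marked \<epsilon> i})) ` family_projections n pl br"
      using state_imp_projection[OF assms] km by blast
  qed
  then show c: "card (?Y - {None}) \<le> card (family_projections n pl br)"
    using finite_family_projections by (rule surj_card_le[rotated])
  show "card ?Y \<le> 1 + card (family_projections n pl br)"
    using c fin card_Diff1_le[of ?Y None] by (cases "None \<in> ?Y") auto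
qed

subsection \<open>Degrees\<close>

lemma finite_enumeration:
  assumes "finite X"
  obtains h g where "\<And>i. i \<in> {1..card X} \<Longrightarrow> h i \<in> X"
    "\<And>x. x \<in> X \<Longrightarrow> g x \<in> {1..card X}" "\<And>x. x \<in> X \<Longrightarrow> h (g x) = x"
proof -
  obtain h where h: "bij_betw h {1..card X} X"
    using ex_bij_betw_nat_finite_1[OF assms] by blast
  then have im: "h ` {1..card X} = X" by (simp add: bij_betw_def)
  show thesis
    by (rule that[of h "inv_into {1..card X} h"])
      (use im inv_into_into[of _ h "{1..card X}"] f_inv_into_f[of _ h "{1..card X}"] in blast)+
qed

lemma mon_full_transformation_of_action:
  fixes X :: "'x set" and act :: "'x \<Rightarrow> 'a \<Rightarrow> 'x"
  assumes X: "finite X"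
    and closed: "\<And>x a. x \<in> X \<Longrightarrow> a \<in> carrier M \<Longrightarrow> act x a \<in> X"
    and act: "\<And>x a b. x \<in> X \<Longrightarrow> a \<in> carrier M \<Longrightarrow> b \<in> carrier M \<Longrightarrow>
      act x (a \<otimes>\<^bsub>M\<^esub> b) = act (act x a) b"
    and faithful: "\<And>a b. a \<in> carrier M \<Longrightarrow> b \<in> carrier M \<Longrightarrow>
      (\<And>x. x \<in> X \<Longrightarrow> act x a = act x b) \<Longrightarrow> a = b"
  shows "mon M (full_transformation_monoid (card X)) \<noteq> {}"
proof -
  obtain h g where hX: "\<And>i. i \<in> {1..card X} \<Longrightarrow> h i \<in> X"
    and g: "\<And>x. x \<in> X \<Longrightarrow> g x \<in> {1..card X}" "\<And>x. x \<in> X \<Longrightarrow> h (g x) = x"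
    using finite_enumeration[OF X] by metis
  define f where "f a = (\<lambda>i\<in>{1..card X}. g (act (h i) a))" for a
  have "f \<in> hom M (full_transformation_monoid (card X))"
  proof (rule homI)
    fix a assume a: "a \<in> carrier M"
    show "f a \<in> carrier (full_transformation_monoid (card X))"
      unfolding full_transformation_monoid_def f_def
      using g(1) closed[OF hX a] by (simp add: PiE_def Pi_def)
    fix b assume b: "b \<in> carrier M"
    have "f (a \<otimes>\<^bsub>M\<^esub> b) i = compose {1..card X} (f b) (f a) i" for i
    proof (cases "i \<in> {1..card X}")
      case True
      have x: "act (h i) a \<in> X" using closed hX True a by blast
      show ?thesis using True g[OF x] act[OF hX[OF True] a b]
        by (simp add: f_def compose_def del: atLeastAtMost_iff)
    next
      case False
      then show ?thesis by (simp add: f_def compose_def del: atLeastAtMost_iff)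
    qed
    then show "f (a \<otimes>\<^bsub>M\<^esub> b) = f a \<otimes>\<^bsub>full_transformation_monoid (card X)\<^esub> f b"
      unfolding full_transformation_monoid_def by auto
  qed
  moreover have "inj_on f (carrier M)"
  proof (rule inj_onI)
    fix a b assume ab: "a \<in> carrier M" "b \<in> carrier M" "f a = f b"
    show "a = b"
    proof (rule faithful[OF ab(1,2)])
      fix x assume x: "x \<in> X"
      have "f a (g x) = f b (g x)" using ab(3) by simp
      then have "g (act x a) = g (act x b)"
        by (simp add: f_def g[OF x] del: atLeastAtMost_iff)
      then show "act x a = act x b" using g(2) closed[OF x] ab by metis
    qed
  qed
  ultimately show ?thesis by (auto simp: mon_def)
qed

text \<open>The sink z becomes the undefined value, which saves one point. All elements agree at z,
  so faithfulness is a matter of \<open>X\<close> alone.\<close>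

lemma mon_partial_transformation_of_action:
  fixes X :: "'x set" and act :: "'x \<Rightarrow> 'a \<Rightarrow> 'x"
  assumes X: "finite X" and z: "z \<notin> X"
    and closed: "\<And>x a. x \<in> X \<Longrightarrow> a \<in> carrier M \<Longrightarrow> act x a \<in> insert z X"
    and zero: "\<And>a. a \<in> carrier M \<Longrightarrow> act z a = z"
    and act: "\<And>x a b. x \<in> X \<Longrightarrow> a \<in> carrier M \<Longrightarrow> b \<in> carrier M \<Longrightarrow>
      act x (a \<otimes>\<^bsub>M\<^esub> b) = act (act x a) b"
    and faithful: "\<And>a b. a \<in> carrier M \<Longrightarrow> b \<in> carrier M \<Longrightarrow>
      (\<And>x. x \<in> X \<Longrightarrow> act x a = act x b) \<Longrightarrow> a = b"
  shows "mon M (partial_transformation_monoid (card X)) \<noteq> {}"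
proof -
  obtain h g where hX: "\<And>i. i \<in> {1..card X} \<Longrightarrow> h i \<in> X"
    and g: "\<And>x. x \<in> X \<Longrightarrow> g x \<in> {1..card X}" "\<And>x. x \<in> X \<Longrightarrow> h (g x) = x"
    using finite_enumeration[OF X] by metis
  define f where "f a i = (if i \<in> {1..card X} \<and> act (h i) a \<in> X then Some (g (act (h i) a)) else None)"
    for a i
  have "f \<in> hom M (partial_transformation_monoid (card X))"
  proof (rule homI)
    fix a assume a: "a \<in> carrier M"
    show "f a \<in> carrier (partial_transformation_monoid (card X))"
      unfolding partial_transformation_monoid_def f_def dom_def ran_def
      using g(1) by (auto split: if_splits)
    fix b assume b: "b \<in> carrier M"
    have "f (a \<otimes>\<^bsub>M\<^esub> b) i = (f b \<circ>\<^sub>m f a) i" for i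
    proof (cases "i \<in> {1..card X} \<and> act (h i) a \<in> X")
      case True
      then have i: "i \<in> {1..card X}" and x: "act (h i) a \<in> X" by blast+
      show ?thesis using i x g[OF x] act[OF hX[OF i] a b]
        by (simp add: f_def map_comp_def del: atLeastAtMost_iff)
    next
      case False
      have "f (a \<otimes>\<^bsub>M\<^esub> b) i = None"
      proof (cases "i \<in> {1..card X}")
        case True
        then have "act (h i) a = z" using False closed[OF hX[OF True] a] by blast
        then have "act (h i) (a \<otimes>\<^bsub>M\<^esub> b) = z" using act[OF hX[OF True] a b] zero[OF b] by simp
        then show ?thesis using z by (simp add: f_def)
      qed (simp add: f_def del: atLeastAtMost_iff)
      moreover have "f a i = None" using False by (auto simp add: f_def)
      ultimately show ?thesis by (simp add: map_comp_def)
    qed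
    then show "f (a \<otimes>\<^bsub>M\<^esub> b) = f a \<otimes>\<^bsub>partial_transformation_monoid (card X)\<^esub> f b"
      unfolding partial_transformation_monoid_def by auto
  qed
  moreover have "inj_on f (carrier M)"
  proof (rule inj_onI)
    fix a b assume ab: "a \<in> carrier M" "b \<in> carrier M" "f a = f b"
    show "a = b"
    proof (rule faithful[OF ab(1,2)])
      fix x assume x: "x \<in> X"
      have "f c (g x) = (if act x c \<in> X then Some (g (act x c)) else None)" for c
        unfolding f_def g(2)[OF x] using g(1)[OF x] by simp
      then have "(if act x a \<in> X then Some (g (act x a)) else None) =
          (if act x b \<in> X then Some (g (act x b)) else None)"
        using ab(3) by metis
      then show "act x a = act x b"
        using g(2) closed[OF x ab(1)] closed[OF x ab(2)] by (metis insertE option.inject option.distinct(1))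
    qed
  qed
  ultimately show ?thesis by (auto simp: mon_def)
qed

lemma class_action_eq:
  assumes s: "right_congruence M \<sigma>" and x: "x \<in> carrier M" and a: "a \<in> carrier M"
  shows "class_action M \<sigma> (\<sigma> `` {x}) a = \<sigma> `` {x \<otimes>\<^bsub>M\<^esub> a}"
proof -
  have eq: "equiv (carrier M) \<sigma>" using s by (simp add: right_congruence_def)
  have "\<sigma> `` {y \<otimes>\<^bsub>M\<^esub> a} = \<sigma> `` {x \<otimes>\<^bsub>M\<^esub> a}" if "y \<in> \<sigma> `` {x}" for y
  proof -
    have "(x \<otimes>\<^bsub>M\<^esub> a, y \<otimes>\<^bsub>M\<^esub> a) \<in> \<sigma>" using s that a unfolding right_congruence_def by blast
    then show ?thesis using equiv_class_eq[OF eq] by metis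
  qed
  moreover have "x \<in> \<sigma> `` {x}" using equiv_class_self[OF eq x] .
  ultimately show ?thesis unfolding class_action_def by blast
qed

text \<open>The lower bound, applied to the witness k itself, gives k = q. This replaces an exact
  count of the points of the witness.\<close>

lemma Least_eqI:
  fixes P :: "nat \<Rightarrow> bool"
  assumes "P k" "k \<le> q" "\<And>m. P m \<Longrightarrow> q \<le> m"
  shows "(LEAST m. P m) = q"
  using assms by (metis LeastI Least_le order.antisym order.trans)

lemma degrees_eq:
  fixes M :: "diagram monoid"
  assumes n: "2 \<le> n" and M: "carrier M = diagram_family n pl br" "mult M = diagram_mult n"
  defines "q \<equiv> card (family_projections n pl br)"
  shows "partial_transformation_degree M = q" "transformation_degree M = 1 + q"
    "right_congruence_degree M = 1 + q"
proof -
  let ?F = "diagram_family n pl br" and ?Y = "state ` diagram_family n pl br"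
  have assoc: "diagram_mult n (diagram_mult n a b) c = diagram_mult n a (diagram_mult n b c)"
    if "a \<in> ?F" "b \<in> ?F" "c \<in> ?F" for a b c
    using that diagram_mult_assoc family_imp_diagram by blast
  note lower = faithful_action_lower_bound[OF n, where pl = pl and br = br, folded q_def]
  note fin = card_states(1)[OF n, of pl br] and cardY = card_states(2,3)[OF n, of pl br, folded q_def]
  \<comment> \<open>Any representative will do: \<open>state_mult_cong\<close> makes the action
    independent of the choice.\<close>
  define rep where "rep y = (SOME a. a \<in> ?F \<and> state a = y)" for y
  have rep: "rep y \<in> ?F" "state (rep y) = y" if "y \<in> ?Y" for y
    unfolding rep_def using that someI_ex[of "\<lambda>a. a \<in> ?F \<and> state a = y"] by auto
  define act where "act y a = state (diagram_mult n (rep y) a)" for y a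
  have act_state: "act (state b) a = state (diagram_mult n b a)" if "b \<in> ?F" "a \<in> ?F" for a b
    unfolding act_def using that rep[of "state b"]
    by (intro state_mult_cong) (auto intro: family_imp_diagram)
  have closed: "act y a \<in> ?Y" if "y \<in> ?Y" "a \<in> carrier M" for y a
    unfolding act_def using that M diagram_family_mult rep(1) by blast
  have act: "act y (a \<otimes>\<^bsub>M\<^esub> b) = act (act y a) b" if y: "y \<in> ?Y" and ab: "a \<in> carrier M" "b \<in> carrier M" for y a b
  proof -
    obtain c where c: "c \<in> ?F" "y = state c" using y by blast
    note ab = ab[unfolded M(1)]
    show ?thesis unfolding c(2) M(2)
      using act_state[OF c(1)] act_state[OF diagram_family_mult[OF c(1) ab(1)]] ab
        diagram_family_mult[OF ab] assoc[OF c(1) ab] by simp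
  qed
  \<comment> \<open>The sink is fixed by every element and separates nothing, so the other states
    already act faithfully.\<close>
  have faithful: "a = b" if "a \<in> carrier M" "b \<in> carrier M" "\<And>y. y \<in> ?Y - {None} \<Longrightarrow> act y a = act y b" for a b
  proof (rule state_faithful[OF n])
    show ab: "a \<in> ?F" "b \<in> ?F" using that M by auto
    fix c assume c: "c \<in> ?F"
    show "state (diagram_mult n c a) = state (diagram_mult n c b)"
    proof (cases "state c = None")
      case True
      then show ?thesis
        using state_mult_None[OF family_imp_diagram[OF c]] ab family_imp_diagram by metis
    next
      case False
      then show ?thesis using that(3)[of "state c"] act_state[OF c] ab c by simp
    qed
  qed
  have zero: "act None a = None" if "None \<in> ?Y" "a \<in> carrier M" for a
    using that rep[of None] M unfolding act_def
    by (intro state_mult_None[of _ n]) (auto intro: family_imp_diagram)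
  \<comment> \<open>Degrees are at least 1 by definition, so the set of states must be nonempty even
    after \<open>None\<close> is removed.\<close>
  have dots: "state (dots n) \<in> ?Y - {None}"
  proof -
    have "state (dots n) \<noteq> None" using n by (simp add: state_def rel_dots)
    then show ?thesis using dots_in_family[of n] n by simp
  qed
  show "transformation_degree M = 1 + q"
    unfolding transformation_degree_def
  proof (rule Least_eqI)
    have "mon M (full_transformation_monoid (card ?Y)) \<noteq> {}"
      by (rule mon_full_transformation_of_action[where act = act, OF fin closed act faithful]) auto
    moreover have "card ?Y \<noteq> 0" using fin dots by auto
    ultimately show "1 \<le> card ?Y \<and> mon M (full_transformation_monoid (card ?Y)) \<noteq> {}"
      by (auto simp: One_nat_def)
    show "card ?Y \<le> 1 + q" by (rule cardY)
    fix m assume "1 \<le> m \<and> mon M (full_transformation_monoid m) \<noteq> {}"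
    then obtain f where f: "f \<in> hom M (full_transformation_monoid m)" "inj_on f (carrier M)"
      by (auto simp: mon_def)
    have fc: "f a \<in> {1..m} \<rightarrow>\<^sub>E {1..m}" if "a \<in> ?F" for a
      using hom_in_carrier[OF f(1)] that M by (simp add: full_transformation_monoid_def)
    have "1 + q \<le> card {1..m}"
    proof (rule lower[where act = "\<lambda>x a. f a x"])
      show "f a x \<in> {1..m}" if "x \<in> {1..m}" "a \<in> ?F" for x a using fc that by blast
      show "f (diagram_mult n a b) x = f b (f a x)" if "x \<in> {1..m}" "a \<in> ?F" "b \<in> ?F" for x a b
        using hom_mult[OF f(1), of a b] that M
        by (simp add: full_transformation_monoid_def compose_def)
      show "a = b" if "a \<in> ?F" "b \<in> ?F" "\<And>x. x \<in> {1..m} \<Longrightarrow> f a x = f b x" for a b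
      proof -
        have "f a = f b" using PiE_ext[OF fc[OF that(1)] fc[OF that(2)]] that(3) by blast
        then show ?thesis using f(2) that M by (auto dest: inj_onD)
      qed
    qed simp
    then show "1 + q \<le> m" by simp
  qed
  show "partial_transformation_degree M = q"
    unfolding partial_transformation_degree_def
  proof (rule Least_eqI)
    have "mon M (partial_transformation_monoid (card (?Y - {None}))) \<noteq> {}"
    \<comment> \<open>The value at \<open>None\<close> is set by hand, because
      \<open>act None\<close> rests on an unspecified representative unless \<open>None\<close> is a
      state.\<close>
    proof (rule mon_partial_transformation_of_action[where act = "\<lambda>y a. if y = None then None else act y a" and z = None])
      show "finite (?Y - {None})" using fin by simp
      show "(if y = None then None else act y a) \<in> insert None (?Y - {None})"
        if "y \<in> ?Y - {None}" "a \<in> carrier M" for y a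
        using closed[of y a] that by simp
      show "(if y = None then None else act y (a \<otimes>\<^bsub>M\<^esub> b)) =
          (if (if y = None then None else act y a) = None then None
           else act (if y = None then None else act y a) b)"
        if y: "y \<in> ?Y - {None}" and ab: "a \<in> carrier M" "b \<in> carrier M" for y a b
      proof -
        have "act None b = None" if "act y a = None"
          using closed[of y a] y ab that by (intro zero) auto
        then show ?thesis using act[of y a b] y ab by auto
      qed
      show "a = b" if "a \<in> carrier M" "b \<in> carrier M"
        "\<And>y. y \<in> ?Y - {None} \<Longrightarrow> (if y = None then None else act y a) = (if y = None then None else act y b)"
        for a b
      proof (rule faithful[OF that(1,2)])
        fix y assume y: "y \<in> ?Y - {None}"
        then have "y \<noteq> None" by simp
        then show "act y a = act y b" using that(3)[OF y] by (simp only: if_False)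
      qed
    qed simp_all
    moreover have "card (?Y - {None}) \<noteq> 0" using fin dots by auto
    ultimately show "1 \<le> card (?Y - {None}) \<and> mon M (partial_transformation_monoid (card (?Y - {None}))) \<noteq> {}"
      by (auto simp: One_nat_def)
    show "card (?Y - {None}) \<le> q" by (rule cardY)
    fix m assume "1 \<le> m \<and> mon M (partial_transformation_monoid m) \<noteq> {}"
    then obtain f where f: "f \<in> hom M (partial_transformation_monoid m)" "inj_on f (carrier M)"
      by (auto simp: mon_def)
    have fc: "dom (f a) \<subseteq> {1..m}" "ran (f a) \<subseteq> {1..m}" if "a \<in> ?F" for a
      using hom_in_carrier[OF f(1)] that M by (simp_all add: partial_transformation_monoid_def)
    \<comment> \<open>With \<open>None\<close> as a sink, partial maps on m points become total maps
      on m + 1 points, so the bound 1 + q yields q \<le> m.\<close>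
    have "1 + q \<le> card (insert None (Some ` {1..m}))"
    proof (rule lower[where act = "\<lambda>x a. Option.bind x (f a)"])
      show "Option.bind x (f a) \<in> insert None (Some ` {1..m})"
        if "x \<in> insert None (Some ` {1..m})" "a \<in> ?F" for x a
      proof (cases "Option.bind x (f a)")
        case (Some y)
        then have "y \<in> ran (f a)" by (auto simp: bind_eq_Some_conv ran_def)
        then show ?thesis using Some fc(2)[OF that(2)] by auto
      qed simp
      show "Option.bind x (f (diagram_mult n a b)) = Option.bind (Option.bind x (f a)) (f b)"
        if "x \<in> insert None (Some ` {1..m})" "a \<in> ?F" "b \<in> ?F" for x a b
        using hom_mult[OF f(1), of a b] that M
        by (cases x) (auto simp add: partial_transformation_monoid_def map_comp_def split: option.split)
      show "a = b" if ab: "a \<in> ?F" "b \<in> ?F"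
        and e: "\<And>x. x \<in> insert None (Some ` {1..m}) \<Longrightarrow> Option.bind x (f a) = Option.bind x (f b)" for a b
      proof -
        have "f a i = f b i" for i
        proof (cases "i \<in> {1..m}")
          case True
          then show ?thesis using e[of "Some i"] by simp
        next
          case False
          then have "f a i = None" "f b i = None" using fc(1) ab by (meson domIff subsetD)+
          then show ?thesis by simp
        qed
        then have "f a = f b" by blast
        then show ?thesis using f(2) ab M by (auto dest: inj_onD)
      qed
    qed simp
    also have "card (insert None (Some ` {1..m})) = Suc m"
      by (subst card_insert_disjoint) (auto simp: card_image)
    finally show "q \<le> m" by simp
  qed
  show "right_congruence_degree M = 1 + q"
    unfolding right_congruence_degree_def
  proof (rule Least_eqI)
    \<comment> \<open>The classes are the fibres of \<open>state\<close>, so there are no more of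
      them than states.\<close>
    define \<sigma> where "\<sigma> = {(a, b). a \<in> ?F \<and> b \<in> ?F \<and> state a = state b}"
    have \<sigma>: "right_congruence M \<sigma>"
      unfolding right_congruence_def
    proof (intro conjI)
      show "equiv (carrier M) \<sigma>"
        unfolding M(1) by (rule equivI) (auto simp: \<sigma>_def refl_on_def sym_def trans_def)
      show "\<forall>(a, b)\<in>\<sigma>. \<forall>s\<in>carrier M. (a \<otimes>\<^bsub>M\<^esub> s, b \<otimes>\<^bsub>M\<^esub> s) \<in> \<sigma>"
        using diagram_family_mult state_mult_cong family_imp_diagram unfolding M \<sigma>_def by blast
    qed
    have "faithful_action M (carrier M // \<sigma>) (class_action M \<sigma>)"
      unfolding faithful_action_def
    proof (rule inj_onI)
      fix a b assume ab: "a \<in> carrier M" "b \<in> carrier M"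
        and e: "(\<lambda>x\<in>carrier M // \<sigma>. class_action M \<sigma> x a) = (\<lambda>x\<in>carrier M // \<sigma>. class_action M \<sigma> x b)"
      have ab': "a \<in> ?F" "b \<in> ?F" using ab M by auto
      show "a = b"
      proof (rule state_faithful[OF n ab'])
        fix c assume c: "c \<in> ?F"
        have X: "\<sigma> `` {c} \<in> carrier M // \<sigma>" using c M by (auto intro: quotientI)
        have "class_action M \<sigma> (\<sigma> `` {c}) a = class_action M \<sigma> (\<sigma> `` {c}) b"
          using fun_cong[OF e, of "\<sigma> `` {c}"] X by simp
        then have "\<sigma> `` {diagram_mult n c a} = \<sigma> `` {diagram_mult n c b}"
          using class_action_eq[OF \<sigma>, of c] ab c M by simp
        moreover have "diagram_mult n c a \<in> \<sigma> `` {diagram_mult n c a}"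
          using diagram_family_mult[OF c ab'(1)] by (simp add: \<sigma>_def)
        ultimately show "state (diagram_mult n c a) = state (diagram_mult n c b)"
          by (auto simp: \<sigma>_def)
      qed
    qed
    with \<sigma> show "\<exists>\<sigma>'. right_congruence M \<sigma>' \<and> faithful_action M (carrier M // \<sigma>') (class_action M \<sigma>') \<and>
        card (carrier M // \<sigma>) = card (carrier M // \<sigma>')" by blast
    have "carrier M // \<sigma> \<subseteq> (\<lambda>y. {b \<in> ?F. y = state b}) ` ?Y"
      unfolding M(1) quotient_def \<sigma>_def by auto
    then have "card (carrier M // \<sigma>) \<le> card ?Y"
      using fin by (rule surj_card_le[rotated])
    then show "card (carrier M // \<sigma>) \<le> 1 + q" using cardY by simp
  next
    fix m assume "\<exists>\<sigma>. right_congruence M \<sigma> \<and> faithful_action M (carrier M // \<sigma>) (class_action M \<sigma>) \<and>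
        m = card (carrier M // \<sigma>)"
    then obtain \<sigma> where s: "right_congruence M \<sigma>"
      and fa: "faithful_action M (carrier M // \<sigma>) (class_action M \<sigma>)" and m: "m = card (carrier M // \<sigma>)"
      by blast
    have eq: "equiv (carrier M) \<sigma>" using s by (simp add: right_congruence_def)
    have finM: "finite (carrier M)"
      unfolding M(1) by (rule finite_subset[OF _ finite_diagrams[of n]]) (auto simp: diagram_family_def)
    have cl: "class_action M \<sigma> X a \<in> carrier M // \<sigma>" if X: "X \<in> carrier M // \<sigma>" and a: "a \<in> ?F" for X a
    proof -
      obtain x where x: "x \<in> carrier M" "X = \<sigma> `` {x}" using X by (auto elim: quotientE)
      then show ?thesis
        using class_action_eq[OF s x(1), of a] a diagram_family_mult[of x n pl br a] M
        by (simp add: quotientI)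
    qed
    show "1 + q \<le> m" unfolding m
    proof (rule lower[where act = "class_action M \<sigma>", OF _ cl])
      show "finite (carrier M // \<sigma>)" using finite_quotient[OF finM equiv_type[OF eq]] .
      show "class_action M \<sigma> X (diagram_mult n a b) = class_action M \<sigma> (class_action M \<sigma> X a) b"
        if X: "X \<in> carrier M // \<sigma>" and ab: "a \<in> ?F" "b \<in> ?F" for X a b
      proof -
        obtain x where x: "x \<in> carrier M" "X = \<sigma> `` {x}" using X by (auto elim: quotientE)
        then have xF: "x \<in> ?F" using M by simp
        show ?thesis
          using class_action_eq[OF s x(1), of "diagram_mult n a b"] class_action_eq[OF s x(1), of a]
            class_action_eq[OF s, of "diagram_mult n x a" b] ab xF M x(2)
            diagram_family_mult[OF ab] diagram_family_mult[OF xF ab(1)] assoc[OF xF ab] by simp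
      qed
      show "a = b" if ab: "a \<in> ?F" "b \<in> ?F"
        and e: "\<And>X. X \<in> carrier M // \<sigma> \<Longrightarrow> class_action M \<sigma> X a = class_action M \<sigma> X b" for a b
      proof -
        have "(\<lambda>x\<in>carrier M // \<sigma>. class_action M \<sigma> x a) = (\<lambda>x\<in>carrier M // \<sigma>. class_action M \<sigma> x b)"
          using e by (intro restrict_ext) blast
        then show ?thesis using fa ab M unfolding faithful_action_def by (auto dest: inj_onD)
      qed
    qed
  qed
qed

theorem theorem4p1:
  fixes n :: nat and M :: "diagram monoid"
  assumes "n \<ge> 2"
    and "M \<in> {partition_monoid n, partial_brauer_monoid n,
              planar_partition_monoid n, motzkin_monoid n}"
  shows "let Q = {\<epsilon> \<in> projections M. diagram_rank \<epsilon> \<le> 2} in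
           partial_transformation_degree M = card Q \<and>
           transformation_degree M = 1 + card Q \<and>
           right_congruence_degree M = 1 + card Q"
proof -
  have "carrier M \<in> {diagram_family n False False, diagram_family n False True,
      diagram_family n True False, diagram_family n True True}"
    using assms(2)
    by (auto simp: partition_monoid_def partial_brauer_monoid_def planar_partition_monoid_def
        motzkin_monoid_def diagram_family_def)
  then obtain pl br where C: "carrier M = diagram_family n pl br" by blast
  have mult: "mult M = diagram_mult n"
    using assms(2)
    by (auto simp: partition_monoid_def partial_brauer_monoid_def planar_partition_monoid_def
        motzkin_monoid_def)
  have "{\<epsilon> \<in> projections M. diagram_rank \<epsilon> \<le> 2} = family_projections n pl br"
    by (auto simp: projections_def family_projections_def C mult)
  then show ?thesis using degrees_eq[OF assms(1) C mult] by simp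
qed

end
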